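(* Let $\mathbb G$ be a homogeneous Carnot group, $1\le m\le l$, $\beta\in\mathbb R$, and $z=(\xi_1,\dots,\xi_m)$ (the first $m$ coordinates). (1) Let $1<p<\infty$ and $\Omega\subset\mathbb G$ open; if $m+\beta<0$ assume also $\Omega\subset(\mathbb R^m\setminus\{0\})\times\mathbb R^{N-m}$. Then for every $u\in C^1_0(\Omega)$, $$\Big(\frac{|m+\beta|}{p}\Big)^p\int_\Omega|u|^p|z|^\beta d\xi\le\int_\Omega|\nabla_Lu|^p|z|^{p+\beta}d\xi;$$ in particular $\big(\frac{|m-p|}{p}\big)^p\int_\Omega\frac{|u|^p}{N_S^p}d\xi\le\big(\frac{|m-p|}{p}\big)^p\int_\Omega\frac{|u|^p}{|z|^p}d\xi\le\int_\Omega|\nabla_Lu|^pd\xi$, and for any homogeneous norm $N$ and $p\ne m$ there is $c>0$ with $c\int_\Omega\frac{|u|^p}{N^p}d\xi\le\int_\Omega|\nabla_Lu|^pd\xi$ for all $u\in C^1_0(\Omega)$. (2) Let $p=m>1$, $R>0$, $\Omega=\{(z,\xi_{m+1},\dots,\xi_N):|z|<R\}$, $\beta<-1$. Then for every $u\in C^1_0(\Omega)$, $$\Big(\frac{|\beta+1|}{p}\Big)^p\int_\Omega\frac{|u|^p}{|z|^p}\Big(\ln\frac R{|z|}\Big)^\beta d\xi\le\int_\Omega|\nabla_Lu|^p\Big(\ln\frac R{|z|}\Big)^{p+\beta}d\xi,$$ in particular $\big(\frac{p-1}{p}\big)^p\int_\Omega\frac{|u|^p}{(|z|\ln(R/|z|))^p}d\xi\le\int_\Omega|\nabla_Lu|^pd\xi$.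 Moreover, if $\mathbb G$ is of H-type, $m=l$ and $(B^l_\rho\setminus\{0\})\times B^{N-l}_\rho\subset\Omega$ for some $\rho>0$, then the constants $(|m+\beta|/p)^p$ in (1) and $(|\beta+1|/p)^p$ in (2) are sharp.
   Context: A homogeneous Carnot group $\mathbb G=(\mathbb R^N,\circ,\delta_\lambda)$: $\mathbb R^N=\mathbb R^{n_1}\times\dots\times\mathbb R^{n_r}$, $\xi=(\xi^{(1)},\dots,\xi^{(r)})$, $\circ$ is a Lie group law on $\mathbb R^N$ for which the dilations $\delta_\lambda(\xi)=(\lambda\xi^{(1)},\lambda^2\xi^{(2)},\dots,\lambda^r\xi^{(r)})$ ($\lambda>0$) are group automorphisms; for $i=1,\dots,l:=n_1$, $X_i$ is the left-invariant vector field agreeing with $\partial/\partial\xi^{(1)}_i$ at the origin, and $X_1,\dots,X_l$ generate the whole Lie algebra of left-invariant vector fields. $\nabla_L=(X_1,\dots,X_l)^T$. A homogeneous norm is a continuous $N:\mathbb R^N\to[0,\infty)$ with $N(\xi^{-1})=N(\xi)$, $N(\xi)=0$ iff $\xi=0$, $N(\delta_\lambda\xi)=\lambda N(\xi)$; $N_S(\xi)=\big(\sum_{i=1}^r|\xi^{(i)}|^{2r!/i}\big)^{1/(2r!)}$. $\mathbb G$ is of H-type if it has step $2$, Lie algebra $V_1\oplus V_2$ with a scalar product on $V_1$, and the map $J:V_2\to\mathrm{End}(V_1)$ defined by $\langle J(\eta)\hat\xi,\tilde\xi\rangle=\langle[\hat\xi,\tilde\xi],\eta\rangle$ satisfies $J(\eta)^2=-|\eta|^2\mathrm{Id}$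 for all $\eta\in V_2$. $B^s_\rho$ is the Euclidean ball in $\mathbb R^s$ of radius $\rho$ centred at $0$. "Sharp" means the constant cannot be replaced by any larger one. *)

theory Defs
  imports "HOL-Analysis.Analysis"
begin

coinductive smooth_fun :: "('a::euclidean_space \<Rightarrow> real) \<Rightarrow> bool" where
  "continuous_on UNIV f \<Longrightarrow> f differentiable_on UNIV \<Longrightarrow>
   (\<And>v. smooth_fun (\<lambda>x. frechet_derivative f (at x) v)) \<Longrightarrow> smooth_fun f"

definition smooth_map :: "('a::euclidean_space \<Rightarrow> 'b::euclidean_space) \<Rightarrow> bool" where
  "smooth_map f \<longleftrightarrow> (\<forall>b\<in>Basis. smooth_fun (\<lambda>x. f x \<bullet> b))"

definition lie_group_law :: "('a::euclidean_space \<Rightarrow> 'a \<Rightarrow> 'a) \<Rightarrow> bool" where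
  "lie_group_law op \<longleftrightarrow>
     (\<forall>x y z. op (op x y) z = op x (op y z)) \<and>
     (\<exists>e inv. (\<forall>x. op e x = x \<and> op x e = x) \<and> (\<forall>x. op x (inv x) = e \<and> op (inv x) x = e)
        \<and> smooth_map inv) \<and>
     smooth_map (\<lambda>(x, y). op x y)"

definition gunit :: "('a \<Rightarrow> 'a \<Rightarrow> 'a) \<Rightarrow> 'a" where
  "gunit op = (THE e. \<forall>x. op e x = x \<and> op x e = x)"

definition ginv :: "('a \<Rightarrow> 'a \<Rightarrow> 'a) \<Rightarrow> 'a \<Rightarrow> 'a" where
  "ginv op x = (THE y. op x y = gunit op \<and> op y x = gunit op)"

text \<open>Coordinates are indexed by a finite linearly ordered type; \<open>deg i\<close> is the layer
  (homogeneity degree) of coordinate \<open>i\<close>; monotonicity of \<open>deg\<close> encodes the block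
  decomposition R^N = R^{n_1} x ... x R^{n_r} in the coordinate order.\<close>

definition dil :: "('n::finite \<Rightarrow> nat) \<Rightarrow> real \<Rightarrow> (real, 'n) vec \<Rightarrow> (real, 'n) vec" where
  "dil deg s x = (\<chi> i. s ^ deg i * x $ i)"

text \<open>Left-invariant vector field with value \<open>a\<close> at the origin: X(x) = d(L_x)_0 a.\<close>
definition lvf :: "('a::euclidean_space \<Rightarrow> 'a \<Rightarrow> 'a) \<Rightarrow> 'a \<Rightarrow> 'a \<Rightarrow> 'a" where
  "lvf op a x = frechet_derivative (\<lambda>y. op x y) (at 0) a"

definition vf_bracket :: "('a::euclidean_space \<Rightarrow> 'a) \<Rightarrow> ('a \<Rightarrow> 'a) \<Rightarrow> 'a \<Rightarrow> 'a" where
  "vf_bracket X Y x = frechet_derivative Y (at x) (X x) - frechet_derivative X (at x) (Y x)"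

inductive_set brackets :: "('a::euclidean_space \<Rightarrow> 'a \<Rightarrow> 'a) \<Rightarrow> 'a set \<Rightarrow> ('a \<Rightarrow> 'a) set"
  for op A where
  gen: "a \<in> A \<Longrightarrow> lvf op a \<in> brackets op A"
| br: "X \<in> brackets op A \<Longrightarrow> Y \<in> brackets op A \<Longrightarrow> vf_bracket X Y \<in> brackets op A"

definition layer :: "('n \<Rightarrow> nat) \<Rightarrow> nat \<Rightarrow> 'n set" where
  "layer deg k = {i. deg i = k}"

text \<open>Homogeneous Carnot group (R^N, op, dil). The Lie algebra of left-invariant fields
  is identified with R^N by evaluation at the origin, so "X_1..X_l generate the Lie algebra"
  means that the values at 0 of all iterated brackets of X_1..X_l span R^N.\<close>
definition hcarnot :: "((real, 'n::{finite,linorder}) vec \<Rightarrow> (real, 'n) vec \<Rightarrow> (real, 'n) vec) \<Rightarrow> ('n \<Rightarrow> nat) \<Rightarrow> bool" where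
  "hcarnot op deg \<longleftrightarrow>
     lie_group_law op \<and> (\<forall>i. 1 \<le> deg i) \<and> mono deg \<and>
     (\<forall>s>0. \<forall>x y. dil deg s (op x y) = op (dil deg s x) (dil deg s y)) \<and>
     span ((\<lambda>X. X 0) ` brackets op {axis i 1 | i. i \<in> layer deg 1}) = UNIV"

definition Xop :: "((real, 'n::finite) vec \<Rightarrow> (real, 'n) vec \<Rightarrow> (real, 'n) vec) \<Rightarrow> 'n \<Rightarrow> ((real, 'n) vec \<Rightarrow> real) \<Rightarrow> (real, 'n) vec \<Rightarrow> real" where
  "Xop op i u x = frechet_derivative u (at x) (lvf op (axis i 1) x)"

definition hgrad_norm :: "((real, 'n::finite) vec \<Rightarrow> (real, 'n) vec \<Rightarrow> (real, 'n) vec) \<Rightarrow> ('n \<Rightarrow> nat) \<Rightarrow> ((real, 'n) vec \<Rightarrow> real) \<Rightarrow> (real, 'n) vec \<Rightarrow> real" where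
  "hgrad_norm op deg u x = sqrt (\<Sum>i\<in>layer deg 1. (Xop op i u x)\<^sup>2)"

definition zidx :: "nat \<Rightarrow> 'n::{finite,linorder} set" where
  "zidx m = {i. card {j. j < i} < m}"

definition znorm :: "nat \<Rightarrow> (real, 'n::{finite,linorder}) vec \<Rightarrow> real" where
  "znorm m x = sqrt (\<Sum>i\<in>zidx m. (x $ i)\<^sup>2)"

definition restnorm :: "nat \<Rightarrow> (real, 'n::{finite,linorder}) vec \<Rightarrow> real" where
  "restnorm m x = sqrt (\<Sum>i\<in>- zidx m. (x $ i)\<^sup>2)"

definition blocknorm :: "('n::finite \<Rightarrow> nat) \<Rightarrow> nat \<Rightarrow> (real, 'n) vec \<Rightarrow> real" where
  "blocknorm deg k x = sqrt (\<Sum>i\<in>layer deg k. (x $ i)\<^sup>2)"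

definition NS :: "('n::finite \<Rightarrow> nat) \<Rightarrow> (real, 'n) vec \<Rightarrow> real" where
  "NS deg x = (let r = Max (range deg) in
     (\<Sum>k\<in>{1..r}. blocknorm deg k x powr (2 * fact r / real k)) powr (1 / (2 * fact r)))"

definition hom_norm :: "((real, 'n::finite) vec \<Rightarrow> (real, 'n) vec \<Rightarrow> (real, 'n) vec) \<Rightarrow> ('n \<Rightarrow> nat) \<Rightarrow> ((real, 'n) vec \<Rightarrow> real) \<Rightarrow> bool" where
  "hom_norm op deg Nf \<longleftrightarrow> continuous_on UNIV Nf \<and> (\<forall>x. 0 \<le> Nf x) \<and>
     (\<forall>x. Nf (ginv op x) = Nf x) \<and> (\<forall>x. Nf x = 0 \<longleftrightarrow> x = 0) \<and>
     (\<forall>s>0. \<forall>x. Nf (dil deg s x) = s * Nf x)"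

definition C1_0 :: "'a::euclidean_space set \<Rightarrow> ('a \<Rightarrow> real) set" where
  "C1_0 \<Omega> = {u. (\<exists>u'. (\<forall>x. (u has_derivative blinfun_apply (u' x)) (at x)) \<and> continuous_on UNIV u')
                 \<and> compact (closure {x. u x \<noteq> 0}) \<and> closure {x. u x \<noteq> 0} \<subseteq> \<Omega>}"

definition lie_br :: "('a::euclidean_space \<Rightarrow> 'a \<Rightarrow> 'a) \<Rightarrow> 'a \<Rightarrow> 'a \<Rightarrow> 'a" where
  "lie_br op a b = vf_bracket (lvf op a) (lvf op b) 0"

definition layer_space :: "('n::finite \<Rightarrow> nat) \<Rightarrow> nat \<Rightarrow> ((real, 'n) vec) set" where
  "layer_space deg k = {a. \<forall>i. deg i \<noteq> k \<longrightarrow> a $ i = 0}"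

definition is_scalar_product :: "'a::real_vector set \<Rightarrow> ('a \<Rightarrow> 'a \<Rightarrow> real) \<Rightarrow> bool" where
  "is_scalar_product V ip \<longleftrightarrow>
     (\<forall>x\<in>V. \<forall>y\<in>V. ip x y = ip y x) \<and>
     (\<forall>x\<in>V. \<forall>y\<in>V. \<forall>z\<in>V. \<forall>c. ip (c *\<^sub>R x + y) z = c * ip x z + ip y z) \<and>
     (\<forall>x\<in>V. x \<noteq> 0 \<longrightarrow> 0 < ip x x)"

definition htype :: "((real, 'n::{finite,linorder}) vec \<Rightarrow> (real, 'n) vec \<Rightarrow> (real, 'n) vec) \<Rightarrow> ('n \<Rightarrow> nat) \<Rightarrow> bool" where
  "htype op deg \<longleftrightarrow> hcarnot op deg \<and> (\<forall>i. deg i \<in> {1, 2}) \<and> (\<exists>i. deg i = 2) \<and>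
     (\<exists>ip1 ip2 J.
        is_scalar_product (layer_space deg 1) ip1 \<and> is_scalar_product (layer_space deg 2) ip2 \<and>
        (\<forall>\<eta>\<in>layer_space deg 2. \<forall>x\<in>layer_space deg 1.
            J \<eta> x \<in> layer_space deg 1 \<and>
            (\<forall>y\<in>layer_space deg 1. ip1 (J \<eta> x) y = ip2 (lie_br op x y) \<eta>) \<and>
            J \<eta> (J \<eta> x) = - (ip2 \<eta> \<eta>) *\<^sub>R x))"

end

(*
  Let z be the first m coordinates. Homogeneity of the group law makes each X_i divergence free, and on functions
  of z it acts as the i-th partial derivative for i <= m (and as 0 for i > m). Hence for a field h = z q(|z|^2) with
  div h = D >= 0 one has int |u|^p D = - p int |u|^(p-2) u <grad_L u, h>, and if |h|^p <= D^(p-1) W then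
  Young's inequality gives int |u|^p D <= p^p int |grad_L u|^p W. Both Hardy inequalities are instances,
  with h = z |z|^(-m) G and G = |z|^(m+beta) or G = ln(R/|z|)^(beta+1) up to sign and constants; where h is
  singular at z = 0, G is first truncated near 0.

  For sharpness, u = G^(-1/p) times a plateau in a logarithmic clock (ln |z|, resp. ln ln(R/|z|)) times a cutoff in
  the other coordinates makes all remaining terms lower order.
*)
theory Submission
  imports Defs
begin

section \<open>Compactly supported \<open>C\<^sup>1\<close> functions\<close>

text \<open>The factor z |z|^(-m) is divergence free off z = 0, so div h contains only the radial
  derivative of G, and \<open>W\<close> is found by requiring equality in |h|^p = D^(p-1) W. The
  obstacle is z = 0, where test functions need not vanish while h is not C^1. The truncation is a
  composition with \<open>cutoff_id\<close>, which keeps |h|^p \<le> D^(p-1) W for every \<epsilon>;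
  the constant is therefore already the final one and Fatou's lemma removes \<epsilon>. Profiles are
  written in s = |z|^2, a smooth function also at z = 0. Young's term in |u|^p is absorbed pointwise
  before integrating, so the right-hand integral may be infinite.

  For sharpness both inequalities share one argument: with -d\<tau> = k d|z|, the measure k
  |z|^(1-m) dx becomes a multiple of d\<tau>, and G^(-1/p) becomes exp (\<kappa> \<tau>) with
  |\<kappa>|^p the claimed constant.

  \<open>has_C1_derivative\<close> asks continuity of the derivative one direction at a time; in
  finite dimension this is C^1, and it avoids operator norms.\<close>

definition has_C1_derivative ::
    "('a::euclidean_space \<Rightarrow> real) \<Rightarrow> ('a \<Rightarrow> 'a \<Rightarrow> real) \<Rightarrow> bool" where
  "has_C1_derivative f f' \<longleftrightarrow>
     (\<forall>x. (f has_derivative f' x) (at x)) \<and> (\<forall>e. continuous_on UNIV (\<lambda>x. f' x e))"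

lemma has_C1_derivativeD:
  assumes "has_C1_derivative f f'"
  shows "(f has_derivative f' x) (at x)" "continuous_on A (\<lambda>x. f' x e)"
    "continuous_on A f" "frechet_derivative f (at x) = f' x"
proof -
  show *: "\<And>x. (f has_derivative f' x) (at x)" using assms by (auto simp: has_C1_derivative_def)
  show "continuous_on A (\<lambda>x. f' x e)"
    using assms by (auto simp: has_C1_derivative_def intro: continuous_on_subset)
  show "continuous_on A f"
    using * by (intro continuous_at_imp_continuous_on ballI has_derivative_continuous) blast
  show "frechet_derivative f (at x) = f' x" using * by (metis frechet_derivative_at)
qed

lemma continuous_on_glue:
  fixes g :: "'a::topological_space \<Rightarrow> real"
  assumes "closed K" "open U" "K \<subseteq> U" "continuous_on U g" "\<And>x. x \<in> U \<Longrightarrow> x \<notin> K \<Longrightarrow> g x = 0"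
  shows "continuous_on UNIV (\<lambda>x. if x \<in> U then g x else 0)"
proof -
  have 1: "continuous_on U (\<lambda>x. if x \<in> U then g x else 0)"
    using assms(4) by (rule continuous_on_cong[THEN iffD1, rotated 2]) auto
  have 2: "continuous_on (- K) (\<lambda>x. if x \<in> U then g x else 0)"
    by (rule continuous_on_cong[THEN iffD1, OF refl _ continuous_on_const[of _ 0]])
       (use assms in auto)
  have "continuous_on (U \<union> - K) (\<lambda>x. if x \<in> U then g x else 0)"
    by (rule continuous_on_open_Un) (use assms 1 2 in auto)
  moreover have "U \<union> - K = UNIV" using assms by auto
  ultimately show ?thesis by simp
qed

text \<open>For products of a test function supported in \<open>K\<close> with a factor regular only
  on \<open>U\<close>, such as a weight singular at z = 0. On \<open>U\<close> the derivative
  formula holds, off \<open>K\<close> the function is locally 0, and uniqueness of derivatives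
  forces \<open>f'\<close> to vanish on the overlap, which gives continuity of the
  extension.\<close>

lemma has_C1_derivative_glue:
  fixes f :: "'a::euclidean_space \<Rightarrow> real"
  assumes "closed K" "open U" "K \<subseteq> U" and zero: "\<And>x. x \<notin> K \<Longrightarrow> f x = 0"
    and der: "\<And>x. x \<in> U \<Longrightarrow> (f has_derivative f' x) (at x)"
    and cont: "\<And>e. continuous_on U (\<lambda>x. f' x e)"
  shows "has_C1_derivative f (\<lambda>x e. if x \<in> U then f' x e else 0)"
proof -
  have out: "(f has_derivative (\<lambda>_. 0)) (at x)" if "x \<notin> K" for x
  proof (rule has_derivative_transform_within_open[where f = "\<lambda>_. 0" and s = "- K"])
    show "open (- K)" using assms by auto
  qed (use that zero in auto)
  have "(f has_derivative (\<lambda>e. if x \<in> U then f' x e else 0)) (at x)" for x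
    using der[of x] out[of x] \<open>K \<subseteq> U\<close> by (cases "x \<in> U") auto
  moreover have "continuous_on UNIV (\<lambda>x. if x \<in> U then f' x e else 0)" for e
  proof -
    have "f' x e = 0" if "x \<in> U" "x \<notin> K" for x
      using has_derivative_unique[OF der[OF that(1)] out[OF that(2)]] by simp
    thus ?thesis by (intro continuous_on_glue[OF assms(1-3)] cont)
  qed
  ultimately show ?thesis by (auto simp: has_C1_derivative_def)
qed

lemma has_C1_derivative_mult:
  assumes "has_C1_derivative f f'" "has_C1_derivative g g'"
  shows "has_C1_derivative (\<lambda>x. f x * g x) (\<lambda>x e. f x * g' x e + f' x e * g x)"
  unfolding has_C1_derivative_def
  by (intro conjI allI has_derivative_mult continuous_intros
      has_C1_derivativeD[OF assms(1)] has_C1_derivativeD[OF assms(2)])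

lemma has_C1_derivative_chain:
  assumes "has_C1_derivative f f'"
    and "\<And>t. (\<phi> has_real_derivative \<phi>' t) (at t)" "continuous_on UNIV \<phi>'"
  shows "has_C1_derivative (\<lambda>x. \<phi> (f x)) (\<lambda>x e. \<phi>' (f x) * f' x e)"
  unfolding has_C1_derivative_def
proof (intro conjI allI)
  show "((\<lambda>x. \<phi> (f x)) has_derivative (\<lambda>e. \<phi>' (f x) * f' x e)) (at x)" for x
    using has_derivative_compose[OF has_C1_derivativeD(1)[OF assms(1)]
        assms(2)[of "f x", unfolded has_field_derivative_def]] by (simp add: o_def)
  show "continuous_on UNIV (\<lambda>x. \<phi>' (f x) * f' x e)" for e
    by (intro continuous_intros has_C1_derivativeD[OF assms(1)]
        continuous_on_compose2[OF assms(3)]) auto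
qed

lemma has_C1_derivative_zero_outside:
  assumes "has_C1_derivative f f'" "closed K" "\<And>x. x \<notin> K \<Longrightarrow> f x = 0" "x \<notin> K"
  shows "f' x e = 0"
proof -
  have "(f has_derivative (\<lambda>_. 0)) (at x)"
    by (rule has_derivative_transform_within_open[where f = "\<lambda>_. 0" and s = "- K"])
       (use assms in auto)
  from has_derivative_unique[OF has_C1_derivativeD(1)[OF assms(1)] this] show ?thesis by simp
qed

lemma integrable_compact_support:
  fixes f :: "'a::euclidean_space \<Rightarrow> real"
  assumes "continuous_on UNIV f" "compact K" "\<And>x. x \<notin> K \<Longrightarrow> f x = 0"
  shows "integrable lborel f"
proof -
  have "integrable lborel (\<lambda>x. indicator K x *\<^sub>R f x)"
    by (intro borel_integrable_compact assms) (use assms in \<open>auto intro: continuous_on_subset\<close>)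
  also have "(\<lambda>x. indicator K x *\<^sub>R f x) = f"
    using assms by (auto simp: indicator_def fun_eq_iff)
  finally show ?thesis .
qed

text \<open>Translation invariance of Lebesgue measure makes every difference quotient of
  \<open>w\<close> integrate to 0; these quotients converge to the derivative under a common bound
  on one fixed ball.\<close>

lemma integral_partial_derivative_zero:
  fixes w :: "'a::euclidean_space \<Rightarrow> real"
  assumes w: "has_C1_derivative w w'" and K: "compact K" and zero: "\<And>x. x \<notin> K \<Longrightarrow> w x = 0"
  shows "integral\<^sup>L lborel (\<lambda>x. w' x e) = 0"
proof -
  have wi: "integrable lborel w"
    by (rule integrable_compact_support[OF has_C1_derivativeD(3)[OF w] K zero])
  define t where "t n = inverse (real (Suc n))" for n
  have t: "0 < t n" "t n \<le> 1" for n by (auto simp: t_def field_simps)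
  have t0: "t \<longlonglongrightarrow> 0" unfolding t_def by (rule LIMSEQ_inverse_real_of_nat)
  define D where "D n x = (w (x + t n *\<^sub>R e) - w x) / t n" for n x
  have shift: "integrable lborel (\<lambda>x. w (x + c)) \<and> integral\<^sup>L lborel (\<lambda>x. w (x + c)) = integral\<^sup>L lborel w" for c
  proof -
    have m: "w \<in> borel_measurable borel" using wi by auto
    have "integrable (distr lborel borel ((+) c)) w" using wi by (simp add: lborel_distr_plus)
    hence "integrable lborel (\<lambda>x. w (c + x))" by (subst (asm) integrable_distr_eq) (use m in auto)
    moreover have "integral\<^sup>L (distr lborel borel ((+) c)) w = integral\<^sup>L lborel (\<lambda>x. w (c + x))"
      by (rule integral_distr) (use m in auto)
    ultimately show ?thesis by (simp add: lborel_distr_plus add.commute)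
  qed
  have D0: "integral\<^sup>L lborel (D n) = 0" for n
    using shift[of "t n *\<^sub>R e"] wi unfolding D_def by (subst integral_divide_zero) simp
  have lim: "(\<lambda>n. D n x) \<longlonglongrightarrow> w' x e" for x
  proof -
    have "((\<lambda>h. (w (x + h *\<^sub>R e) - w x) / h) \<longlongrightarrow> w' x e) (at 0)"
    proof -
      have "((\<lambda>h. w (x + h *\<^sub>R e)) has_derivative (\<lambda>h. w' x (h *\<^sub>R e))) (at 0)"
        by (rule has_derivative_compose[of "\<lambda>h. x + h *\<^sub>R e" "\<lambda>h. h *\<^sub>R e" 0 UNIV w])
           (auto intro!: derivative_eq_intros has_C1_derivativeD[OF w])
      moreover have "(\<lambda>h. w' x (h *\<^sub>R e)) = (*) (w' x e)"
        using has_derivative_linear[OF has_C1_derivativeD(1)[OF w, of x]]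
        by (simp add: linear_cmul fun_eq_iff mult.commute)
      ultimately have "((\<lambda>h. w (x + h *\<^sub>R e)) has_real_derivative w' x e) (at 0)"
        by (simp add: has_field_derivative_def)
      thus ?thesis by (simp add: DERIV_def)
    qed
    thus ?thesis unfolding D_def
      by (rule filterlim_compose) (use t0 t in \<open>auto simp: filterlim_at less_imp_neq[symmetric] intro!: always_eventually\<close>)
  qed
  obtain B0 where B0: "K \<subseteq> cball 0 B0" 
    using bounded_subset_ballD[OF compact_imp_bounded[OF K], of 0] ball_subset_cball[of "0::'a"] by blast
  \<comment> \<open>Steps satisfy \<open>t n\<close> \<le> 1, so a point of norm above
    \<open>B0 + norm e\<close> and its translate both miss \<open>K\<close>: all quotients vanish
    off \<open>B\<close>. The further margin in \<open>B2\<close> holds the intermediate points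
    produced by the mean value theorem from points of \<open>B\<close>.\<close>
  define B where "B = cball (0::'a) (B0 + norm e)"
  define B2 where "B2 = cball (0::'a) (B0 + norm e + norm e)"
  have "compact ((\<lambda>x. \<bar>w' x e\<bar>) ` B2)"
    by (intro compact_continuous_image continuous_intros has_C1_derivativeD[OF w]) (auto simp: B2_def)
  then obtain M where M: "\<And>x. x \<in> B2 \<Longrightarrow> \<bar>w' x e\<bar> \<le> M"
    using compact_imp_bounded[of "(\<lambda>x. \<bar>w' x e\<bar>) ` B2"] unfolding bounded_iff by force
  have Dzero: "D n x = 0" if "x \<notin> B" for n x
  proof -
    have "norm x > B0 + norm e" using that by (auto simp: B_def)
    moreover have "norm (t n *\<^sub>R e) \<le> norm e"
      using t[of n] by (simp add: mult_left_le_one_le)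
    ultimately have "norm x > B0" "norm (x + t n *\<^sub>R e) > B0"
      using norm_diff_ineq[of x "t n *\<^sub>R e"] norm_ge_zero[of e] by linarith+
    hence "x \<notin> K" "x + t n *\<^sub>R e \<notin> K" using B0 by (force simp: subset_iff)+
    thus ?thesis using zero by (simp add: D_def)
  qed
  have bound: "\<bar>D n x\<bar> \<le> M" if "x \<in> B" for n x
  proof -
    have "\<exists>z. z > 0 \<and> z < t n \<and> w (x + t n *\<^sub>R e) - w (x + 0 *\<^sub>R e) = (t n - 0) * w' (x + z *\<^sub>R e) e"
    proof (rule MVT2[of 0 "t n" "\<lambda>h. w (x + h *\<^sub>R e)" "\<lambda>h. w' (x + h *\<^sub>R e) e"])
      fix h :: real
      have "((\<lambda>h. w (x + h *\<^sub>R e)) has_derivative (\<lambda>k. w' (x + h *\<^sub>R e) (k *\<^sub>R e))) (at h)"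
        by (rule has_derivative_compose[of "\<lambda>h. x + h *\<^sub>R e" "\<lambda>h. h *\<^sub>R e" h UNIV w])
           (auto intro!: derivative_eq_intros has_C1_derivativeD[OF w])
      moreover have "(\<lambda>k. w' (x + h *\<^sub>R e) (k *\<^sub>R e)) = (*) (w' (x + h *\<^sub>R e) e)"
        using has_derivative_linear[OF has_C1_derivativeD(1)[OF w, of "x + h *\<^sub>R e"]]
        by (simp add: linear_cmul fun_eq_iff mult.commute)
      ultimately show "DERIV (\<lambda>h. w (x + h *\<^sub>R e)) h :> w' (x + h *\<^sub>R e) e"
        by (simp add: has_field_derivative_def)
    qed (use t in auto)
    then obtain z where z: "0 < z" "z < t n" "w (x + t n *\<^sub>R e) - w x = t n * w' (x + z *\<^sub>R e) e" by auto
    hence "D n x = w' (x + z *\<^sub>R e) e" using t[of n] by (simp add: D_def)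
    moreover have "x + z *\<^sub>R e \<in> B2"
    proof -
      have "norm (z *\<^sub>R e) \<le> norm e" using z t[of n] by (simp add: mult_left_le_one_le)
      thus ?thesis using that norm_triangle_ineq[of x "z *\<^sub>R e"] by (auto simp: B_def B2_def)
    qed
    ultimately show ?thesis using M by simp
  qed
  have "(\<lambda>n. integral\<^sup>L lborel (D n)) \<longlonglongrightarrow> integral\<^sup>L lborel (\<lambda>x. w' x e)"
  proof (rule integral_dominated_convergence[where w = "\<lambda>x. indicator B x *\<^sub>R M"])
    show "(\<lambda>x. w' x e) \<in> borel_measurable lborel"
      using has_C1_derivativeD(2)[OF w, of UNIV e] by (simp add: borel_measurable_continuous_onI)
    have "w \<in> borel_measurable borel" using wi by auto
    thus "D n \<in> borel_measurable lborel" for n unfolding D_def by measurable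
    show "integrable lborel (\<lambda>x. indicator B x *\<^sub>R M)"
      by (rule borel_integrable_compact) (auto simp: B_def)
    show "AE x in lborel. (\<lambda>n. D n x) \<longlonglongrightarrow> w' x e" using lim by simp
    show "AE x in lborel. norm (D n x) \<le> indicator B x *\<^sub>R M" for n
      using bound Dzero by (auto simp: indicator_def)
  qed
  thus ?thesis using D0 by (simp add: LIMSEQ_const_iff)
qed

section \<open>Left-invariant vector fields\<close>

lemma smooth_funD:
  assumes "smooth_fun f"
  shows "continuous_on UNIV f" "(f has_derivative frechet_derivative f (at x)) (at x)"
    "smooth_fun (\<lambda>x. frechet_derivative f (at x) v)"
  using assms by (auto elim: smooth_fun.cases simp: differentiable_on_def frechet_derivative_works[symmetric])

lemma smooth_fun_has_C1_derivative:
  "smooth_fun f \<Longrightarrow> has_C1_derivative f (\<lambda>x. frechet_derivative f (at x))"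
  by (auto simp: has_C1_derivative_def intro: smooth_funD)

lemma has_C1_derivative_affine:
  assumes f: "has_C1_derivative f f'" and L: "bounded_linear L"
  shows "has_C1_derivative (\<lambda>x. f (c + L x)) (\<lambda>x e. f' (c + L x) (L e))"
  unfolding has_C1_derivative_def
proof (intro conjI allI)
  show "((\<lambda>x. f (c + L x)) has_derivative (\<lambda>e. f' (c + L x) (L e))) (at x)" for x
    by (rule has_derivative_compose[of "\<lambda>x. c + L x" L x UNIV f])
       (auto intro!: derivative_eq_intros bounded_linear.has_derivative[OF L] has_C1_derivativeD[OF f])
  show "continuous_on UNIV (\<lambda>x. f' (c + L x) (L e))" for e
    by (rule continuous_on_compose2[OF has_C1_derivativeD(2)[OF f, of UNIV]])
       (auto intro!: continuous_intros linear_continuous_on[OF L])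
qed

context
  fixes op :: "(real, 'n::{finite,linorder}) vec \<Rightarrow> (real, 'n) vec \<Rightarrow> (real, 'n) vec"
    and deg :: "'n \<Rightarrow> nat"
  assumes G: "hcarnot op deg"
begin

lemma hcarnot_dil: "s > 0 \<Longrightarrow> dil deg s (op x y) = op (dil deg s x) (dil deg s y)"
  and hcarnot_deg: "1 \<le> deg i"
  and hcarnot_mono: "mono deg"
  and hcarnot_law: "lie_group_law op"
  using G by (auto simp: hcarnot_def)

text \<open>The group axioms only provide some unit \<open>e\<close>, while \<open>lvf\<close>
  differentiates at 0. Dilations are automorphisms, so \<open>dil deg 2\<close> fixes
  \<open>e\<close>; all degrees are at least 1, so its only fixed point is 0.\<close>

lemma hcarnot_unit: "op 0 x = x" "op x 0 = x"
proof -
  obtain e where e: "\<And>x. op e x = x \<and> op x e = x"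
    using hcarnot_law unfolding lie_group_law_def by blast
  have "op (dil deg 2 e) x = x" for x
  proof -
    have "op (dil deg 2 e) (dil deg 2 (dil deg (1/2) x)) = dil deg 2 (dil deg (1/2) x)"
      using hcarnot_dil[of 2 e "dil deg (1/2) x"] e by simp
    moreover have "dil deg 2 (dil deg (1/2) x) = x"
      by (auto simp: dil_def vec_eq_iff power_mult_distrib[symmetric])
    ultimately show ?thesis by simp
  qed
  hence "dil deg 2 e = e" using e by metis
  hence "2 ^ deg i * e $ i = e $ i" for i by (metis dil_def vec_lambda_beta)
  moreover have "(2::real) ^ deg i > 1" for i using hcarnot_deg[of i] by simp
  ultimately have "e $ i = 0" for i by (metis less_irrefl mult_cancel_right1)
  hence "e = 0" by (simp add: vec_eq_iff)
  thus "op 0 x = x" "op x 0 = x" using e by auto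
qed

lemma smooth_component: "smooth_fun (\<lambda>q. op (fst q) (snd q) $ j)"
proof -
  have "smooth_map (\<lambda>(x, y). op x y)" using hcarnot_law by (simp add: lie_group_law_def)
  hence "smooth_fun (\<lambda>q. (case q of (x, y) \<Rightarrow> op x y) \<bullet> axis j 1)"
    unfolding smooth_map_def by (auto simp: Basis_vec_def)
  thus ?thesis by (simp add: inner_axis case_prod_unfold)
qed

text \<open>\<open>lvf\<close> differentiates in the second argument only. Rewriting it as a
  directional derivative of the law on the product space makes its regularity in \<open>x\<close> a
  consequence of the smoothness of the law.\<close>

lemma lvf_component:
  "lvf op a x $ j = frechet_derivative (\<lambda>q. op (fst q) (snd q) $ j) (at (x, 0)) (0, a)"
proof -
  have "((\<lambda>y. op x y \<bullet> b) has_derivative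
        (\<lambda>a. (\<chi> j. frechet_derivative (\<lambda>q. op (fst q) (snd q) $ j) (at (x, 0)) (0, a)) \<bullet> b)) (at 0)"
    if bB: "b \<in> Basis" for b
  proof -
    obtain j where b: "b = axis j 1" using bB by (auto simp: Basis_vec_def)
    have "has_C1_derivative (\<lambda>y. op (fst ((x, 0) + (0, y))) (snd ((x, 0) + (0, y))) $ j)
       (\<lambda>y e. frechet_derivative (\<lambda>q. op (fst q) (snd q) $ j) (at ((x, 0) + (0, y))) (0, e))"
      by (rule has_C1_derivative_affine[OF smooth_fun_has_C1_derivative[OF smooth_component]])
         (auto intro!: bounded_linear_intros)
    from has_C1_derivativeD(1)[OF this, of 0] show ?thesis
      unfolding b by (simp add: inner_axis)
  qed
  hence "((\<lambda>y. op x y) has_derivative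
        (\<lambda>a. \<chi> j. frechet_derivative (\<lambda>q. op (fst q) (snd q) $ j) (at (x, 0)) (0, a))) (at 0)"
    by (subst has_derivative_componentwise_within) blast
  hence "frechet_derivative (\<lambda>y. op x y) (at 0) =
        (\<lambda>a. \<chi> j. frechet_derivative (\<lambda>q. op (fst q) (snd q) $ j) (at (x, 0)) (0, a))"
    by (rule frechet_derivative_at[symmetric])
  thus ?thesis by (simp add: lvf_def)
qed

lemma lvf_C1: "\<exists>A'. has_C1_derivative (\<lambda>x. lvf op a x $ j) A'"
proof -
  have "has_C1_derivative (\<lambda>x. frechet_derivative (\<lambda>q. op (fst q) (snd q) $ j) (at (0 + (x, 0))) (0, a))
      (\<lambda>x e. frechet_derivative (\<lambda>q. frechet_derivative (\<lambda>q. op (fst q) (snd q) $ j) (at q) (0, a))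
               (at (0 + (x, 0))) (e, 0))"
    by (rule has_C1_derivative_affine[OF smooth_fun_has_C1_derivative[OF smooth_funD(3)[OF smooth_component]]])
       (auto intro!: bounded_linear_intros)
  thus ?thesis by (auto simp: lvf_component)
qed

lemma lvf_continuous: "continuous_on A (\<lambda>x. lvf op a x $ j)"
  by (rule exE[OF lvf_C1[of a j]]) (rule has_C1_derivativeD(3))

lemma lvf_scaleR: "lvf op (c *\<^sub>R a) x $ j = c * lvf op a x $ j"
proof -
  have "linear (frechet_derivative (\<lambda>q. op (fst q) (snd q) $ j) (at (x, 0)))"
    using has_derivative_linear[OF smooth_funD(2)[OF smooth_component]] .
  from linear_cmul[OF this, of c "(0, a)"] show ?thesis by (simp add: lvf_component)
qed

lemma lvf_has_derivative_along: "((\<lambda>y. op x y $ j) has_derivative (\<lambda>a. lvf op a x $ j)) (at 0)"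
proof -
  have "has_C1_derivative (\<lambda>y. op (fst ((x, 0) + (0, y))) (snd ((x, 0) + (0, y))) $ j)
       (\<lambda>y e. frechet_derivative (\<lambda>q. op (fst q) (snd q) $ j) (at ((x, 0) + (0, y))) (0, e))"
    by (rule has_C1_derivative_affine[OF smooth_fun_has_C1_derivative[OF smooth_component]])
       (auto intro!: bounded_linear_intros)
  from has_C1_derivativeD(1)[OF this, of 0] show ?thesis by (simp add: lvf_component)
qed

text \<open>Differentiate the automorphism identity
  \<open>op (dil deg s x) (dil deg s y) = dil deg s (op x y)\<close> in \<open>y\<close> at 0:
  dilations carry left-invariant fields to left-invariant fields.\<close>

lemma lvf_dil:
  assumes "s > 0"
  shows "lvf op (dil deg s a) (dil deg s x) $ j = s ^ deg j * lvf op a x $ j"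
proof -
  have "((\<lambda>y. op (dil deg s x) (dil deg s y) $ j) has_derivative (\<lambda>a. lvf op (dil deg s a) (dil deg s x) $ j)) (at 0)"
  proof (rule has_derivative_compose[of "dil deg s" "dil deg s" 0 UNIV "\<lambda>y. op (dil deg s x) y $ j"])
    have "linear (dil deg s)"
      by (rule linearI) (auto simp: dil_def vec_eq_iff algebra_simps)
    thus "(dil deg s has_derivative dil deg s) (at 0)"
      by (intro bounded_linear_imp_has_derivative linear_conv_bounded_linear[THEN iffD1])
    have "dil deg s 0 = 0" by (simp add: dil_def vec_eq_iff)
    thus "((\<lambda>y. op (dil deg s x) y $ j) has_derivative (\<lambda>a. lvf op a (dil deg s x) $ j)) (at (dil deg s 0))"
      using lvf_has_derivative_along by simp
  qed
  moreover have "(\<lambda>y. op (dil deg s x) (dil deg s y) $ j) = (\<lambda>y. s ^ deg j * op x y $ j)"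
    using hcarnot_dil[OF assms, of x, symmetric] by (simp add: dil_def)
  moreover have "((\<lambda>y. s ^ deg j * op x y $ j) has_derivative (\<lambda>a. s ^ deg j * lvf op a x $ j)) (at 0)"
    by (intro has_derivative_mult_right lvf_has_derivative_along)
  ultimately have "(\<lambda>a. lvf op (dil deg s a) (dil deg s x) $ j) = (\<lambda>a. s ^ deg j * lvf op a x $ j)"
    by (intro has_derivative_unique) simp_all
  thus ?thesis by (rule fun_cong)
qed

lemma dil_tendsto_zero: "((\<lambda>s. dil deg s x) \<longlongrightarrow> 0) (at_right 0)"
proof (rule vec_tendstoI)
  fix i
  have "((\<lambda>s::real. s ^ deg i * x $ i) \<longlongrightarrow> 0 ^ deg i * x $ i) (at_right 0)"
    by (intro tendsto_intros)
  thus "((\<lambda>s. dil deg s x $ i) \<longlongrightarrow> 0 $ i) (at_right 0)"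
    using hcarnot_deg[of i] by (simp add: dil_def power_0_left)
qed

text \<open>For layer-one directions this says that the j-th coefficient is homogeneous of degree
  \<open>deg j - 1\<close>; the factor \<open>s\<close> on the left keeps the exponent free of
  subtraction.\<close>

lemma lvf_axis_dil:
  assumes "s > 0" "deg i = 1"
  shows "s * lvf op (axis i 1) (dil deg s x) $ j = s ^ deg j * lvf op (axis i 1) x $ j"
proof -
  have "dil deg s (axis i 1) = s *\<^sub>R axis i 1"
    using assms by (auto simp: dil_def axis_def vec_eq_iff)
  thus ?thesis using lvf_dil[OF assms(1), of "axis i 1" x j] by (simp add: lvf_scaleR)
qed

text \<open>The coefficient is homogeneous of degree 0 and continuous at the origin, hence constant:
  letting s tend to 0 gives its value at 0, where the field is \<open>axis i 1\<close>. This is what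
  makes X_i act on functions of z as a partial derivative.\<close>

lemma lvf_layer1_const:
  assumes "deg i = 1" "deg j = 1"
  shows "lvf op (axis i 1) x $ j = (if i = j then 1 else 0)"
proof -
  obtain A' where A': "has_C1_derivative (\<lambda>x. lvf op (axis i 1) x $ j) A'" using lvf_C1 by blast
  have "((\<lambda>s. lvf op (axis i 1) (dil deg s x) $ j) \<longlongrightarrow> lvf op (axis i 1) 0 $ j) (at_right 0)"
    using has_C1_derivativeD(3)[OF A', of UNIV] dil_tendsto_zero
    by (intro isCont_tendsto_compose[where g = "\<lambda>x. lvf op (axis i 1) x $ j"])
       (auto simp: continuous_on_eq_continuous_at)
  moreover have "eventually (\<lambda>s. lvf op (axis i 1) (dil deg s x) $ j = lvf op (axis i 1) x $ j) (at_right 0)"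
    using eventually_at_right_less[of 0]
    by eventually_elim (use lvf_axis_dil[of _ i x j] assms in simp)
  ultimately have "((\<lambda>s::real. lvf op (axis i 1) x $ j) \<longlongrightarrow> lvf op (axis i 1) 0 $ j) (at_right 0)"
    by (rule Lim_transform_eventually)
  hence "lvf op (axis i 1) x $ j = lvf op (axis i 1) 0 $ j"
    by (simp add: tendsto_const_iff)
  moreover have "(\<lambda>y. op 0 y) = (\<lambda>y. y)" using hcarnot_unit by auto
  hence "lvf op (axis i 1) 0 = axis i 1" by (simp add: lvf_def)
  ultimately show ?thesis by (simp add: axis_def)
qed

text \<open>The \<open>j\<close>-th coefficient is homogeneous of degree \<open>deg j - 1\<close>, so its \<open>j\<close>-th partial derivative
  would be homogeneous of degree \<open>-1\<close>; being continuous at the origin, it vanishes.\<close>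
lemma lvf_divergence_free:
  assumes i: "deg i = 1" and A': "has_C1_derivative (\<lambda>x. lvf op (axis i 1) x $ j) A'"
  shows "A' x (axis j 1) = 0"
proof -
  let ?a = "\<lambda>x. lvf op (axis i 1) x $ j"
  have eq: "A' x (axis j 1) = s * A' (dil deg s x) (axis j 1)" if s: "s > 0" for s
  proof -
    have along: "((\<lambda>t. ?a (z + t *\<^sub>R axis j c)) has_real_derivative c * A' z (axis j 1)) (at 0)" for z c
    proof -
      have "((\<lambda>t. ?a (z + t *\<^sub>R axis j c)) has_derivative (\<lambda>t. A' z (t *\<^sub>R axis j c))) (at 0)"
        by (rule has_derivative_compose[of "\<lambda>t. z + t *\<^sub>R axis j c" "\<lambda>t. t *\<^sub>R axis j c" 0 UNIV ?a])
           (auto intro!: derivative_eq_intros has_C1_derivativeD[OF A'])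
      moreover have "A' z (t *\<^sub>R axis j c) = c * A' z (axis j 1) * t" for t
      proof -
        have "t *\<^sub>R axis j c = (c * t) *\<^sub>R (axis j 1 :: (real, 'n) vec)"
          by (auto simp: vec_eq_iff axis_def)
        thus ?thesis
          using linear_cmul[OF has_derivative_linear[OF has_C1_derivativeD(1)[OF A']]] by simp
      qed
      ultimately show ?thesis by (simp add: has_field_derivative_def)
    qed
    have "dil deg s (x + t *\<^sub>R axis j 1) = dil deg s x + t *\<^sub>R axis j (s ^ deg j)" for t
      by (auto simp: dil_def vec_eq_iff axis_def algebra_simps)
    hence "s * ?a (dil deg s x + t *\<^sub>R axis j (s ^ deg j)) = s ^ deg j * ?a (x + t *\<^sub>R axis j 1)" for t
      using lvf_axis_dil[OF s i, of "x + t *\<^sub>R axis j 1" j] by simp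
    moreover have "((\<lambda>t. s * ?a (dil deg s x + t *\<^sub>R axis j (s ^ deg j))) has_real_derivative
        s * (s ^ deg j * A' (dil deg s x) (axis j 1))) (at 0)"
      by (intro DERIV_cmult along)
    moreover have "((\<lambda>t. s ^ deg j * ?a (x + t *\<^sub>R axis j 1)) has_real_derivative
        s ^ deg j * (1 * A' x (axis j 1))) (at 0)"
      by (intro DERIV_cmult along)
    ultimately have "s * (s ^ deg j * A' (dil deg s x) (axis j 1)) = s ^ deg j * (1 * A' x (axis j 1))"
      by (simp only:) (rule DERIV_unique)
    thus ?thesis using s by (simp add: field_simps)
  qed
  have "((\<lambda>s. s * A' (dil deg s x) (axis j 1)) \<longlongrightarrow> 0 * A' 0 (axis j 1)) (at_right 0)"
    using has_C1_derivativeD(2)[OF A', of UNIV] dil_tendsto_zero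
    by (intro tendsto_intros isCont_tendsto_compose[where g = "\<lambda>x. A' x (axis j 1)"])
       (auto simp: continuous_on_eq_continuous_at)
  moreover have "eventually (\<lambda>s. s * A' (dil deg s x) (axis j 1) = A' x (axis j 1)) (at_right 0)"
    using eventually_at_right_less[of 0] by eventually_elim (use eq in simp)
  ultimately have "((\<lambda>s::real. A' x (axis j 1)) \<longlongrightarrow> 0 * A' 0 (axis j 1)) (at_right 0)"
    by (rule Lim_transform_eventually)
  thus ?thesis by (simp add: tendsto_const_iff)
qed

lemma derivative_along_lvf:
  assumes "has_C1_derivative v v'"
  shows "v' x (lvf op a x) = (\<Sum>j\<in>UNIV. lvf op a x $ j * v' x (axis j 1))"
proof -
  have l: "linear (v' x)" using has_derivative_linear[OF has_C1_derivativeD(1)[OF assms]] .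
  have "lvf op a x = (\<Sum>j\<in>UNIV. lvf op a x $ j *\<^sub>R axis j 1)"
    by (simp add: basis_expansion flip: scalar_mult_eq_scaleR)
  hence "v' x (lvf op a x) = v' x (\<Sum>j\<in>UNIV. lvf op a x $ j *\<^sub>R axis j 1)" by simp
  thus ?thesis by (simp add: linear_sum[OF l] linear_cmul[OF l])
qed

lemma continuous_on_derivative_along_lvf:
  assumes "has_C1_derivative v v'"
  shows "continuous_on UNIV (\<lambda>x. v' x (lvf op a x))"
  by (subst derivative_along_lvf[OF assms])
     (intro continuous_on_sum continuous_on_mult has_C1_derivativeD(2)[OF assms] lvf_continuous)

text \<open>Not only the divergence but each term of it vanishes, so every a_j \<partial>_j v equals
  \<partial>_j (a_j v) and integrates to 0 separately.\<close>

lemma integral_lvf_zero: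
  assumes i: "deg i = 1" and v: "has_C1_derivative v v'"
    and K: "compact K" and zero: "\<And>x. x \<notin> K \<Longrightarrow> v x = 0"
  shows "integral\<^sup>L lborel (\<lambda>x. v' x (lvf op (axis i 1) x)) = 0"
proof -
  let ?a = "\<lambda>j x. lvf op (axis i 1) x $ j"
  have cl: "closed K" using K by (rule compact_imp_closed)
  have int: "integrable lborel (\<lambda>x. ?a j x * v' x (axis j 1))" for j
  proof (rule integrable_compact_support[OF _ K])
    show "continuous_on UNIV (\<lambda>x. ?a j x * v' x (axis j 1))"
      by (intro continuous_on_mult has_C1_derivativeD(2)[OF v] lvf_continuous)
    show "x \<notin> K \<Longrightarrow> ?a j x * v' x (axis j 1) = 0" for x
      using has_C1_derivative_zero_outside[OF v cl] zero by auto
  qed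
  have "integral\<^sup>L lborel (\<lambda>x. ?a j x * v' x (axis j 1)) = 0" for j
  proof -
    obtain A' where A': "has_C1_derivative (?a j) A'" using lvf_C1 by blast
    have "integral\<^sup>L lborel (\<lambda>x. ?a j x * v' x (axis j 1) + A' x (axis j 1) * v x) = 0"
      by (rule integral_partial_derivative_zero[OF has_C1_derivative_mult[OF A' v] K]) (simp add: zero)
    thus ?thesis using lvf_divergence_free[OF i A'] by simp
  qed
  thus ?thesis by (simp add: derivative_along_lvf[OF v] int)
qed

end

section \<open>The weighted inequality\<close>

lemma C1_0E:
  assumes "u \<in> C1_0 \<Omega>"
  obtains u' K where "has_C1_derivative u u'" "compact K" "K \<subseteq> \<Omega>" "\<And>x. x \<notin> K \<Longrightarrow> u x = 0"
proof -
  obtain u' where u': "\<And>x. (u has_derivative blinfun_apply (u' x)) (at x)" "continuous_on UNIV u'"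
    "compact (closure {x. u x \<noteq> 0})" "closure {x. u x \<noteq> 0} \<subseteq> \<Omega>"
    using assms unfolding C1_0_def by blast
  show ?thesis
  proof
    show "has_C1_derivative u (\<lambda>x. blinfun_apply (u' x))"
      using u' by (auto simp: has_C1_derivative_def intro!: continuous_intros)
    show "x \<notin> closure {x. u x \<noteq> 0} \<Longrightarrow> u x = 0" for x
      using closure_subset[of "{x. u x \<noteq> 0}"] by auto
  qed (use u' in auto)
qed

lemma C1_0I:
  assumes u: "has_C1_derivative u u'" and K: "compact K" "K \<subseteq> \<Omega>" "\<And>x. x \<notin> K \<Longrightarrow> u x = 0"
  shows "u \<in> C1_0 \<Omega>"
proof -
  have bl: "bounded_linear (u' x)" for x
    using has_C1_derivativeD(1)[OF u] by (rule has_derivative_bounded_linear)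
  have "(u has_derivative blinfun_apply (Blinfun (u' x))) (at x)" for x
    using has_C1_derivativeD(1)[OF u] by (simp add: bounded_linear_Blinfun_apply[OF bl])
  moreover have "continuous_on UNIV (\<lambda>x. Blinfun (u' x))"
    by (rule continuous_on_blinfun_componentwise)
       (simp add: bounded_linear_Blinfun_apply[OF bl] has_C1_derivativeD(2)[OF u])
  moreover have "closure {x. u x \<noteq> 0} \<subseteq> K"
    using K compact_imp_closed by (intro closure_minimal) auto
  ultimately show ?thesis unfolding C1_0_def
    using K by (auto intro!: exI[of _ "\<lambda>x. Blinfun (u' x)"] intro: compact_closure[THEN iffD2]
        bounded_subset[OF compact_imp_bounded] closure_subset order_trans)
qed

text \<open>At t = 0 the difference quotient has modulus |h|^(p-1), which tends to 0 because p > 1.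
  Hence |u|^p is itself C^1 and can be differentiated without regularisation.\<close>

lemma abs_powr_has_real_derivative:
  assumes "(1::real) < p"
  shows "((\<lambda>t. \<bar>t\<bar> powr p) has_real_derivative p * \<bar>t\<bar> powr (p - 1) * sgn t) (at t)"
proof -
  consider "t > 0" | "t < 0" | "t = 0" by linarith
  thus ?thesis
  proof cases
    case 1
    have "((\<lambda>t. t powr p) has_real_derivative p * t powr (p - 1)) (at t)"
      using 1 by (auto intro!: derivative_eq_intros simp: powr_diff)
    hence "((\<lambda>t. \<bar>t\<bar> powr p) has_real_derivative p * t powr (p - 1)) (at t)"
      by (rule has_field_derivative_transform_within_open[where S = "{0<..}"]) (use 1 in auto)
    thus ?thesis using 1 by simp
  next
    case 2
    have "((\<lambda>t. (- t) powr p) has_real_derivative - (p * (- t) powr (p - 1))) (at t)"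
      using 2 by (auto intro!: derivative_eq_intros simp: powr_diff)
    hence "((\<lambda>t. \<bar>t\<bar> powr p) has_real_derivative - (p * (- t) powr (p - 1))) (at t)"
      by (rule has_field_derivative_transform_within_open[where S = "{..<0}"]) (use 2 in auto)
    thus ?thesis using 2 by simp
  next
    case 3
    have "((\<lambda>h::real. \<bar>h\<bar> powr (p - 1)) \<longlongrightarrow> \<bar>0\<bar> powr (p - 1)) (at 0)"
      by (intro tendsto_powr' tendsto_intros) (use assms in auto)
    hence "((\<lambda>h::real. \<bar>h\<bar> powr (p - 1)) \<longlongrightarrow> 0) (at 0)" by simp
    moreover have "\<bar>\<bar>h\<bar> powr p / h\<bar> = \<bar>h\<bar> powr (p - 1)" for h :: real
      by (cases "h = 0") (auto simp: powr_diff)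
    ultimately have "((\<lambda>h::real. \<bar>\<bar>h\<bar> powr p / h\<bar>) \<longlongrightarrow> 0) (at 0)" by simp
    hence "((\<lambda>h::real. \<bar>h\<bar> powr p / h) \<longlongrightarrow> 0) (at 0)" by (rule tendsto_rabs_zero_cancel)
    thus ?thesis using 3 assms by (simp add: DERIV_def)
  qed
qed

lemma continuous_on_abs_powr_derivative:
  assumes "(1::real) < p"
  shows "continuous_on UNIV (\<lambda>t. p * \<bar>t\<bar> powr (p - 1) * sgn t)"
proof -
  have "isCont (\<lambda>t::real. p * \<bar>t\<bar> powr (p - 1) * sgn t) t" for t
  proof (cases "t = 0")
    case True
    have "((\<lambda>h::real. p * \<bar>h\<bar> powr (p - 1)) \<longlongrightarrow> p * \<bar>0\<bar> powr (p - 1)) (at 0)"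
      by (intro tendsto_powr' tendsto_intros) (use assms in auto)
    hence "((\<lambda>h::real. p * \<bar>h\<bar> powr (p - 1)) \<longlongrightarrow> 0) (at 0)" by simp
    hence "((\<lambda>h::real. p * \<bar>h\<bar> powr (p - 1) * sgn h) \<longlongrightarrow> 0) (at 0)"
      by (rule Lim_null_comparison[rotated])
         (use assms in \<open>auto intro!: always_eventually simp: abs_mult abs_sgn_eq\<close>)
    thus ?thesis using True by (simp add: isCont_def)
  next
    case False
    thus ?thesis by (intro continuous_intros) (auto simp: isCont_sgn)
  qed
  thus ?thesis by (simp add: continuous_on_eq_continuous_at)
qed

text \<open>Used with a = |u|, b = |grad_L u| and k = |h|. The hypothesis gives k \<le> D^(1-1/p)
  W^(1/p), so the left side is at most X^(1-1/p) Y^(1/p) with X = a^p D and Y = p^p b^p W; weighted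
  arithmetic-geometric mean finishes. Placing the whole factor p in Y is what yields the optimal
  constant after absorption.\<close>

lemma weighted_Young:
  fixes p a b k D W :: real
  assumes p: "1 < p" and nn: "0 \<le> a" "0 \<le> b" "0 \<le> k" "0 \<le> D" "0 \<le> W"
    and k: "k powr p \<le> D powr (p - 1) * W"
  shows "p * a powr (p - 1) * b * k \<le> (1 - 1 / p) * (a powr p * D) + p powr (p - 1) * (b powr p * W)"
proof (cases "k = 0 \<or> a = 0 \<or> b = 0")
  case True
  thus ?thesis using nn p by auto
next
  case False
  hence pos: "0 < k" "0 < a" "0 < b" using nn by auto
  hence "0 < D powr (p - 1) * W" using k by (smt (verit) powr_gt_zero)
  hence pos': "0 < D" "0 < W" using nn by (auto simp: zero_less_mult_iff less_le)
  have "k = (k powr p) powr (1 / p)" using pos p by (simp add: powr_powr)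
  also have "\<dots> \<le> (D powr (p - 1) * W) powr (1 / p)" using k p by (intro powr_mono2) auto
  finally have k': "k \<le> D powr ((p - 1) / p) * W powr (1 / p)"
    using pos' by (simp add: powr_mult powr_powr)
  have "p * a powr (p - 1) * b * k \<le> p * a powr (p - 1) * b * (D powr ((p - 1) / p) * W powr (1 / p))"
    using k' pos p by (intro mult_left_mono) auto
  also have "\<dots> = (a powr p * D) powr (1 - 1 / p) * (p powr p * b powr p * W) powr (1 / p)"
    using pos pos' p by (simp add: powr_mult powr_powr diff_divide_distrib right_diff_distrib)
  also have "\<dots> \<le> (1 - 1 / p) * (a powr p * D) + 1 / p * (p powr p * b powr p * W)"
    using pos pos' p by (intro Youngs_inequality_0) auto
  also have "1 / p * (p powr p * b powr p * W) = p powr (p - 1) * (b powr p * W)"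
    using p by (simp add: powr_diff)
  finally show ?thesis .
qed

text \<open>For integrands without a sign: \<open>ennreal\<close> replaces them by their positive
  part, which can only increase the integral.\<close>

lemma ennreal_integral_le_nn_integral:
  assumes "integrable M f"
  shows "ennreal (integral\<^sup>L M f) \<le> (\<integral>\<^sup>+x. ennreal (f x) \<partial>M)"
proof -
  have i: "integrable M (\<lambda>x. max 0 (f x))" using assms by (intro integrable_max) auto
  have "integral\<^sup>L M f \<le> integral\<^sup>L M (\<lambda>x. max 0 (f x))"
    by (rule integral_mono[OF assms i]) auto
  hence "ennreal (integral\<^sup>L M f) \<le> ennreal (integral\<^sup>L M (\<lambda>x. max 0 (f x)))"
    by (rule ennreal_leI)
  also have "\<dots> = (\<integral>\<^sup>+x. ennreal (max 0 (f x)) \<partial>M)"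
    by (rule nn_integral_eq_integral[symmetric, OF i]) auto
  also have "\<dots> = (\<integral>\<^sup>+x. ennreal (f x) \<partial>M)" 
    by (intro nn_integral_cong) (auto simp: max_def ennreal_neg)
  finally show ?thesis .
qed

section \<open>The first m coordinates and their norm\<close>

lemma rank_lessThan_inj: "inj (\<lambda>i::'n::{finite,linorder}. card {j. j < i})"
proof (rule injI)
  have lt: "card {k. k < i} < card {k. k < j}" if "i < j" for i j :: 'n
    using that by (intro psubset_card_mono) auto
  fix i j :: 'n assume "card {k. k < i} = card {k. k < j}"
  thus "i = j" using lt[of i j] lt[of j i] by (cases i j rule: linorder_cases) auto
qed

text \<open>The rank of an index is injective with values below \<open>CARD('n)\<close>, hence a
  bijection onto that initial segment, and \<open>zidx m\<close> is the preimage of the first m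
  ranks.\<close>

lemma card_zidx:
  assumes "m \<le> CARD('n::{finite,linorder})"
  shows "card (zidx m :: 'n set) = m"
proof -
  let ?r = "\<lambda>i::'n. card {j. j < i}"
  have sub: "range ?r \<subseteq> {..<CARD('n)}"
    by (auto intro!: psubset_card_mono)
  have eq: "range ?r = {..<CARD('n)}"
    by (rule card_subset_eq) (use sub card_image[OF rank_lessThan_inj] in auto)
  have "?r ` zidx m = {..<m}"
    using eq assms image_vimage_eq[of ?r "{..<m}"] by (auto simp: zidx_def vimage_def)
  moreover have "card (?r ` zidx m) = card (zidx m :: 'n set)"
    by (intro card_image inj_on_subset[OF rank_lessThan_inj]) auto
  ultimately show ?thesis by simp
qed

lemma znorm_square: "(znorm m x)\<^sup>2 = (\<Sum>i\<in>zidx m. (x $ i)\<^sup>2)"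
  by (simp add: znorm_def sum_nonneg)

lemma znorm_nonneg [simp]: "0 \<le> znorm m x" by (simp add: znorm_def sum_nonneg)

lemma restnorm_square: "(restnorm m x)\<^sup>2 = (\<Sum>i\<in>- zidx m. (x $ i)\<^sup>2)"
  by (simp add: restnorm_def sum_nonneg)

lemma restnorm_nonneg [simp]: "0 \<le> restnorm m x" by (simp add: restnorm_def sum_nonneg)

lemma has_C1_derivative_sum_squares:
  "has_C1_derivative (\<lambda>x::(real, 'n::finite) vec. \<Sum>i\<in>I. (x $ i)\<^sup>2) (\<lambda>x e. \<Sum>i\<in>I. 2 * x $ i * e $ i)"
  unfolding has_C1_derivative_def
  by (auto intro!: derivative_eq_intros continuous_intros bounded_linear_imp_has_derivative
      bounded_linear_vec_nth simp: fun_eq_iff algebra_simps)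

lemma has_C1_derivative_component:
  "has_C1_derivative (\<lambda>x::(real, 'n::finite) vec. x $ i) (\<lambda>x e. e $ i)"
  unfolding has_C1_derivative_def
  by (auto intro!: continuous_intros bounded_linear_imp_has_derivative bounded_linear_vec_nth)

lemma continuous_on_znorm [continuous_intros]:
  "continuous_on A (\<lambda>x::(real, 'n::{finite,linorder}) vec. znorm m x)"
  unfolding znorm_def by (intro continuous_intros)

lemma continuous_on_restnorm [continuous_intros]:
  "continuous_on A (\<lambda>x::(real, 'n::{finite,linorder}) vec. restnorm m x)"
  unfolding restnorm_def by (intro continuous_intros)

lemma borel_measurable_znorm [measurable]:
  "znorm m \<in> borel_measurable (borel :: (real, 'n::{finite,linorder}) vec measure)"
  by (intro borel_measurable_continuous_onI continuous_intros)

lemma borel_measurable_restnorm [measurable]: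
  "restnorm m \<in> borel_measurable (borel :: (real, 'n::{finite,linorder}) vec measure)"
  by (intro borel_measurable_continuous_onI continuous_intros)

context
  fixes op :: "(real, 'n::{finite,linorder}) vec \<Rightarrow> (real, 'n) vec \<Rightarrow> (real, 'n) vec"
    and deg :: "'n \<Rightarrow> nat" and m :: nat
  assumes G: "hcarnot op deg" and m1: "1 \<le> m" and ml: "m \<le> card (layer deg 1)"
begin

text \<open>By monotonicity of \<open>deg\<close>, an index of degree above 1 has the whole first
  layer below it, so its rank is at least \<open>card (layer deg 1)\<close> and thus at least
  m.\<close>

lemma zidx_subset_layer: "zidx m \<subseteq> layer deg 1"
proof
  fix i :: 'n assume i: "i \<in> zidx m"
  show "i \<in> layer deg 1"
  proof (rule ccontr)
    assume "i \<notin> layer deg 1"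
    hence "1 < deg i" using hcarnot_deg[OF G, of i] by (auto simp: layer_def)
    hence "layer deg 1 \<subseteq> {j. j < i}"
      using hcarnot_mono[OF G] by (force simp: layer_def mono_def not_less[symmetric])
    hence "card (layer deg 1) \<le> card {j. j < i}" by (intro card_mono) auto
    thus False using i ml by (simp add: zidx_def)
  qed
qed

lemma zidx_deg: "i \<in> zidx m \<Longrightarrow> deg i = 1"
  using zidx_subset_layer by (auto simp: layer_def)

lemma card_zidx_carnot: "card (zidx m :: 'n set) = m"
  by (rule card_zidx) (use ml card_mono[of UNIV "layer deg 1"] in auto)

lemma Xop_eq: "has_C1_derivative u u' \<Longrightarrow> Xop op i u x = u' x (lvf op (axis i 1) x)"
  by (simp add: Xop_def has_C1_derivativeD(4))

lemma continuous_on_hgrad_norm: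
  assumes "has_C1_derivative u u'"
  shows "continuous_on UNIV (hgrad_norm op deg u)"
  unfolding hgrad_norm_def Xop_eq[OF assms]
  by (intro continuous_intros continuous_on_derivative_along_lvf[OF G assms])

lemma hgrad_norm_nonneg [simp]: "0 \<le> hgrad_norm op deg u x"
  by (simp add: hgrad_norm_def sum_nonneg)

text \<open>Cauchy-Schwarz over the first m fields, after which the sum of squares is enlarged to
  the full first layer. This is the pairing of the horizontal gradient with the radial
  direction.\<close>

lemma sum_Xop_le:
  "\<bar>\<Sum>i\<in>zidx m. Xop op i u x * x $ i\<bar> \<le> hgrad_norm op deg u x * znorm m x"
proof -
  have "(\<Sum>i\<in>zidx m. Xop op i u x * x $ i)\<^sup>2 \<le> (\<Sum>i\<in>zidx m. (Xop op i u x)\<^sup>2) * (\<Sum>i\<in>zidx m. (x $ i)\<^sup>2)"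
    by (rule Cauchy_Schwarz_ineq_sum)
  also have "\<dots> \<le> (\<Sum>i\<in>layer deg 1. (Xop op i u x)\<^sup>2) * (\<Sum>i\<in>zidx m. (x $ i)\<^sup>2)"
    by (intro mult_right_mono sum_mono2 zidx_subset_layer sum_nonneg) auto
  also have "\<dots> = (hgrad_norm op deg u x * znorm m x)\<^sup>2"
    by (simp add: power_mult_distrib znorm_square hgrad_norm_def sum_nonneg)
  finally show ?thesis
    by (rule abs_le_square_iff[THEN iffD2, THEN order_trans]) (simp add: abs_mult)
qed

text \<open>The field is z q(|z|^2) and \<open>D\<close> is its Euclidean divergence m q + 2 s q'.
  The regularity of \<open>q\<close> is asked on an open set \<open>T\<close> of reals, which may
  contain negative s, so that z = 0 can be an ordinary point; the conditions linking
  \<open>q\<close>, \<open>D\<close> and \<open>W\<close> concern s \<ge> 0 only.\<close>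

lemma hardy_weighted:
  fixes W :: "real \<Rightarrow> real"
  assumes p: "1 < p" and u: "has_C1_derivative u u'"
    and K: "compact K" and zero: "\<And>x. x \<notin> K \<Longrightarrow> u x = 0"
    and T: "open T" and KT: "\<And>x. x \<in> K \<Longrightarrow> (znorm m x)\<^sup>2 \<in> T"
    and q: "\<And>s. s \<in> T \<Longrightarrow> (q has_real_derivative q' s) (at s)" and q': "continuous_on T q'"
    and D: "\<And>s. s \<in> T \<Longrightarrow> 0 \<le> s \<Longrightarrow> D s = real m * q s + 2 * s * q' s"
    and D0: "\<And>s. s \<in> T \<Longrightarrow> 0 \<le> s \<Longrightarrow> 0 \<le> D s"
    and Wm: "W \<in> borel_measurable borel" and W0: "\<And>s. 0 \<le> W s"
    and W: "\<And>s. s \<in> T \<Longrightarrow> 0 \<le> s \<Longrightarrow> (\<bar>q s\<bar> * sqrt s) powr p \<le> D s powr (p - 1) * W s"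
  shows "(\<integral>\<^sup>+x. ennreal (\<bar>u x\<bar> powr p * D ((znorm m x)\<^sup>2)) \<partial>lborel)
    \<le> ennreal (p powr p) * (\<integral>\<^sup>+x. ennreal (hgrad_norm op deg u x powr p * W ((znorm m x)\<^sup>2)) \<partial>lborel)"
proof -
  define S :: "(real, 'n) vec \<Rightarrow> real" where "S x = (znorm m x)\<^sup>2" for x
  have S_eq: "S = (\<lambda>x. \<Sum>i\<in>zidx m. (x $ i)\<^sup>2)" by (simp add: S_def znorm_square fun_eq_iff)
  define S' :: "(real, 'n) vec \<Rightarrow> (real, 'n) vec \<Rightarrow> real"
    where "S' x e = (\<Sum>i\<in>zidx m. 2 * x $ i * e $ i)" for x e
  have S: "has_C1_derivative S S'"
    unfolding S_eq S'_def by (rule has_C1_derivative_sum_squares)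
  have S0: "0 \<le> S x" for x by (simp add: S_def)
  define U where "U = S -` T"
  have U: "open U" "K \<subseteq> U"
    unfolding U_def using T KT has_C1_derivativeD(3)[OF S, of UNIV]
    by (auto intro!: open_vimage simp: S_def)
  have cl: "closed K" using K by (rule compact_imp_closed)
  define \<phi>' where "\<phi>' t = p * \<bar>t\<bar> powr (p - 1) * sgn t" for t
  define up where "up x = \<bar>u x\<bar> powr p" for x
  define up' where "up' x e = \<phi>' (u x) * u' x e" for x e
  have up: "has_C1_derivative up up'" unfolding up_def up'_def \<phi>'_def
    by (rule has_C1_derivative_chain[OF u abs_powr_has_real_derivative[OF p]
          continuous_on_abs_powr_derivative[OF p]])
  have qS: "continuous_on U (\<lambda>x. q (S x))" "continuous_on U (\<lambda>x. q' (S x))"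
  proof -
    have "continuous_on T q" using q by (auto intro!: continuous_at_imp_continuous_on DERIV_isCont)
    thus "continuous_on U (\<lambda>x. q (S x))"
      by (rule continuous_on_compose2[OF _ has_C1_derivativeD(3)[OF S]]) (auto simp: U_def)
    show "continuous_on U (\<lambda>x. q' (S x))"
      by (rule continuous_on_compose2[OF q' has_C1_derivativeD(3)[OF S]]) (auto simp: U_def)
  qed
  \<comment> \<open>\<open>v i\<close> is |u|^p times the i-th component of the field. The sum of
    X_i (v i) over the first m indices is |u|^p div h plus p |u|^(p-2) u times the pairing of the
    gradient with h, and it integrates to 0.\<close>
  define v where "v i x = up x * (x $ i * q (S x))" for i x
  define v' where "v' i x e = up x * (x $ i * (q' (S x) * S' x e) + e $ i * q (S x)) + up' x e * (x $ i * q (S x))" for i x e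
  have v: "has_C1_derivative (v i) (\<lambda>x e. if x \<in> U then v' i x e else 0)" for i
  proof (rule has_C1_derivative_glue[OF cl U])
    show "x \<notin> K \<Longrightarrow> v i x = 0" for x by (simp add: v_def up_def zero)
    show "(v i has_derivative v' i x) (at x)" if x: "x \<in> U" for x
    proof -
      have "((\<lambda>x. q (S x)) has_derivative (\<lambda>e. q' (S x) * S' x e)) (at x)"
        using has_derivative_compose[OF has_C1_derivativeD(1)[OF S]
            q[of "S x", unfolded has_field_derivative_def]] x by (simp add: U_def)
      thus ?thesis unfolding v_def v'_def
        by (intro has_derivative_mult has_C1_derivativeD(1)[OF up]
            has_C1_derivativeD(1)[OF has_C1_derivative_component])
    qed
    show "continuous_on U (\<lambda>x. v' i x e)" for e unfolding v'_def
      by (intro continuous_on_add continuous_on_mult has_C1_derivativeD(2,3)[OF up] qS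
          has_C1_derivativeD(2,3)[OF has_C1_derivative_component] has_C1_derivativeD(2)[OF S])
  qed
  define Yi where "Yi i x = (if x \<in> U then v' i x (lvf op (axis i 1) x) else 0)" for i x
  have v0: "x \<notin> K \<Longrightarrow> v i x = 0" for i x by (simp add: v_def up_def zero)
  have Yi: "integrable lborel (Yi i)" "integral\<^sup>L lborel (Yi i) = 0" if "i \<in> zidx m" for i
  proof -
    show "integrable lborel (Yi i)"
    proof (rule integrable_compact_support[OF _ K])
      show "continuous_on UNIV (Yi i)"
        using continuous_on_derivative_along_lvf[OF G v[of i], of "axis i 1"] by (simp add: Yi_def[abs_def])
      show "x \<notin> K \<Longrightarrow> Yi i x = 0" for x
        using has_C1_derivative_zero_outside[OF v cl v0, of x i "lvf op (axis i 1) x"]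
        by (simp add: Yi_def)
    qed
    show "integral\<^sup>L lborel (Yi i) = 0"
      using integral_lvf_zero[OF G zidx_deg[OF that] v K v0, of i] by (simp add: Yi_def[abs_def])
  qed
  define Y where "Y x = (\<Sum>i\<in>zidx m. Yi i x)" for x
  have Y: "integrable lborel Y" "integral\<^sup>L lborel Y = 0"
    unfolding Y_def using Yi by (auto intro!: Bochner_Integration.integrable_sum)
  \<comment> \<open>\<open>F\<close> is |u|^p D, written through \<open>q\<close> and
    \<open>q'\<close> because these are known to be continuous, whereas \<open>D\<close> is only
    prescribed pointwise.\<close>
  define F where "F x = (if x \<in> U then up x * (real m * q (S x) + 2 * S x * q' (S x)) else 0)" for x
  have F: "integrable lborel F"
  proof (rule integrable_compact_support[OF _ K])
    show "continuous_on UNIV F" unfolding F_def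
    proof (rule continuous_on_glue[OF cl U])
      show "continuous_on U (\<lambda>x. up x * (real m * q (S x) + 2 * S x * q' (S x)))"
        by (intro continuous_intros qS has_C1_derivativeD(3)[OF S] has_C1_derivativeD(3)[OF up])
    qed (simp add: up_def zero)
    show "x \<notin> K \<Longrightarrow> F x = 0" for x by (simp add: F_def up_def zero)
  qed
  have F_eq: "F x = \<bar>u x\<bar> powr p * D (S x)" for x
    using D[OF _ S0, of x] zero[of x] U by (auto simp: F_def up_def U_def)
  have F0: "0 \<le> F x" for x
  proof (cases "x \<in> U")
    case True
    thus ?thesis using D0[OF _ S0, of x] by (simp add: F_eq U_def)
  qed (simp add: F_def)
  \<comment> \<open>Young's inequality leaves (1 - 1/p) F on the right. Multiplying by p and
    cancelling (p - 1) F pointwise turns F - Y into F - p Y; since Y integrates to 0 this has the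
    same integral as F.\<close>
  have le: "F x - p * Y x \<le> p powr p * (hgrad_norm op deg u x powr p * W (S x))" for x
  proof (cases "x \<in> U")
    case False
    thus ?thesis using W0 by (simp add: F_def Y_def Yi_def)
  next
    case True
    hence xT: "S x \<in> T" by (simp add: U_def)
    have "Yi i x = up x * (2 * (x $ i)\<^sup>2 * q' (S x) + q (S x))
        + \<phi>' (u x) * q (S x) * (Xop op i u x * x $ i)" if i: "i \<in> zidx m" for i
    proof -
      have X: "lvf op (axis i 1) x $ j = (if i = j then 1 else 0)" if "j \<in> zidx m" for j
        using lvf_layer1_const[OF G zidx_deg[OF i] zidx_deg[OF that]] .
      have "S' x (lvf op (axis i 1) x) = 2 * x $ i"
      proof -
        have "S' x (lvf op (axis i 1) x) = (\<Sum>j\<in>zidx m. if i = j then 2 * x $ j else 0)"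
          unfolding S'_def by (rule sum.cong) (simp_all add: X)
        thus ?thesis using i by simp
      qed
      thus ?thesis using True X[OF i] Xop_eq[OF u]
        by (simp add: Yi_def v'_def up'_def algebra_simps power2_eq_square)
    qed
    hence "Y x = (\<Sum>i\<in>zidx m. up x * (2 * (x $ i)\<^sup>2 * q' (S x) + q (S x)))
        + \<phi>' (u x) * q (S x) * (\<Sum>i\<in>zidx m. Xop op i u x * x $ i)"
      by (simp add: Y_def sum.distrib sum_distrib_left)
    also have "(\<Sum>i\<in>zidx m. up x * (2 * (x $ i)\<^sup>2 * q' (S x) + q (S x))) = F x"
    proof -
      have "(\<Sum>i\<in>zidx m. 2 * (x $ i)\<^sup>2 * q' (S x)) = 2 * S x * q' (S x)"
        by (simp add: S_eq sum_distrib_left sum_distrib_right)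
      hence "(\<Sum>i\<in>zidx m. 2 * (x $ i)\<^sup>2 * q' (S x) + q (S x)) = real m * q (S x) + 2 * S x * q' (S x)"
        by (simp add: sum.distrib card_zidx_carnot)
      thus ?thesis using True by (simp add: F_def flip: sum_distrib_left)
    qed
    finally have "F x - Y x = - (\<phi>' (u x) * q (S x) * (\<Sum>i\<in>zidx m. Xop op i u x * x $ i))" by simp
    also have "\<dots> \<le> \<bar>\<phi>' (u x)\<bar> * \<bar>q (S x)\<bar> * \<bar>\<Sum>i\<in>zidx m. Xop op i u x * x $ i\<bar>"
      by (simp only: abs_mult[symmetric] abs_ge_minus_self)
    also have "\<dots> \<le> \<bar>\<phi>' (u x)\<bar> * \<bar>q (S x)\<bar> * (hgrad_norm op deg u x * znorm m x)"
      by (intro mult_left_mono sum_Xop_le) auto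
    also have "\<dots> \<le> (p * \<bar>u x\<bar> powr (p - 1)) * \<bar>q (S x)\<bar> * (hgrad_norm op deg u x * znorm m x)"
      using p by (intro mult_right_mono) (auto simp: \<phi>'_def abs_mult abs_sgn_eq)
    also have "\<dots> = p * \<bar>u x\<bar> powr (p - 1) * hgrad_norm op deg u x * (\<bar>q (S x)\<bar> * sqrt (S x))"
      by (simp add: S_def)
    also have "\<dots> \<le> (1 - 1 / p) * (\<bar>u x\<bar> powr p * D (S x))
        + p powr (p - 1) * (hgrad_norm op deg u x powr p * W (S x))"
      using W[OF xT S0] D0[OF xT S0] W0 S0 by (intro weighted_Young[OF p]) auto
    finally have "p * (F x - Y x) \<le> p * ((1 - 1 / p) * F x
        + p powr (p - 1) * (hgrad_norm op deg u x powr p * W (S x)))"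
      using p by (intro mult_left_mono) (auto simp: F_eq)
    also have "\<dots> = (p - 1) * F x + (p * p powr (p - 1)) * (hgrad_norm op deg u x powr p * W (S x))"
      using p by (simp add: right_diff_distrib distrib_left left_diff_distrib mult.assoc)
    also have "p * p powr (p - 1) = p powr p" using p by (simp add: powr_mult_base)
    finally show ?thesis by (simp add: algebra_simps)
  qed
  have "(\<integral>\<^sup>+x. ennreal (F x) \<partial>lborel) = ennreal (integral\<^sup>L lborel F)"
    by (intro nn_integral_eq_integral F) (simp add: F0)
  also have "integral\<^sup>L lborel F = integral\<^sup>L lborel (\<lambda>x. F x - p * Y x)"
    using F Y by simp
  also have "ennreal \<dots> \<le> (\<integral>\<^sup>+x. ennreal (F x - p * Y x) \<partial>lborel)"
    using F Y by (intro ennreal_integral_le_nn_integral) auto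
  also have "\<dots> \<le> (\<integral>\<^sup>+x. ennreal (p powr p) * ennreal (hgrad_norm op deg u x powr p * W (S x)) \<partial>lborel)"
    using le p by (intro nn_integral_mono) (simp add: W0 flip: ennreal_mult')
  also have "\<dots> = ennreal (p powr p) * (\<integral>\<^sup>+x. ennreal (hgrad_norm op deg u x powr p * W (S x)) \<partial>lborel)"
  proof (rule nn_integral_cmult)
    have [measurable]: "hgrad_norm op deg u \<in> borel_measurable borel"
      by (intro borel_measurable_continuous_onI continuous_on_hgrad_norm[OF u])
    note Wm[measurable]
    show "(\<lambda>x. ennreal (hgrad_norm op deg u x powr p * W (S x))) \<in> borel_measurable lborel"
      unfolding S_def by measurable
  qed
  finally show ?thesis by (simp add: F_eq S_def)
qed

end

section \<open>Singular weights\<close>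

text \<open>Squaring removes the kink of \<open>max\<close>. This truncated square is the building
  block of every C^1 cutoff below.\<close>

lemma max_square_has_real_derivative:
  "((\<lambda>t. (max 0 (t - c))\<^sup>2) has_real_derivative 2 * max 0 (t - c)) (at (t::real))"
proof -
  consider "t > c" | "t < c" | "t = c" by linarith
  thus ?thesis
  proof cases
    case 1
    have "((\<lambda>t. (t - c)\<^sup>2) has_real_derivative 2 * (t - c)) (at t)"
      by (auto intro!: derivative_eq_intros)
    hence "((\<lambda>t. (max 0 (t - c))\<^sup>2) has_real_derivative 2 * (t - c)) (at t)"
      by (rule has_field_derivative_transform_within_open[where S = "{c<..}"]) (use 1 in auto)
    thus ?thesis using 1 by simp
  next
    case 2
    have "((\<lambda>t. 0) has_real_derivative 0) (at t)" by simp
    hence "((\<lambda>t. (max 0 (t - c))\<^sup>2) has_real_derivative 0) (at t)"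
      by (rule has_field_derivative_transform_within_open[where S = "{..<c}"]) (use 2 in auto)
    thus ?thesis using 2 by simp
  next
    case 3
    have "((\<lambda>h. max 0 h) \<longlongrightarrow> max 0 (0::real)) (at 0)" by (intro tendsto_intros)
    moreover have "max 0 h = (max 0 h)\<^sup>2 / h" for h :: real by (auto simp: max_def power2_eq_square)
    ultimately have "((\<lambda>h::real. (max 0 h)\<^sup>2 / h) \<longlongrightarrow> 0) (at 0)" by simp
    thus ?thesis using 3 by (simp add: DERIV_def)
  qed
qed

text \<open>A truncation \<open>\<Phi>\<close> of the identity with \<open>\<Phi> t \<le> t\<close> and \<open>\<Phi> t \<le> t * \<Phi>' t\<close>: replacing \<open>g\<close> by \<open>\<Phi> \<circ> g\<close> then
  preserves the pointwise condition on the weight \<open>W\<close> below, with no loss in the constant.\<close>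
definition cutoff_id :: "real \<Rightarrow> real \<Rightarrow> real" where
  "cutoff_id \<epsilon> t = (max 0 (t - \<epsilon>))\<^sup>2 / t"

definition cutoff_id_deriv :: "real \<Rightarrow> real \<Rightarrow> real" where
  "cutoff_id_deriv \<epsilon> t = max 0 (t - \<epsilon>) * (t + \<epsilon>) / t\<^sup>2"

lemma cutoff_id_has_real_derivative:
  assumes "0 < t"
  shows "(cutoff_id \<epsilon> has_real_derivative cutoff_id_deriv \<epsilon> t) (at t)"
proof -
  let ?c = "max 0 (t - \<epsilon>)"
  have "((\<lambda>t. (max 0 (t - \<epsilon>))\<^sup>2 / t) has_real_derivative
      (2 * ?c * t - ?c\<^sup>2 * 1) / (t * t)) (at t)"
    by (rule DERIV_divide[OF max_square_has_real_derivative DERIV_ident]) (use assms in auto)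
  moreover have "(2 * ?c * t - ?c\<^sup>2 * 1) / (t * t) = cutoff_id_deriv \<epsilon> t"
    by (auto simp: cutoff_id_deriv_def max_def power2_eq_square algebra_simps)
  ultimately show ?thesis by (simp add: cutoff_id_def[abs_def])
qed

lemma cutoff_id_deriv_nonneg: "0 < \<epsilon> \<Longrightarrow> 0 < t \<Longrightarrow> 0 \<le> cutoff_id_deriv \<epsilon> t"
  by (simp add: cutoff_id_deriv_def)

lemma cutoff_id_bounds:
  assumes "0 < \<epsilon>" "0 < t"
  shows "0 \<le> cutoff_id \<epsilon> t" "cutoff_id \<epsilon> t \<le> t" "cutoff_id \<epsilon> t \<le> t * cutoff_id_deriv \<epsilon> t"
proof -
  let ?c = "max 0 (t - \<epsilon>)"
  have c: "0 \<le> ?c" "?c \<le> t" "?c \<le> t + \<epsilon>" using assms by auto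
  show "0 \<le> cutoff_id \<epsilon> t" using assms by (simp add: cutoff_id_def)
  have "?c * ?c \<le> t * t" using c assms by (intro mult_mono) auto
  thus "cutoff_id \<epsilon> t \<le> t" using assms by (simp add: cutoff_id_def power2_eq_square field_simps)
  have "?c * ?c \<le> ?c * (t + \<epsilon>)" using c by (intro mult_left_mono) auto
  thus "cutoff_id \<epsilon> t \<le> t * cutoff_id_deriv \<epsilon> t"
    using assms by (simp add: cutoff_id_def cutoff_id_deriv_def power2_eq_square divide_right_mono)
qed

lemma cutoff_id_deriv_tendsto:
  assumes "0 < t"
  shows "(\<lambda>n. cutoff_id_deriv (inverse (real (Suc n))) t) \<longlonglongrightarrow> 1"
proof -
  have "(\<lambda>n. cutoff_id_deriv (inverse (real (Suc n))) t) \<longlonglongrightarrow> max 0 (t - 0) * (t + 0) / t\<^sup>2"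
    unfolding cutoff_id_deriv_def by (intro tendsto_intros LIMSEQ_inverse_real_of_nat) (use assms in auto)
  thus ?thesis using assms by (simp add: power2_eq_square)
qed

context
  fixes op :: "(real, 'n::{finite,linorder}) vec \<Rightarrow> (real, 'n) vec \<Rightarrow> (real, 'n) vec"
    and deg :: "'n \<Rightarrow> nat" and m :: nat
  assumes G: "hcarnot op deg" and m1: "1 \<le> m" and ml: "m \<le> card (layer deg 1)"
begin

text \<open>The field is z |z|^(-m) g(|z|^2). Since z |z|^(-m) is divergence free off z = 0, the
  divergence is 2 s^(1-m/2) g'(s) without a term in g, and |h| is s^((1-m)/2) g(s), which explains
  the condition on \<open>W\<close>. The limit g \<longlongrightarrow> 0 at s = 0 is what allows the
  truncated field to vanish near the singularity.\<close>

lemma hardy_singular: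
  fixes W g g' :: "real \<Rightarrow> real"
  assumes p: "1 < p" and u: "u \<in> C1_0 {x. (znorm m x)\<^sup>2 < T0}"
    and g: "\<And>s. 0 < s \<Longrightarrow> s < T0 \<Longrightarrow> (g has_real_derivative g' s) (at s)"
    and g': "continuous_on {0<..<T0} g'"
    and pos: "\<And>s. 0 < s \<Longrightarrow> s < T0 \<Longrightarrow> 0 < g s" "\<And>s. 0 < s \<Longrightarrow> s < T0 \<Longrightarrow> 0 \<le> g' s"
    and lim: "(g \<longlongrightarrow> 0) (at_right 0)"
    and meas: "g \<in> borel_measurable borel" "g' \<in> borel_measurable borel"
    and Wm: "W \<in> borel_measurable borel" and W0: "\<And>s. 0 \<le> W s"
    and W: "\<And>s. 0 < s \<Longrightarrow> s < T0 \<Longrightarrow>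
      (s powr ((1 - real m) / 2) * g s) powr p \<le> (2 * s powr (1 - real m / 2) * g' s) powr (p - 1) * W s"
  shows "(\<integral>\<^sup>+x. ennreal (\<bar>u x\<bar> powr p *
            (2 * (znorm m x)\<^sup>2 powr (1 - real m / 2) * g' ((znorm m x)\<^sup>2))) \<partial>lborel)
    \<le> ennreal (p powr p) * (\<integral>\<^sup>+x. ennreal (hgrad_norm op deg u x powr p * W ((znorm m x)\<^sup>2)) \<partial>lborel)"
    (is "_ \<le> ?R")
proof -
  obtain u' K where u': "has_C1_derivative u u'" and K: "compact K" "K \<subseteq> {x. (znorm m x)\<^sup>2 < T0}"
      and zero: "\<And>x. x \<notin> K \<Longrightarrow> u x = 0" using u by (rule C1_0E) blast
  define D where "D \<epsilon> s = (if s \<le> 0 then 0 else 2 * s powr (1 - real m / 2) * g' s * cutoff_id_deriv \<epsilon> (g s))" for \<epsilon> s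
  have main: "(\<integral>\<^sup>+x. ennreal (\<bar>u x\<bar> powr p * D \<epsilon> ((znorm m x)\<^sup>2)) \<partial>lborel) \<le> ?R" if \<epsilon>: "0 < \<epsilon>" for \<epsilon>
  proof -
    \<comment> \<open>Below \<open>b\<close> the values of g stay under \<epsilon>, where
      \<open>cutoff_id\<close> and its derivative are 0. So the truncated profile is identically 0
      for s < b, is C^1 across s = 0, and \<open>T\<close> can be the whole half-line up to
      \<open>T0\<close>.\<close>
    have "eventually (\<lambda>s. g s < \<epsilon>) (at_right 0)" using lim \<epsilon> by (rule order_tendstoD)
    then obtain b where b: "0 < b" "\<And>s. 0 < s \<Longrightarrow> s < b \<Longrightarrow> g s < \<epsilon>"
      unfolding eventually_at_right_field by auto
    define q where "q s = (if s \<le> 0 then 0 else s powr (- real m / 2) * cutoff_id \<epsilon> (g s))" for s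
    define q' where "q' s = (if s \<le> 0 then 0 else
      - real m / 2 * s powr (- real m / 2 - 1) * cutoff_id \<epsilon> (g s)
      + cutoff_id_deriv \<epsilon> (g s) * g' s * s powr (- real m / 2))" for s
    have q0: "q s = 0" "q' s = 0" if "s < b" for s
      using b(2)[of s] that by (auto simp: q_def q'_def cutoff_id_def cutoff_id_deriv_def max_def)
    show ?thesis
    proof (rule hardy_weighted[OF G m1 ml p u' K(1) zero, of "{..<T0}" q q'])
      show "(q has_real_derivative q' s) (at s)" if s: "s \<in> {..<T0}" for s
      proof (cases "s < b")
        case True
        have "((\<lambda>s. 0) has_real_derivative 0) (at s)" by simp
        hence "(q has_real_derivative 0) (at s)"
          by (rule has_field_derivative_transform_within_open[where S = "{..<b}"]) (use True q0 in auto)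
        thus ?thesis using q0 True by simp
      next
        case False
        hence s0: "0 < s" using b by auto
        have "((\<lambda>s. s powr (- real m / 2)) has_real_derivative - real m / 2 * s powr (- real m / 2 - 1)) (at s)"
          using s0 has_real_derivative_powr by blast
        moreover have "((\<lambda>s. cutoff_id \<epsilon> (g s)) has_real_derivative cutoff_id_deriv \<epsilon> (g s) * g' s) (at s)"
          using DERIV_chain2[OF cutoff_id_has_real_derivative g] pos s s0 by auto
        ultimately have "((\<lambda>s. s powr (- real m / 2) * cutoff_id \<epsilon> (g s)) has_real_derivative q' s) (at s)"
          using s0 DERIV_mult by (fastforce simp: q'_def)
        thus ?thesis
          by (rule has_field_derivative_transform_within_open[where S = "{0<..}"]) (use s0 in \<open>auto simp: q_def\<close>)
      qed
      have "continuous_on ({..<min b T0} \<union> {0<..<T0}) q'"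
      proof (rule continuous_on_open_Un)
        show "continuous_on {..<min b T0} q'"
          by (rule continuous_on_cong[THEN iffD1, OF refl _ continuous_on_const[of _ 0]]) (auto simp: q0)
        have gc: "continuous_on {0<..<T0} g"
          using g by (auto intro!: continuous_at_imp_continuous_on DERIV_isCont)
        have "continuous_on {0<..<T0} (\<lambda>s. - real m / 2 * s powr (- real m / 2 - 1) * cutoff_id \<epsilon> (g s)
            + cutoff_id_deriv \<epsilon> (g s) * g' s * s powr (- real m / 2))"
          unfolding cutoff_id_def cutoff_id_deriv_def
          by (intro continuous_intros gc g') (use pos in \<open>auto simp: less_imp_neq[symmetric]\<close>)
        thus "continuous_on {0<..<T0} q'"
          by (rule continuous_on_cong[THEN iffD1, rotated 2]) (auto simp: q'_def)
      qed auto
      moreover have "{..<min b T0} \<union> {0<..<T0} = {..<T0}" using b(1) by auto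
      ultimately show "continuous_on {..<T0} q'" by simp
      show "D \<epsilon> s = real m * q s + 2 * s * q' s" if "s \<in> {..<T0}" "0 \<le> s" for s
      proof (cases "s = 0")
        case False
        hence *: "s * s powr (- real m / 2 - 1) = s powr (- real m / 2)"
          "s * s powr (- real m / 2) = s powr (1 - real m / 2)"
          using that powr_add[of s 1 "- real m / 2 - 1"] powr_add[of s 1 "- real m / 2"] by auto
        have "2 * s * (- k / 2 * A * c + d * e * B) = - k * (s * A) * c + 2 * d * e * (s * B)"
          for A B c d e k :: real by (simp add: algebra_simps)
        hence "2 * s * (- real m / 2 * s powr (- real m / 2 - 1) * cutoff_id \<epsilon> (g s)
            + cutoff_id_deriv \<epsilon> (g s) * g' s * s powr (- real m / 2))
          = - real m * s powr (- real m / 2) * cutoff_id \<epsilon> (g s)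
            + 2 * cutoff_id_deriv \<epsilon> (g s) * g' s * s powr (1 - real m / 2)"
          by (simp only: *)
        thus ?thesis using that False by (simp add: D_def q_def q'_def algebra_simps)
      qed (simp add: D_def q_def)
      show "0 \<le> D \<epsilon> s" if "s \<in> {..<T0}" "0 \<le> s" for s
        using that pos \<epsilon> by (auto simp: D_def cutoff_id_deriv_nonneg)
      show "(\<bar>q s\<bar> * sqrt s) powr p \<le> D \<epsilon> s powr (p - 1) * W s" if "s \<in> {..<T0}" "0 \<le> s" for s
      proof (cases "s = 0")
        case False
        hence s: "0 < s" "s < T0" using that by auto
        note gs = pos[OF s]
        note cb = cutoff_id_bounds[OF \<epsilon> gs(1)]
        \<comment> \<open>Truncation multiplies |h| by \<psi> and the divergence by
          \<open>cutoff_id_deriv\<close>. Preserving the condition on \<open>W\<close> amounts to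
          \<psi>^p \<le> \<open>cutoff_id_deriv\<close>^(p-1), which follows from \<psi> \<le> 1
          together with \<psi> \<le> \<open>cutoff_id_deriv\<close>.\<close>
        define \<psi> where "\<psi> = cutoff_id \<epsilon> (g s) / g s"
        have \<psi>: "0 \<le> \<psi>" "\<psi> \<le> 1" "\<psi> \<le> cutoff_id_deriv \<epsilon> (g s)" "cutoff_id \<epsilon> (g s) = g s * \<psi>"
          using cb gs by (auto simp: \<psi>_def field_simps)
        have "\<psi> powr p \<le> \<psi> powr (p - 1)" using \<psi> p by (intro powr_mono') auto
        also have "\<dots> \<le> cutoff_id_deriv \<epsilon> (g s) powr (p - 1)" using \<psi> p by (intro powr_mono2) auto
        finally have \<psi>p: "\<psi> powr p \<le> cutoff_id_deriv \<epsilon> (g s) powr (p - 1)" .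
        have "s powr (- real m / 2) * sqrt s = s powr ((1 - real m) / 2)"
          using s by (simp add: powr_half_sqrt[symmetric] diff_divide_distrib flip: powr_add)
        hence "\<bar>q s\<bar> * sqrt s = (s powr ((1 - real m) / 2) * g s) * \<psi>"
          using s \<psi> gs by (simp add: q_def abs_mult mult.assoc mult.left_commute)
        hence "(\<bar>q s\<bar> * sqrt s) powr p = (s powr ((1 - real m) / 2) * g s) powr p * \<psi> powr p"
          using s gs \<psi> by (simp add: powr_mult)
        also have "\<dots> \<le> ((2 * s powr (1 - real m / 2) * g' s) powr (p - 1) * W s) * cutoff_id_deriv \<epsilon> (g s) powr (p - 1)"
          using W[OF s] \<psi>p W0 by (intro mult_mono) auto
        also have "\<dots> = D \<epsilon> s powr (p - 1) * W s"
          using s gs cutoff_id_deriv_nonneg[OF \<epsilon> gs(1)] by (simp add: D_def powr_mult)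
        finally show ?thesis .
      qed (use W0 p in \<open>simp add: q_def\<close>)
    qed (use K Wm W0 in auto)
  qed
  \<comment> \<open>The bound \<open>main\<close> has the same right-hand side for all \<epsilon>,
    so pointwise convergence and Fatou's lemma suffice as \<epsilon> runs through 1/(n+1). At z = 0
    there is nothing to check, because 0 \<open>powr\<close> any exponent is 0.\<close>
  define f where "f n x = ennreal (\<bar>u x\<bar> powr p * D (inverse (real (Suc n))) ((znorm m x)\<^sup>2))" for n x
  note meas[measurable]
  have [measurable]: "u \<in> borel_measurable borel"
    by (intro borel_measurable_continuous_onI has_C1_derivativeD(3)[OF u'])
  have [measurable]: "f n \<in> borel_measurable lborel" for n
    unfolding f_def D_def cutoff_id_deriv_def by measurable
  have lim: "(\<lambda>n. f n x) \<longlonglongrightarrow> ennreal (\<bar>u x\<bar> powr p *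
            (2 * (znorm m x)\<^sup>2 powr (1 - real m / 2) * g' ((znorm m x)\<^sup>2)))" for x
  proof (cases "u x = 0 \<or> znorm m x = 0")
    case False
    let ?s = "(znorm m x)\<^sup>2"
    have s: "0 < ?s" "?s < T0" using False K zero[of x] by auto
    have "(\<lambda>n. \<bar>u x\<bar> powr p * (2 * ?s powr (1 - real m / 2) * g' ?s * cutoff_id_deriv (inverse (real (Suc n))) (g ?s)))
      \<longlonglongrightarrow> \<bar>u x\<bar> powr p * (2 * ?s powr (1 - real m / 2) * g' ?s * 1)"
      by (intro tendsto_intros cutoff_id_deriv_tendsto pos s)
    thus ?thesis using s unfolding f_def D_def by (auto intro!: tendsto_ennrealI)
  qed (auto simp: f_def D_def)
  have "(\<integral>\<^sup>+x. ennreal (\<bar>u x\<bar> powr p *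
            (2 * (znorm m x)\<^sup>2 powr (1 - real m / 2) * g' ((znorm m x)\<^sup>2))) \<partial>lborel)
      = (\<integral>\<^sup>+x. liminf (\<lambda>n. f n x) \<partial>lborel)"
    using lim_imp_Liminf[OF _ lim] by simp
  also have "\<dots> \<le> liminf (\<lambda>n. \<integral>\<^sup>+x. f n x \<partial>lborel)"
    by (rule nn_integral_liminf) simp
  also have "\<dots> \<le> limsup (\<lambda>n. \<integral>\<^sup>+x. f n x \<partial>lborel)"
    by (intro Liminf_le_Limsup) simp
  also have "\<dots> \<le> ?R"
    by (intro Limsup_bounded always_eventually allI) (simp add: f_def main)
  finally show ?thesis .
qed

end

section \<open>The two Hardy inequalities\<close>

lemma square_powr_half: "0 \<le> (z::real) \<Longrightarrow> z\<^sup>2 powr (a / 2) = z powr a"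
  by (cases "z = 0") (auto simp: powr_powr simp flip: powr_numeral)

text \<open>In both applications the divergence carries a factor c and \<open>W\<close> a factor
  c^(1-p). Moving them to one side gives c c^(p-1) / p^p, the Hardy constant.\<close>

lemma ennreal_scale_le:
  fixes A B :: ennreal
  assumes c: "0 < c" and p: "0 < p"
    and le: "ennreal c * A \<le> ennreal (p powr p) * (ennreal (c powr (1 - p)) * B)"
  shows "ennreal ((c / p) powr p) * A \<le> B"
proof -
  let ?k = "c powr (p - 1) / p powr p"
  have "(c / p) powr p = ?k * c"
    using c p by (simp add: powr_divide powr_diff)
  moreover have "ennreal (?k * c) = ennreal ?k * ennreal c" using c by (intro ennreal_mult) auto
  ultimately have "ennreal ((c / p) powr p) * A = ennreal ?k * (ennreal c * A)"
    by (simp only: mult.assoc)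
  also have "\<dots> \<le> ennreal ?k * (ennreal (p powr p) * (ennreal (c powr (1 - p)) * B))"
    using le by (intro mult_left_mono) auto
  also have "\<dots> = ennreal (?k * p powr p * c powr (1 - p)) * B"
  proof -
    have "ennreal (?k * p powr p * c powr (1 - p)) = ennreal ?k * ennreal (p powr p) * ennreal (c powr (1 - p))"
      by (subst ennreal_mult, simp, simp, subst ennreal_mult) simp_all
    thus ?thesis by (simp only: mult.assoc)
  qed
  also have "?k * p powr p * c powr (1 - p) = 1"
    using c p by (simp flip: powr_add)
  finally show ?thesis by simp
qed

context
  fixes op :: "(real, 'n::{finite,linorder}) vec \<Rightarrow> (real, 'n) vec \<Rightarrow> (real, 'n) vec"
    and deg :: "'n \<Rightarrow> nat" and m :: nat
  assumes G: "hcarnot op deg" and m1: "1 \<le> m" and ml: "m \<le> card (layer deg 1)"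
begin

text \<open>As m \<ge> 1, the set z = 0 lies in a coordinate hyperplane. It is discarded wherever
  the values assigned to division by 0 would break a pointwise comparison.\<close>

lemma AE_znorm_nonzero: "AE x in lborel. znorm m (x :: (real, 'n) vec) \<noteq> 0"
proof -
  have "zidx m \<noteq> ({} :: 'n set)" using card_zidx_carnot[OF G m1 ml] m1 by auto
  then obtain i :: 'n where i: "i \<in> zidx m" by blast
  have "{x :: (real, 'n) vec. x $ i = 0} \<in> null_sets lebesgue"
    using negligible_standard_hyperplane_cart by (simp add: negligible_iff_null_sets)
  hence "AE x in lebesgue. (x :: (real, 'n) vec) $ i \<noteq> 0" by (rule AE_I') auto
  hence "AE x in lborel. (x :: (real, 'n) vec) $ i \<noteq> 0" by (simp add: AE_completion_iff)
  thus ?thesis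
  proof (rule AE_mp, intro AE_I2 impI)
    fix x :: "(real, 'n) vec" assume "x $ i \<noteq> 0"
    hence "0 < (\<Sum>i\<in>zidx m. (x $ i)\<^sup>2)" using i by (intro sum_pos2[of _ i]) auto
    thus "znorm m x \<noteq> 0" by (simp add: znorm_def)
  qed
qed

lemma borel_measurable_C1_0:
  assumes "u \<in> C1_0 \<Omega>"
  shows "u \<in> borel_measurable borel" "hgrad_norm op deg u \<in> borel_measurable borel"
proof -
  obtain u' where u': "has_C1_derivative u u'" using assms by (rule C1_0E)
  show "u \<in> borel_measurable borel" "hgrad_norm op deg u \<in> borel_measurable borel"
    by (intro borel_measurable_continuous_onI continuous_on_hgrad_norm[OF G m1 ml u'] has_C1_derivativeD(3)[OF u'])+
qed

lemma hgrad_norm_zero_outside: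
  assumes "has_C1_derivative u u'" "closed K" "\<And>x. x \<notin> K \<Longrightarrow> u x = 0" "x \<notin> K"
  shows "hgrad_norm op deg u x = 0"
  using has_C1_derivative_zero_outside[OF assms] Xop_eq[OF G m1 ml assms(1)]
  by (simp add: hgrad_norm_def)

lemma C1_0_set_integrals:
  assumes u: "u \<in> C1_0 \<Omega>" and f: "\<And>x. u x = 0 \<Longrightarrow> f x = 0"
    and h: "\<And>x. hgrad_norm op deg u x = 0 \<Longrightarrow> h x = 0"
  shows "(\<integral>\<^sup>+x\<in>\<Omega>. f x \<partial>lborel) = (\<integral>\<^sup>+x. f x \<partial>lborel)"
    "(\<integral>\<^sup>+x\<in>\<Omega>. h x \<partial>lborel) = (\<integral>\<^sup>+x. h x \<partial>lborel)"
proof -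
  obtain u' K where u': "has_C1_derivative u u'" and K: "compact K" "K \<subseteq> \<Omega>"
      and zero: "\<And>x. x \<notin> K \<Longrightarrow> u x = 0" using u by (rule C1_0E) blast
  show "(\<integral>\<^sup>+x\<in>\<Omega>. f x \<partial>lborel) = (\<integral>\<^sup>+x. f x \<partial>lborel)"
    using zero f K by (intro nn_integral_cong) (auto simp: indicator_def)
  show "(\<integral>\<^sup>+x\<in>\<Omega>. h x \<partial>lborel) = (\<integral>\<^sup>+x. h x \<partial>lborel)"
    using hgrad_norm_zero_outside[OF u' compact_imp_closed[OF K(1)] zero] h K
    by (intro nn_integral_cong) (auto simp: indicator_def)
qed

text \<open>The sign of m + \<beta> decides how z = 0 is treated. If positive, G = |z|^(m+\<beta>)
  tends to 0 there and the singular version applies. If negative, the field is reversed to -z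
  |z|^\<beta> to keep its divergence nonnegative, and since \<Omega> avoids z = 0 the regular
  version applies on s > 0. If zero, the constant is 0.\<close>

lemma hardy_power:
  assumes p: "1 < p" and u: "u \<in> C1_0 \<Omega>" and neg: "real m + \<beta> < 0 \<Longrightarrow> \<forall>x\<in>\<Omega>. znorm m x \<noteq> 0"
  shows "ennreal ((\<bar>real m + \<beta>\<bar> / p) powr p) *
           (\<integral>\<^sup>+x\<in>\<Omega>. ennreal (\<bar>u x\<bar> powr p * znorm m x powr \<beta>) \<partial>lborel)
         \<le> (\<integral>\<^sup>+x\<in>\<Omega>. ennreal (hgrad_norm op deg u x powr p * znorm m x powr (p + \<beta>)) \<partial>lborel)"
proof (cases "real m + \<beta> = 0")
  case True
  thus ?thesis using p by simp
next
  case False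
  define c where "c = \<bar>real m + \<beta>\<bar>"
  have c: "0 < c" using False by (simp add: c_def)
  obtain u' K where u': "has_C1_derivative u u'" and K: "compact K" "K \<subseteq> \<Omega>"
      and zero: "\<And>x. x \<notin> K \<Longrightarrow> u x = 0" using u by (rule C1_0E) blast
  \<comment> \<open>Solved from equality: with |h| = |z|^(\<beta>+1) and D = c |z|^\<beta>, the
    exponent of |z| is p (\<beta>+1) - (p-1) \<beta> = p + \<beta>.\<close>
  define W where "W s = c powr (1 - p) * s powr ((p + \<beta>) / 2)" for s :: real
  have W0: "0 \<le> W s" for s by (simp add: W_def)
  have Wm: "W \<in> borel_measurable borel" unfolding W_def by measurable
  have ident: "(s powr ((\<beta> + 1) / 2)) powr p = (c * s powr (\<beta> / 2)) powr (p - 1) * W s" if "0 < s" for s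
  proof -
    have "(c * s powr (\<beta> / 2)) powr (p - 1) * W s
      = (c powr (p - 1) * c powr (1 - p)) * (s powr (\<beta> / 2 * (p - 1)) * s powr ((p + \<beta>) / 2))"
      using that c by (simp add: W_def powr_mult powr_powr)
    also have "c powr (p - 1) * c powr (1 - p) = 1" using c by (simp flip: powr_add)
    also have "s powr (\<beta> / 2 * (p - 1)) * s powr ((p + \<beta>) / 2) = s powr ((\<beta> + 1) / 2 * p)"
    proof -
      have "\<beta> / 2 * (p - 1) + (p + \<beta>) / 2 = (\<beta> + 1) / 2 * p" by (simp add: field_simps)
      thus ?thesis by (simp only: powr_add[symmetric])
    qed
    finally show ?thesis by (simp add: powr_powr)
  qed
  have "(\<integral>\<^sup>+x. ennreal (\<bar>u x\<bar> powr p * (c * (znorm m x)\<^sup>2 powr (\<beta> / 2))) \<partial>lborel)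
    \<le> ennreal (p powr p) * (\<integral>\<^sup>+x. ennreal (hgrad_norm op deg u x powr p * W ((znorm m x)\<^sup>2)) \<partial>lborel)"
  proof (cases "real m + \<beta> > 0")
    case pos: True
    have "bounded ((\<lambda>x. (znorm m x)\<^sup>2) ` K)"
      by (intro compact_imp_bounded compact_continuous_image K continuous_intros)
    \<comment> \<open>\<open>g\<close> is regular on all of s > 0; \<open>T0\<close> is just some
      strict bound for |z|^2 on the support.\<close>
    then obtain T0 where T0: "\<And>x. x \<in> K \<Longrightarrow> (znorm m x)\<^sup>2 < T0"
      unfolding bounded_pos_less by (auto simp: abs_less_iff)
    define g where "g s = s powr ((real m + \<beta>) / 2)" for s :: real
    define g' where "g' s = (real m + \<beta>) / 2 * s powr ((real m + \<beta>) / 2 - 1)" for s :: real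
    have D: "2 * s powr (1 - real m / 2) * g' s = c * s powr (\<beta> / 2)" for s
    proof -
      have "s powr (1 - real m / 2) * s powr ((real m + \<beta>) / 2 - 1) = s powr (\<beta> / 2)"
        by (simp add: add_divide_distrib flip: powr_add)
      thus ?thesis using pos by (simp add: g'_def c_def)
    qed
    have "(\<integral>\<^sup>+x. ennreal (\<bar>u x\<bar> powr p *
            (2 * (znorm m x)\<^sup>2 powr (1 - real m / 2) * g' ((znorm m x)\<^sup>2))) \<partial>lborel)
    \<le> ennreal (p powr p) * (\<integral>\<^sup>+x. ennreal (hgrad_norm op deg u x powr p * W ((znorm m x)\<^sup>2)) \<partial>lborel)"
    proof (rule hardy_singular[OF G m1 ml p, where ?T0.0 = T0 and g = g])
      show "u \<in> C1_0 {x. (znorm m x)\<^sup>2 < T0}"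
        by (rule C1_0I[OF u' K(1) _ zero]) (use T0 in auto)
      show "(g has_real_derivative g' s) (at s)" if "0 < s" for s
        using that unfolding g_def g'_def by (rule has_real_derivative_powr)
      show "continuous_on {0<..<T0} g'" unfolding g'_def by (intro continuous_intros) auto
      show "(g \<longlongrightarrow> 0) (at_right 0)"
      proof -
        have "(g \<longlongrightarrow> 0 powr ((real m + \<beta>) / 2)) (at_right 0)" unfolding g_def
          by (intro tendsto_powr' tendsto_intros) (use pos in \<open>auto simp: eventually_at_filter\<close>)
        thus ?thesis by simp
      qed
      show "(s powr ((1 - real m) / 2) * g s) powr p \<le> (2 * s powr (1 - real m / 2) * g' s) powr (p - 1) * W s"
        if "0 < s" for s
      proof -
        have "s powr ((1 - real m) / 2) * g s = s powr ((\<beta> + 1) / 2)"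
          by (simp add: g_def diff_divide_distrib add_divide_distrib add.commute flip: powr_add)
        thus ?thesis using ident[OF that] by (simp add: D)
      qed
      show "g \<in> borel_measurable borel" "g' \<in> borel_measurable borel"
        unfolding g_def[abs_def] g'_def[abs_def] by measurable
    qed (use pos Wm W0 in \<open>auto simp: g_def g'_def\<close>)
    thus ?thesis by (simp only: D)
  next
    case notpos: False
    hence lt: "real m + \<beta> < 0" using False by simp
    show ?thesis
    proof (rule hardy_weighted[OF G m1 ml p u' K(1) zero, where T = "{0<..}"
          and q = "\<lambda>s. - (s powr (\<beta> / 2))" and q' = "\<lambda>s. - (\<beta> / 2 * s powr (\<beta> / 2 - 1))"])
      show "(znorm m x)\<^sup>2 \<in> {0<..}" if "x \<in> K" for x using neg[OF lt] that K by auto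
      show "((\<lambda>s. - (s powr (\<beta> / 2))) has_real_derivative - (\<beta> / 2 * s powr (\<beta> / 2 - 1))) (at s)"
        if "s \<in> {0<..}" for s using that by (intro DERIV_minus has_real_derivative_powr) auto
      show "continuous_on {0<..} (\<lambda>s::real. - (\<beta> / 2 * s powr (\<beta> / 2 - 1)))"
        by (intro continuous_intros) auto
      show "c * s powr (\<beta> / 2) = real m * - (s powr (\<beta> / 2)) + 2 * s * - (\<beta> / 2 * s powr (\<beta> / 2 - 1))"
        if "s \<in> {0<..}" for s
      proof -
        have "s * s powr (\<beta> / 2 - 1) = s powr (\<beta> / 2)" using that by (simp add: powr_mult_base)
        hence "2 * s * - (\<beta> / 2 * s powr (\<beta> / 2 - 1)) = - \<beta> * s powr (\<beta> / 2)"
          by (simp add: mult.left_commute)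
        thus ?thesis using lt by (simp add: c_def algebra_simps)
      qed
      show "(\<bar>- (s powr (\<beta> / 2))\<bar> * sqrt s) powr p \<le> (c * s powr (\<beta> / 2)) powr (p - 1) * W s"
        if "s \<in> {0<..}" for s
      proof -
        have "\<bar>- (s powr (\<beta> / 2))\<bar> * sqrt s = s powr ((\<beta> + 1) / 2)"
          using that by (simp add: powr_half_sqrt[symmetric] add_divide_distrib flip: powr_add)
        thus ?thesis using ident[of s] that by simp
      qed
    qed (use c W0 Wm in auto)
  qed
  note borel_measurable_C1_0[OF u, measurable]
  have "ennreal c * (\<integral>\<^sup>+x. ennreal (\<bar>u x\<bar> powr p * znorm m x powr \<beta>) \<partial>lborel)
    = (\<integral>\<^sup>+x. ennreal (\<bar>u x\<bar> powr p * (c * (znorm m x)\<^sup>2 powr (\<beta> / 2))) \<partial>lborel)"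
    using c by (subst nn_integral_cmult[symmetric])
      (auto simp: square_powr_half mult.left_commute simp flip: ennreal_mult')
  also have "\<dots> \<le> ennreal (p powr p) * (\<integral>\<^sup>+x. ennreal (hgrad_norm op deg u x powr p * W ((znorm m x)\<^sup>2)) \<partial>lborel)"
    by fact
  also have "(\<integral>\<^sup>+x. ennreal (hgrad_norm op deg u x powr p * W ((znorm m x)\<^sup>2)) \<partial>lborel)
    = ennreal (c powr (1 - p)) * (\<integral>\<^sup>+x. ennreal (hgrad_norm op deg u x powr p * znorm m x powr (p + \<beta>)) \<partial>lborel)"
    by (subst nn_integral_cmult[symmetric])
      (auto simp: W_def square_powr_half mult.left_commute simp flip: ennreal_mult')
  finally have "ennreal ((c / p) powr p) * (\<integral>\<^sup>+x. ennreal (\<bar>u x\<bar> powr p * znorm m x powr \<beta>) \<partial>lborel)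
    \<le> (\<integral>\<^sup>+x. ennreal (hgrad_norm op deg u x powr p * znorm m x powr (p + \<beta>)) \<partial>lborel)"
    using c p by (intro ennreal_scale_le) auto
  thus ?thesis
    using p C1_0_set_integrals[OF u, of "\<lambda>x. ennreal (\<bar>u x\<bar> powr p * znorm m x powr \<beta>)"
        "\<lambda>x. ennreal (hgrad_norm op deg u x powr p * znorm m x powr (p + \<beta>))"]
    by (simp add: c_def)
qed

text \<open>With p = m the choice is G = ln(R/|z|)^(\<beta>+1). Because \<beta> + 1 < 0, it is
  positive, increasing in |z| and tends to 0 at z = 0, exactly what the singular version
  asks.\<close>

lemma hardy_log:
  assumes p: "p = real m" "1 < p" and R: "0 < R" and \<beta>: "\<beta> < - 1" and u: "u \<in> C1_0 {x. znorm m x < R}"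
  shows "ennreal ((\<bar>\<beta> + 1\<bar> / p) powr p) *
           (\<integral>\<^sup>+x\<in>{x. znorm m x < R}. ennreal (\<bar>u x\<bar> powr p / znorm m x powr p * ln (R / znorm m x) powr \<beta>) \<partial>lborel)
         \<le> (\<integral>\<^sup>+x\<in>{x. znorm m x < R}. ennreal (hgrad_norm op deg u x powr p * ln (R / znorm m x) powr (p + \<beta>)) \<partial>lborel)"
proof -
  define c where "c = \<bar>\<beta> + 1\<bar>"
  have c: "0 < c" "\<beta> + 1 = - c" using \<beta> by (simp_all add: c_def)
  \<comment> \<open>This is ln(R/|z|) as a function of s = |z|^2. As before, \<open>W\<close> is the
    weight giving equality in |h|^p = D^(p-1) W.\<close>
  define L where "L s = ln R - ln s / 2" for s :: real
  have L_pos: "0 < L s" if "0 < s" "s < R\<^sup>2" for s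
  proof -
    have "ln s < ln (R\<^sup>2)" using that R by (subst ln_less_cancel_iff) auto
    thus ?thesis using R by (simp add: L_def ln_realpow)
  qed
  have L_square: "L (z\<^sup>2) = ln (R / z)" if "0 < z" for z
    using that R by (simp add: L_def ln_realpow ln_div)
  define W where "W s = c powr (1 - p) * L s powr (p + \<beta>)" for s
  have W0: "0 \<le> W s" for s by (simp add: W_def)
  have Wm: "W \<in> borel_measurable borel" unfolding W_def L_def by measurable
  define g where "g s = L s powr (\<beta> + 1)" for s
  define g' where "g' s = c * L s powr \<beta> / (2 * s)" for s
  have L_cont: "continuous_on {0<..<R\<^sup>2} L" unfolding L_def by (intro continuous_intros) auto
  have D: "2 * s powr (1 - real m / 2) * g' s = c * (s powr (- p / 2) * L s powr \<beta>)" if "0 \<le> s" for s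
  proof (cases "s = 0")
    case False
    hence "s powr (1 - real m / 2) = s * s powr (- p / 2)" using that p powr_add[of s 1 "- p / 2"] by simp
    thus ?thesis using False by (simp add: g'_def)
  qed simp
  have "(\<integral>\<^sup>+x. ennreal (\<bar>u x\<bar> powr p *
            (2 * (znorm m x)\<^sup>2 powr (1 - real m / 2) * g' ((znorm m x)\<^sup>2))) \<partial>lborel)
    \<le> ennreal (p powr p) * (\<integral>\<^sup>+x. ennreal (hgrad_norm op deg u x powr p * W ((znorm m x)\<^sup>2)) \<partial>lborel)"
  proof (rule hardy_singular[OF G m1 ml p(2), where ?T0.0 = "R\<^sup>2" and g = g])
    have "{x :: (real, 'n) vec. (znorm m x)\<^sup>2 < R\<^sup>2} = {x. znorm m x < R}"
      using R by (auto intro: power_strict_mono power_less_imp_less_base)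
    thus "u \<in> C1_0 {x. (znorm m x)\<^sup>2 < R\<^sup>2}" using u by simp
    show "(g has_real_derivative g' s) (at s)" if "0 < s" "s < R\<^sup>2" for s
    proof -
      have "(L has_real_derivative - 1 / (2 * s)) (at s)"
        unfolding L_def using that by (auto intro!: derivative_eq_intros)
      from DERIV_chain2[OF has_real_derivative_powr[OF L_pos[OF that], of "\<beta> + 1"] this]
      have "((\<lambda>s. L s powr (\<beta> + 1)) has_real_derivative (\<beta> + 1) * L s powr (\<beta> + 1 - 1) * (- 1 / (2 * s))) (at s)" .
      moreover have "(\<beta> + 1) * L s powr (\<beta> + 1 - 1) * (- 1 / (2 * s)) = - (\<beta> + 1) * L s powr \<beta> / (2 * s)"
      proof -
        have "x * y * (- 1 / z) = - x * y / z" for x y z :: real by simp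
        thus ?thesis by (simp only: add_diff_cancel_right')
      qed
      moreover have "- (\<beta> + 1) = c" using c by simp
      ultimately show ?thesis by (simp only: g_def[abs_def] g'_def)
    qed
    show "continuous_on {0<..<R\<^sup>2} g'" unfolding g'_def
      by (intro continuous_intros L_cont) (use L_pos in force)+
    have "filterlim (\<lambda>s::real. - ln s) at_top (at_right 0)"
      using ln_at_0 by (simp add: filterlim_uminus_at_top)
    hence "filterlim (\<lambda>s::real. (1 / 2) * - ln s) at_top (at_right 0)"
      by (intro filterlim_tendsto_pos_mult_at_top[OF tendsto_const]) auto
    hence "filterlim (\<lambda>s::real. ln R + (1 / 2) * - ln s) at_top (at_right 0)"
      by (intro filterlim_tendsto_add_at_top[OF tendsto_const])
    hence "filterlim L at_top (at_right 0)" by (simp add: L_def[abs_def])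
    thus "(g \<longlongrightarrow> 0) (at_right 0)" unfolding g_def using \<beta> by (intro tendsto_neg_powr) auto
    show "(s powr ((1 - real m) / 2) * g s) powr p \<le> (2 * s powr (1 - real m / 2) * g' s) powr (p - 1) * W s"
      if s: "0 < s" "s < R\<^sup>2" for s
    proof -
      have "(c * (s powr (- p / 2) * L s powr \<beta>)) powr (p - 1) * W s
        = (c powr (p - 1) * c powr (1 - p)) * s powr (- p / 2 * (p - 1)) * (L s powr (\<beta> * (p - 1)) * L s powr (p + \<beta>))"
        using c by (simp add: W_def powr_mult powr_powr)
      also have "c powr (p - 1) * c powr (1 - p) = 1" using c by (simp flip: powr_add)
      also have "L s powr (\<beta> * (p - 1)) * L s powr (p + \<beta>) = L s powr ((\<beta> + 1) * p)"
        by (simp add: algebra_simps flip: powr_add)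
      also have "- p / 2 * (p - 1) = (1 - real m) / 2 * p" using p by (simp add: field_simps)
      also have "1 * s powr ((1 - real m) / 2 * p) * L s powr ((\<beta> + 1) * p)
          = (s powr ((1 - real m) / 2) * g s) powr p"
        by (simp add: g_def powr_mult powr_powr)
      finally show ?thesis using s by (simp add: D)
    qed
    show "g \<in> borel_measurable borel" "g' \<in> borel_measurable borel"
      unfolding g_def g'_def L_def by measurable
    show "0 < g s" if "0 < s" "s < R\<^sup>2" for s using L_pos[OF that] by (simp add: g_def)
  qed (use c Wm W0 in \<open>auto simp: g'_def\<close>)
  also have "(\<integral>\<^sup>+x. ennreal (\<bar>u x\<bar> powr p *
            (2 * (znorm m x)\<^sup>2 powr (1 - real m / 2) * g' ((znorm m x)\<^sup>2))) \<partial>lborel)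
      = (\<integral>\<^sup>+x. ennreal c * ennreal (\<bar>u x\<bar> powr p / znorm m x powr p * ln (R / znorm m x) powr \<beta>) \<partial>lborel)"
  proof (rule nn_integral_cong)
    fix x :: "(real, 'n) vec"
    have "\<bar>u x\<bar> powr p * (2 * (znorm m x)\<^sup>2 powr (1 - real m / 2) * g' ((znorm m x)\<^sup>2))
      = c * (\<bar>u x\<bar> powr p / znorm m x powr p * ln (R / znorm m x) powr \<beta>)"
    proof (cases "znorm m x = 0")
      case False
      hence z: "0 < znorm m x" using znorm_nonneg[of m x] by linarith
      have "(znorm m x)\<^sup>2 powr (- p / 2) = 1 / znorm m x powr p"
        using square_powr_half[of "znorm m x" "- p"] by (simp add: powr_minus_divide)
      hence "2 * (znorm m x)\<^sup>2 powr (1 - real m / 2) * g' ((znorm m x)\<^sup>2)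
          = c * (1 / znorm m x powr p * ln (R / znorm m x) powr \<beta>)"
        by (simp only: D[OF zero_le_power2] L_square[OF z])
      thus ?thesis by simp
    qed (simp add: D)
    thus "ennreal (\<bar>u x\<bar> powr p * (2 * (znorm m x)\<^sup>2 powr (1 - real m / 2) * g' ((znorm m x)\<^sup>2)))
      = ennreal c * ennreal (\<bar>u x\<bar> powr p / znorm m x powr p * ln (R / znorm m x) powr \<beta>)"
      using c by (simp only: ennreal_mult'[OF less_imp_le])
  qed
  also have "(\<integral>\<^sup>+x. ennreal (hgrad_norm op deg u x powr p * W ((znorm m x)\<^sup>2)) \<partial>lborel)
    = (\<integral>\<^sup>+x. ennreal (c powr (1 - p)) * ennreal (hgrad_norm op deg u x powr p * ln (R / znorm m x) powr (p + \<beta>)) \<partial>lborel)"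
  \<comment> \<open>The identification of \<open>L\<close> with ln(R/|z|) is available for |z| > 0
    only, hence equality of the integrands almost everywhere.\<close>
  proof (rule nn_integral_cong_AE, rule AE_mp[OF AE_znorm_nonzero], intro AE_I2 impI)
    fix x :: "(real, 'n) vec" assume "znorm m x \<noteq> 0"
    hence z: "0 < znorm m x" using znorm_nonneg[of m x] by linarith
    show "ennreal (hgrad_norm op deg u x powr p * W ((znorm m x)\<^sup>2))
      = ennreal (c powr (1 - p)) * ennreal (hgrad_norm op deg u x powr p * ln (R / znorm m x) powr (p + \<beta>))"
      by (simp add: W_def L_square[OF z] mult.left_commute flip: ennreal_mult')
  qed
  finally have *: "(\<integral>\<^sup>+x. ennreal c * ennreal (\<bar>u x\<bar> powr p / znorm m x powr p * ln (R / znorm m x) powr \<beta>) \<partial>lborel)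
    \<le> ennreal (p powr p) * (\<integral>\<^sup>+x. ennreal (c powr (1 - p)) *
        ennreal (hgrad_norm op deg u x powr p * ln (R / znorm m x) powr (p + \<beta>)) \<partial>lborel)" .
  note borel_measurable_C1_0[OF u, measurable]
  have "ennreal ((c / p) powr p) * (\<integral>\<^sup>+x. ennreal (\<bar>u x\<bar> powr p / znorm m x powr p * ln (R / znorm m x) powr \<beta>) \<partial>lborel)
    \<le> (\<integral>\<^sup>+x. ennreal (hgrad_norm op deg u x powr p * ln (R / znorm m x) powr (p + \<beta>)) \<partial>lborel)"
    using c p by (intro ennreal_scale_le) (use * in \<open>auto simp: nn_integral_cmult\<close>)
  thus ?thesis
    using p C1_0_set_integrals[OF u, of "\<lambda>x. ennreal (\<bar>u x\<bar> powr p / znorm m x powr p * ln (R / znorm m x) powr \<beta>)"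
        "\<lambda>x. ennreal (hgrad_norm op deg u x powr p * ln (R / znorm m x) powr (p + \<beta>))"]
    by (simp add: c_def)
qed

section \<open>Comparison of |z| with homogeneous norms\<close>

lemma znorm_le_NS: "znorm m x \<le> NS deg x"
proof -
  define r where "r = Max (range deg)"
  have r: "1 \<le> r" unfolding r_def
    using hcarnot_deg[OF G] by (meson Max_ge finite_code finite_imageI order_trans rangeI)
  let ?e = "2 * fact r :: real"
  have "znorm m x \<le> blocknorm deg 1 x"
    unfolding znorm_def blocknorm_def
    by (intro real_sqrt_le_mono sum_mono2 zidx_subset_layer[OF G m1 ml]) auto
  hence "znorm m x powr ?e \<le> blocknorm deg 1 x powr ?e" by (intro powr_mono2) auto
  \<comment> \<open>The summand k = 1 alone suffices: its exponent is undone by the outer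
    root.\<close>
  also have "\<dots> = blocknorm deg 1 x powr (?e / real 1)" by simp
  also have "\<dots> \<le> (\<Sum>k\<in>{1..r}. blocknorm deg k x powr (?e / real k))"
    using r by (intro member_le_sum) auto
  finally have "(znorm m x powr ?e) powr (1 / ?e) \<le> (\<Sum>k\<in>{1..r}. blocknorm deg k x powr (?e / real k)) powr (1 / ?e)"
    by (intro powr_mono2) auto
  thus ?thesis by (simp add: powr_powr NS_def r_def Let_def)
qed

text \<open>The constant is the minimum of \<open>Nf\<close> on the Euclidean unit sphere, positive
  by compactness. A dilation by some s \<le> 1/|z| moves x onto that sphere, and homogeneity of
  \<open>Nf\<close> transfers the bound.\<close>

lemma znorm_le_hom_norm:
  assumes N: "hom_norm op deg Nf"
  obtains c where "0 < c" "\<And>x. c * znorm m x \<le> Nf x"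
proof -
  have Nc: "continuous_on A Nf" for A using N unfolding hom_norm_def by (auto intro: continuous_on_subset)
  have "\<exists>x0\<in>sphere (0 :: (real, 'n) vec) 1. \<forall>x\<in>sphere 0 1. Nf x0 \<le> Nf x"
    by (intro continuous_attains_inf Nc) auto
  then obtain x0 where x0: "norm x0 = 1" and min: "\<And>x. norm x = 1 \<Longrightarrow> Nf x0 \<le> Nf x" by auto
  have "Nf x0 \<noteq> 0" using N x0 unfolding hom_norm_def by auto
  hence pos: "0 < Nf x0" using N unfolding hom_norm_def by (metis less_le)
  show ?thesis
  proof (rule that[OF pos])
    fix x
    show "Nf x0 * znorm m x \<le> Nf x"
    proof (cases "znorm m x = 0")
      case True
      thus ?thesis using N by (simp add: hom_norm_def)
    next
      case False
      hence z: "0 < znorm m x" using znorm_nonneg[of m x] by linarith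
      let ?f = "\<lambda>s. norm (dil deg s x)"
      \<comment> \<open>Dilations act on z as multiplication by s, so |z| bounds the norm of the
        dilated point from below. It is 0 at s = 0 and at least 1 at s = 1/|z|; the intermediate
        value theorem gives a crossing of the sphere in between.\<close>
      have "s * znorm m x \<le> ?f s" if "0 \<le> s" for s
      proof -
        have "(s * znorm m x)\<^sup>2 = (\<Sum>i\<in>zidx m. (dil deg s x $ i)\<^sup>2)"
          using zidx_deg[OF G m1 ml]
          by (simp add: power_mult_distrib znorm_square dil_def sum_distrib_left)
        also have "\<dots> \<le> (\<Sum>i\<in>UNIV. (dil deg s x $ i)\<^sup>2)" by (intro sum_mono2) auto
        also have "\<dots> = (?f s)\<^sup>2" by (simp add: norm_vec_def L2_set_def sum_nonneg)
        finally show ?thesis by (rule power2_le_imp_le) simp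
      qed
      from this[of "1 / znorm m x"] have f1: "1 \<le> ?f (1 / znorm m x)" using z by simp
      have "dil deg 0 x = 0"
      proof -
        have "(0::real) ^ deg i = 0" for i using hcarnot_deg[OF G, of i] by (simp add: power_0_left)
        thus ?thesis by (simp add: dil_def vec_eq_iff power_0_left)
      qed
      hence f0: "?f 0 = 0" by simp
      have "continuous_on {0..1 / znorm m x} ?f" unfolding dil_def by (intro continuous_intros)
      then obtain s where s: "0 \<le> s" "s \<le> 1 / znorm m x" "?f s = 1"
        using IVT'[of ?f 0 1 "1 / znorm m x"] f0 f1 z by auto
      hence s0: "0 < s" using f0 by (cases "s = 0") auto
      hence "Nf x0 \<le> s * Nf x" using min[OF s(3)] N unfolding hom_norm_def by auto
      also have "\<dots> \<le> 1 / znorm m x * Nf x" using s N by (intro mult_right_mono) (auto simp: hom_norm_def)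
      finally show ?thesis using z by (simp add: field_simps)
    qed
  qed
qed

end

section \<open>Integration of radial functions\<close>

definition cylinder :: "nat \<Rightarrow> real \<Rightarrow> real \<Rightarrow> (real, 'n::{finite,linorder}) vec set" where
  "cylinder m a \<sigma> = {x. znorm m x < a \<and> restnorm m x < \<sigma>}"

lemma norm_le_znorm_restnorm: "norm x \<le> znorm m x + restnorm m x"
proof (rule power2_le_imp_le)
  have "(norm x)\<^sup>2 = (\<Sum>i\<in>zidx m \<union> - zidx m. (x $ i)\<^sup>2)" by (simp add: norm_vec_def L2_set_def sum_nonneg)
  also have "\<dots> = (znorm m x)\<^sup>2 + (restnorm m x)\<^sup>2"
    unfolding znorm_square restnorm_square by (rule sum.union_disjoint) auto
  also have "\<dots> \<le> (znorm m x + restnorm m x)\<^sup>2" by (simp add: power2_sum)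
  finally show "(norm x)\<^sup>2 \<le> (znorm m x + restnorm m x)\<^sup>2" .
qed (simp add: add_nonneg_nonneg)

lemma open_cylinder: "open (cylinder m a \<sigma>)"
  unfolding cylinder_def by (intro open_Collect_conj open_Collect_less continuous_intros)

lemma cylinder_lmeasurable: "cylinder m a \<sigma> \<in> lmeasurable"
proof (rule lmeasurable_open[OF _ open_cylinder])
  show "bounded (cylinder m a \<sigma> :: (real, 'n::{finite,linorder}) vec set)"
    unfolding bounded_iff
  proof (intro exI[of _ "a + \<sigma>"] ballI)
    fix x :: "(real, 'n) vec" assume "x \<in> cylinder m a \<sigma>"
    thus "norm x \<le> a + \<sigma>" using norm_le_znorm_restnorm[of x m] by (simp add: cylinder_def)
  qed
qed

text \<open>Stretching only the first m coordinates by a maps the cylinder of radius 1 onto that of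
  radius a and has determinant a^m.\<close>

lemma emeasure_cylinder:
  assumes "0 < a" "m \<le> CARD('n::{finite,linorder})"
  shows "emeasure lborel (cylinder m a \<sigma> :: (real, 'n) vec set)
    = ennreal (a ^ m * measure lebesgue (cylinder m 1 \<sigma> :: (real, 'n) vec set))"
proof -
  define d where "d k = (if k \<in> zidx m then a else 1)" for k :: 'n
  have zn: "znorm m (\<chi> k. d k * x $ k) = a * znorm m x" for x :: "(real, 'n) vec"
  proof -
    have "(\<Sum>i\<in>zidx m. (d i * x $ i)\<^sup>2) = (\<Sum>i\<in>zidx m. a\<^sup>2 * (x $ i)\<^sup>2)"
      by (rule sum.cong) (simp_all add: d_def power_mult_distrib)
    hence "(znorm m (\<chi> k. d k * x $ k))\<^sup>2 = (a * znorm m x)\<^sup>2"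
      by (simp add: znorm_square power_mult_distrib flip: sum_distrib_left)
    thus ?thesis by (rule power2_eq_imp_eq) (use assms in auto)
  qed
  have rn: "restnorm m (\<chi> k. d k * x $ k) = restnorm m x" for x :: "(real, 'n) vec"
  proof -
    have "(\<Sum>i\<in>- zidx m. (d i * x $ i)\<^sup>2) = (\<Sum>i\<in>- zidx m. (x $ i)\<^sup>2)"
      by (rule sum.cong) (simp_all add: d_def)
    thus ?thesis by (simp add: restnorm_def)
  qed
  have "cylinder m a \<sigma> = (\<lambda>x. \<chi> k. d k * x $ k) ` (cylinder m 1 \<sigma> :: (real, 'n) vec set)"
  proof (intro set_eqI iffI)
    fix y :: "(real, 'n) vec" assume y: "y \<in> cylinder m a \<sigma>"
    define x where "x = (\<chi> k. y $ k / d k)"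
    have yx: "y = (\<chi> k. d k * x $ k)" using assms by (auto simp: x_def d_def vec_eq_iff)
    have "znorm m y = a * znorm m x" "restnorm m y = restnorm m x"
      by (subst yx, rule zn) (subst yx, rule rn)
    hence "x \<in> cylinder m 1 \<sigma>" using y assms by (simp add: cylinder_def)
    thus "y \<in> (\<lambda>x. \<chi> k. d k * x $ k) ` cylinder m 1 \<sigma>" using yx by blast
  qed (use assms zn rn in \<open>auto simp: cylinder_def\<close>)
  hence "measure lebesgue (cylinder m a \<sigma> :: (real, 'n) vec set)
      = \<bar>prod d UNIV\<bar> * measure lebesgue (cylinder m 1 \<sigma> :: (real, 'n) vec set)"
    by (simp only: measure_stretch[OF cylinder_lmeasurable])
  also have "prod d UNIV = a ^ m"
  proof -
    have "prod d UNIV = (\<Prod>k\<in>(zidx m :: 'n set). a)"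
      by (rule prod.mono_neutral_cong_right) (auto simp: d_def)
    thus ?thesis by (simp add: card_zidx[OF assms(2)])
  qed
  finally have "measure lebesgue (cylinder m a \<sigma> :: (real, 'n) vec set)
      = a ^ m * measure lebesgue (cylinder m 1 \<sigma> :: (real, 'n) vec set)" using assms by simp
  moreover have "emeasure lebesgue (cylinder m a \<sigma> :: (real, 'n) vec set)
      = emeasure lborel (cylinder m a \<sigma> :: (real, 'n) vec set)"
    by (simp add: borel_open[OF open_cylinder])
  moreover have "emeasure lebesgue (cylinder m a \<sigma> :: (real, 'n) vec set)
      = ennreal (measure lebesgue (cylinder m a \<sigma> :: (real, 'n) vec set))"
    by (rule emeasure_eq_measure2[OF cylinder_lmeasurable])
  ultimately show ?thesis by (simp only:)
qed

lemma measure_cylinder_pos: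
  assumes "0 < \<sigma>"
  shows "0 < measure lebesgue (cylinder m 1 \<sigma> :: (real, 'n::{finite,linorder}) vec set)"
proof -
  have "(0 :: (real, 'n) vec) \<in> cylinder m 1 \<sigma>" using assms by (simp add: cylinder_def znorm_def restnorm_def)
  hence "\<not> negligible (cylinder m 1 \<sigma> :: (real, 'n) vec set)"
    using open_not_negligible[OF open_cylinder] by blast
  thus ?thesis using negligible_iff_measure0[OF cylinder_lmeasurable]
    by (metis measure_nonneg less_le)
qed

text \<open>A replacement for polar coordinates: the image under |z| of Lebesgue measure on
  \<open>restnorm\<close> < \<sigma> agrees on all half-lines below a with the measure of density c
  m r^(m-1), both giving c a^m. Half-lines are stable under intersection and generate the Borel
  sets, so the measures coincide.\<close>

lemma nn_integral_radial:
  fixes F :: "real \<Rightarrow> ennreal" and \<sigma> :: real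
  assumes m: "1 \<le> m" "m \<le> CARD('n::{finite,linorder})" and F [measurable]: "F \<in> borel_measurable borel"
  defines "c \<equiv> measure lebesgue (cylinder m 1 \<sigma> :: (real, 'n) vec set)"
  shows "(\<integral>\<^sup>+x. F (znorm m (x :: (real, 'n) vec)) * indicator {x. restnorm m x < \<sigma>} x \<partial>lborel)
    = (\<integral>\<^sup>+r. F r * (ennreal (c * (real m * r ^ (m - 1))) * indicator {0..} r) \<partial>lborel)"
proof -
  define B :: "(real, 'n) vec set" where "B = {x. restnorm m x < \<sigma>}"
  have B [measurable]: "B \<in> sets borel" unfolding B_def by measurable
  define M where "M = distr (density lborel (indicator B)) borel (znorm m :: (real, 'n) vec \<Rightarrow> real)"
  define N where "N = density lborel (\<lambda>r. ennreal (c * (real m * r ^ (m - 1))) * indicator {0..} r)"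
  have c0: "0 \<le> c" by (simp add: c_def)
  have eM: "emeasure M {..<a} = (if 0 < a then ennreal (a ^ m * c) else 0)" for a
  proof -
    have "emeasure M {..<a} = emeasure (density lborel (indicator B)) (znorm m -` {..<a} :: (real, 'n) vec set)"
      unfolding M_def by (subst emeasure_distr) (auto simp: space_density)
    also have "\<dots> = (\<integral>\<^sup>+x. indicator B x * indicator (znorm m -` {..<a}) x \<partial>lborel)"
      using measurable_sets_borel[OF borel_measurable_znorm, of "{..<a}"]
      by (intro emeasure_density) auto
    also have "\<dots> = (\<integral>\<^sup>+x. indicator (cylinder m a \<sigma>) x \<partial>(lborel :: (real, 'n) vec measure))"
      by (intro nn_integral_cong) (auto simp: indicator_def cylinder_def B_def)
    also have "\<dots> = emeasure lborel (cylinder m a \<sigma> :: (real, 'n) vec set)"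
      by (rule nn_integral_indicator) (simp add: borel_open[OF open_cylinder])
    also have "\<dots> = (if 0 < a then ennreal (a ^ m * c) else 0)"
    proof (cases "0 < a")
      case True
      thus ?thesis using emeasure_cylinder[OF True m(2)] by (simp add: c_def)
    next
      case False
      have "\<not> znorm m x < a" for x :: "(real, 'n) vec" using False znorm_nonneg[of m x] by linarith
      hence "cylinder m a \<sigma> = ({} :: (real, 'n) vec set)" by (simp add: cylinder_def)
      thus ?thesis using False by simp
    qed
    finally show ?thesis .
  qed
  have eN: "emeasure N {..<a} = (if 0 < a then ennreal (a ^ m * c) else 0)" for a
  proof -
    have "emeasure N {..<a} = (\<integral>\<^sup>+r. ennreal (c * (real m * r ^ (m - 1))) * indicator {0..} r * indicator {..<a} r \<partial>lborel)"
      unfolding N_def by (subst emeasure_density) auto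
    also have "\<dots> = (\<integral>\<^sup>+r. ennreal (c * (real m * r ^ (m - 1))) * indicator {0..a} r \<partial>lborel)"
      by (rule nn_integral_cong_AE, rule AE_mp[OF AE_lborel_singleton[of a]]) (auto simp: indicator_def)
    also have "\<dots> = (if 0 < a then ennreal (a ^ m * c) else 0)"
    proof (cases "0 < a")
      case True
      have "(\<integral>\<^sup>+r. ennreal (c * (real m * r ^ (m - 1))) * indicator {0..a} r \<partial>lborel) = ennreal (c * a ^ m - c * 0 ^ m)"
      proof (rule nn_integral_FTC_Icc)
        show "((\<lambda>r. c * r ^ m) has_real_derivative c * (real m * r ^ (m - 1))) (at r)" for r
          using DERIV_cmult[OF DERIV_pow[of m r UNIV], of c] by simp
      qed (use True c0 in auto)
      moreover have "(0::real) ^ m = 0" using m by (simp add: power_0_left)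
      ultimately show ?thesis using True by (simp add: mult.commute)
    next
      case False
      have "(\<integral>\<^sup>+r. ennreal (c * (real m * r ^ (m - 1))) * indicator {0..a} r \<partial>lborel) = (\<integral>\<^sup>+(r::real). 0 \<partial>lborel)"
        by (rule nn_integral_cong_AE, rule AE_mp[OF AE_lborel_singleton[of 0]]) (use False in \<open>auto simp: indicator_def\<close>)
      thus ?thesis using False by simp
    qed
    finally show ?thesis .
  qed
  have "M = N"
  proof (rule measure_eqI_generator_eq[where E = "range lessThan" and \<Omega> = UNIV and A = "\<lambda>n. {..<real n}"])
    have "{..<a} \<inter> {..<b} = {..<min a b}" for a b :: real by auto
    thus "Int_stable (range lessThan :: real set set)" by (auto simp: Int_stable_def)
    have "sets (borel :: real measure) = sigma_sets UNIV (range lessThan)"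
      by (simp add: borel_Iio)
    thus "sets M = sigma_sets UNIV (range lessThan)" "sets N = sigma_sets UNIV (range lessThan)"
      by (simp_all add: M_def N_def)
    show "(\<Union>i. {..<real i}) = UNIV" using reals_Archimedean2 by auto
  qed (auto simp: eM eN)
  have "(\<integral>\<^sup>+x. F (znorm m (x :: (real, 'n) vec)) * indicator {x. restnorm m x < \<sigma>} x \<partial>lborel)
    = (\<integral>\<^sup>+x. indicator B x * F (znorm m x) \<partial>lborel)" by (simp add: B_def mult.commute)
  also have "\<dots> = (\<integral>\<^sup>+x. F (znorm m x) \<partial>density lborel (indicator B))"
    by (subst nn_integral_density) auto
  also have "\<dots> = (\<integral>\<^sup>+r. F r \<partial>M)" unfolding M_def by (subst nn_integral_distr) auto
  also have "\<dots> = (\<integral>\<^sup>+r. F r \<partial>N)" by (simp add: \<open>M = N\<close>)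
  also have "\<dots> = (\<integral>\<^sup>+r. F r * (ennreal (c * (real m * r ^ (m - 1))) * indicator {0..} r) \<partial>lborel)"
    unfolding N_def by (subst nn_integral_density) (auto simp: mult.commute)
  finally show ?thesis .
qed

text \<open>The factor |z|^(1-m) cancels the Jacobian r^(m-1), leaving the integral of k = -\<tau>'.
  Up to a constant, the measure of a shell is the length of \<tau> it covers.\<close>

lemma nn_integral_shell:
  fixes k \<tau> :: "real \<Rightarrow> real" and \<sigma> :: real
  assumes m: "1 \<le> m" "m \<le> CARD('n::{finite,linorder})" and k: "k \<in> borel_measurable borel"
    and ab: "0 < a" "a \<le> b" and \<tau>: "\<And>r. a \<le> r \<Longrightarrow> r \<le> b \<Longrightarrow> (\<tau> has_real_derivative - k r) (at r)"
    and k0: "\<And>r. a \<le> r \<Longrightarrow> r \<le> b \<Longrightarrow> 0 \<le> k r"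
  defines "c \<equiv> measure lebesgue (cylinder m 1 \<sigma> :: (real, 'n) vec set)"
  shows "(\<integral>\<^sup>+x. ennreal (k (znorm m (x :: (real, 'n) vec)) * znorm m x powr (1 - real m)) *
      indicator {x. a \<le> znorm m x \<and> znorm m x \<le> b \<and> restnorm m x < \<sigma>} x \<partial>lborel)
    = ennreal (c * real m * (\<tau> a - \<tau> b))"
proof -
  note k[measurable]
  have c0: "0 \<le> c" by (simp add: c_def)
  define F where "F r = ennreal (k r * r powr (1 - real m)) * indicator {a..b} r" for r
  have [measurable]: "F \<in> borel_measurable borel" unfolding F_def by measurable
  have "(\<integral>\<^sup>+x. ennreal (k (znorm m (x :: (real, 'n) vec)) * znorm m x powr (1 - real m)) *
      indicator {x. a \<le> znorm m x \<and> znorm m x \<le> b \<and> restnorm m x < \<sigma>} x \<partial>lborel)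
    = (\<integral>\<^sup>+x. F (znorm m (x :: (real, 'n) vec)) * indicator {x. restnorm m x < \<sigma>} x \<partial>lborel)"
    by (intro nn_integral_cong) (auto simp: F_def indicator_def)
  also have "\<dots> = (\<integral>\<^sup>+r. F r * (ennreal (c * (real m * r ^ (m - 1))) * indicator {0..} r) \<partial>lborel)"
    unfolding c_def by (rule nn_integral_radial[OF m]) simp
  also have "\<dots> = (\<integral>\<^sup>+r. ennreal (c * real m) * (ennreal (k r) * indicator {a..b} r) \<partial>lborel)"
  proof (intro nn_integral_cong)
    fix r
    show "F r * (ennreal (c * (real m * r ^ (m - 1))) * indicator {0..} r)
      = ennreal (c * real m) * (ennreal (k r) * indicator {a..b} r)"
    proof (cases "r \<in> {a..b}")
      case True
      hence r: "0 < r" using ab by auto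
      have "r powr (1 - real m) * r ^ (m - 1) = 1"
        using r m by (simp add: powr_realpow[symmetric] of_nat_diff flip: powr_add)
      hence "k r * r powr (1 - real m) * (c * (real m * r ^ (m - 1))) = c * real m * k r"
        by (simp add: ac_simps)
      thus ?thesis using True r k0[of r] c0
        by (simp add: F_def ennreal_mult'[symmetric])
    qed (simp add: F_def)
  qed
  also have "\<dots> = ennreal (c * real m) * (\<integral>\<^sup>+r. ennreal (k r) * indicator {a..b} r \<partial>lborel)"
    by (rule nn_integral_cmult) simp
  also have "(\<integral>\<^sup>+r. ennreal (k r) * indicator {a..b} r \<partial>lborel) = ennreal (- \<tau> b - - \<tau> a)"
  proof (rule nn_integral_FTC_Icc[OF k])
    show "((\<lambda>r. - \<tau> r) has_real_derivative k r) (at r)" if "r \<in> {a..b}" for r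
      using DERIV_minus[OF \<tau>[of r]] that by simp
  qed (use k0 ab in auto)
  also have "ennreal (c * real m) * \<dots> = ennreal (c * real m * (\<tau> a - \<tau> b))"
    using c0 by (simp add: ennreal_mult')
  finally show ?thesis .
qed

section \<open>A convexity inequality and one-variable C^1 cutoffs\<close>

lemma powr_add_le:
  fixes a b p \<theta> :: real
  assumes p: "1 < p" and \<theta>: "0 < \<theta>" "\<theta> < 1" and ab: "0 \<le> a" "0 \<le> b"
  shows "(a + b) powr p \<le> (1 - \<theta>) powr (1 - p) * a powr p + \<theta> powr (1 - p) * b powr p"
proof -
  have one: "1 \<le> t powr (1 - p)" if "0 < t" "t < 1" for t
  proof -
    have "t powr 0 \<le> t powr (1 - p)" using that p by (intro powr_mono') auto
    thus ?thesis using that by simp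
  qed
  have scale: "t * (y / t) powr p = t powr (1 - p) * y powr p" if "0 < t" "0 \<le> y" for t y
    using that by (simp add: powr_divide powr_diff)
  show ?thesis
  proof (cases "a = 0 \<or> b = 0")
    case True
    have "1 * b powr p \<le> \<theta> powr (1 - p) * b powr p" "1 * a powr p \<le> (1 - \<theta>) powr (1 - p) * a powr p"
      using one \<theta> by (intro mult_right_mono; simp)+
    thus ?thesis using True p by auto
  next
    case False
    hence pos: "0 < a / (1 - \<theta>)" "0 < b / \<theta>" using \<theta> ab by auto
    have "\<forall>x\<in>{0<..}. \<forall>y\<in>{0<..}. \<forall>u\<ge>0. \<forall>v\<ge>0. u + v = 1 \<longrightarrow>
        (u * x + v * y) powr p \<le> u * x powr p + v * y powr p"
      using powr_convex[of p] p by (simp add: convex_on_def)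
    \<comment> \<open>Convexity with the arguments divided by their own weights, so that the
      combination is a + b. As \<theta> tends to 0 the coefficient of a^p tends to 1; only the small
      term b pays for this.\<close>
    from this[rule_format, of "a / (1 - \<theta>)" "b / \<theta>" "1 - \<theta>" \<theta>] pos \<theta>
    have "((1 - \<theta>) * (a / (1 - \<theta>)) + \<theta> * (b / \<theta>)) powr p
        \<le> (1 - \<theta>) * (a / (1 - \<theta>)) powr p + \<theta> * (b / \<theta>) powr p" by simp
    thus ?thesis using \<theta> ab by (simp add: scale)
  qed
qed

text \<open>The primitive of a tent function on [0,1] with peak 2 at 1/2, so it rises from 0 to 1.
  It is written through truncated squares to inherit their C^1 property; the form
  \<open>t - 0\<close> matches the derivative rule for them.\<close>

definition step :: "real \<Rightarrow> real" where
  "step t = 2 * (max 0 (t - 0))\<^sup>2 - 4 * (max 0 (t - 1 / 2))\<^sup>2 + 2 * (max 0 (t - 1))\<^sup>2"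

definition step' :: "real \<Rightarrow> real" where
  "step' t = 4 * max 0 (t - 0) - 8 * max 0 (t - 1 / 2) + 4 * max 0 (t - 1)"

lemma step_has_real_derivative: "(step has_real_derivative step' t) (at t)"
proof -
  have "(step has_real_derivative 2 * (2 * max 0 (t - 0)) - 4 * (2 * max 0 (t - 1 / 2)) + 2 * (2 * max 0 (t - 1))) (at t)"
    unfolding step_def[abs_def] by (intro DERIV_add DERIV_diff DERIV_cmult max_square_has_real_derivative)
  thus ?thesis by (simp add: step'_def)
qed

lemma continuous_on_step' [continuous_intros]: "continuous_on A f \<Longrightarrow> continuous_on A (\<lambda>x. step' (f x))"
  unfolding step'_def by (intro continuous_intros)

lemma continuous_on_step [continuous_intros]: "continuous_on A f \<Longrightarrow> continuous_on A (\<lambda>x. step (f x))"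
  unfolding step_def by (intro continuous_intros)

lemma step_eq_0: "t \<le> 0 \<Longrightarrow> step t = 0" by (simp add: step_def max_def)

lemma step_eq_1: "1 \<le> t \<Longrightarrow> step t = 1" by (simp add: step_def max_def power2_eq_square field_simps)

lemma abs_step'_le: "\<bar>step' t\<bar> \<le> 2" by (auto simp: step'_def max_def)

lemma step_bounds: "0 \<le> step t" "step t \<le> 1"
proof -
  consider "t \<le> 0" | "0 \<le> t" "t \<le> 1 / 2" | "1 / 2 \<le> t" "t \<le> 1" | "1 \<le> t" by linarith
  hence "0 \<le> step t \<and> step t \<le> 1"
  proof cases
    case 2
    hence s: "step t = 2 * t\<^sup>2" by (simp add: step_def max_def)
    have "t\<^sup>2 \<le> (1 / 2)\<^sup>2" using 2 by (intro power_mono) auto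
    thus ?thesis unfolding s by (simp add: power2_eq_square)
  next
    case 3
    hence s: "step t = 1 - 2 * (1 - t)\<^sup>2"
      by (simp add: step_def max_def power2_eq_square algebra_simps)
    have "(1 - t)\<^sup>2 \<le> (1 / 2)\<^sup>2" using 3 by (intro power_mono) auto
    thus ?thesis unfolding s by (simp add: power2_eq_square)
  qed (simp_all add: step_eq_0 step_eq_1)
  thus "0 \<le> step t" "step t \<le> 1" by auto
qed

text \<open>Supported in [1,4] and equal to 1 on [2,3]. Evaluated at \<tau> / T, the support has
  \<tau>-length 3T and the plateau T: both grow linearly, while the slope is at most 4/T.\<close>

definition plateau :: "real \<Rightarrow> real" where "plateau t = step (t - 1) * step (4 - t)"

definition plateau' :: "real \<Rightarrow> real" where
  "plateau' t = step' (t - 1) * step (4 - t) - step (t - 1) * step' (4 - t)"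

lemma plateau_has_real_derivative: "(plateau has_real_derivative plateau' t) (at t)"
proof -
  have "((\<lambda>t. step (t - 1)) has_real_derivative step' (t - 1) * 1) (at t)"
    by (rule DERIV_chain2[OF step_has_real_derivative]) (auto intro!: derivative_eq_intros)
  moreover have "((\<lambda>t. step (4 - t)) has_real_derivative step' (4 - t) * - 1) (at t)"
    by (rule DERIV_chain2[OF step_has_real_derivative]) (auto intro!: derivative_eq_intros)
  ultimately have "((\<lambda>t. step (t - 1) * step (4 - t)) has_real_derivative
      (step' (t - 1) * 1) * step (4 - t) + (step' (4 - t) * - 1) * step (t - 1)) (at t)"
    by (rule DERIV_mult)
  thus ?thesis by (simp add: plateau_def[abs_def] plateau'_def mult.commute)
qed

lemma plateau_props:
  "0 \<le> plateau t" "plateau t \<le> 1" "2 \<le> t \<Longrightarrow> t \<le> 3 \<Longrightarrow> plateau t = 1"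
  "t \<le> 1 \<Longrightarrow> plateau t = 0" "4 \<le> t \<Longrightarrow> plateau t = 0" "\<bar>plateau' t\<bar> \<le> 4"
proof -
  have "\<bar>step' (t - 1) * step (4 - t)\<bar> \<le> 2 * 1" "\<bar>step (t - 1) * step' (4 - t)\<bar> \<le> 1 * 2"
    unfolding abs_mult using step_bounds abs_step'_le by (intro mult_mono; simp)+
  thus "\<bar>plateau' t\<bar> \<le> 4" unfolding plateau'_def by linarith
  have "step (t - 1) * step (4 - t) \<le> 1 * 1" using step_bounds by (intro mult_mono) auto
  thus "plateau t \<le> 1" by (simp add: plateau_def)
qed (auto simp: plateau_def step_bounds step_eq_0 step_eq_1)

lemma continuous_on_plateau [continuous_intros]: 
  "continuous_on A f \<Longrightarrow> continuous_on A (\<lambda>x. plateau (f x))"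
  "continuous_on A f \<Longrightarrow> continuous_on A (\<lambda>x. plateau' (f x))"
  unfolding plateau_def plateau'_def by (intro continuous_intros; assumption)+

section \<open>Sharpness\<close>

lemma L2_set_scale: "L2_set (\<lambda>i. c * f i) A = \<bar>c\<bar> * L2_set f A"
  by (simp add: L2_set_def power_mult_distrib real_sqrt_mult flip: sum_distrib_left)

lemma compact_shell:
  "compact {x :: (real, 'n::{finite,linorder}) vec. a \<le> znorm m x \<and> znorm m x \<le> b \<and> restnorm m x \<le> d}"
  unfolding compact_eq_bounded_closed
proof
  show "bounded {x :: (real, 'n) vec. a \<le> znorm m x \<and> znorm m x \<le> b \<and> restnorm m x \<le> d}"
    unfolding bounded_iff
  proof (intro exI[of _ "b + d"] ballI)
    fix x :: "(real, 'n) vec" assume "x \<in> {x. a \<le> znorm m x \<and> znorm m x \<le> b \<and> restnorm m x \<le> d}"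
    thus "norm x \<le> b + d" using norm_le_znorm_restnorm[of x m] by simp
  qed
  show "closed {x :: (real, 'n) vec. a \<le> znorm m x \<and> znorm m x \<le> b \<and> restnorm m x \<le> d}"
    by (intro closed_Collect_conj closed_Collect_le continuous_intros)
qed

lemma znorm_has_derivative:
  fixes x :: "(real, 'n::{finite,linorder}) vec"
  assumes "0 < znorm m x"
  shows "(znorm m has_derivative (\<lambda>e. (\<Sum>i\<in>zidx m. x $ i * e $ i) / znorm m x)) (at x)"
proof -
  define S :: "(real, 'n) vec \<Rightarrow> real" where "S x = (\<Sum>i\<in>zidx m. (x $ i)\<^sup>2)" for x
  have zS: "znorm m = (\<lambda>x. sqrt (S x))" by (simp add: fun_eq_iff znorm_def S_def)
  have pos: "0 < S x" using assms unfolding zS by simp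
  have "(S has_derivative (\<lambda>e. \<Sum>i\<in>zidx m. 2 * x $ i * e $ i)) (at x)"
    unfolding S_def by (rule has_C1_derivativeD(1)[OF has_C1_derivative_sum_squares])
  from has_derivative_compose[OF this DERIV_real_sqrt[OF pos, THEN has_field_derivative_imp_has_derivative]]
  have "((\<lambda>x. sqrt (S x)) has_derivative
      (\<lambda>e. inverse (sqrt (S x)) / 2 * (\<Sum>i\<in>zidx m. 2 * x $ i * e $ i))) (at x)" .
  moreover have "inverse (sqrt (S x)) / 2 * (\<Sum>i\<in>zidx m. 2 * x $ i * e $ i)
      = (\<Sum>i\<in>zidx m. x $ i * e $ i) / sqrt (S x)" for e
  proof -
    have "(\<Sum>i\<in>zidx m. 2 * x $ i * e $ i) = 2 * (\<Sum>i\<in>zidx m. x $ i * e $ i)"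
      unfolding sum_distrib_left by (simp only: mult.assoc)
    thus ?thesis by (simp add: inverse_eq_divide)
  qed
  ultimately show ?thesis unfolding zS by (simp only:)
qed

text \<open>Using the square of \<open>restnorm\<close> keeps the cutoff C^1 where
  \<open>restnorm\<close> itself has a corner.\<close>

lemma restnorm_cutoff_has_C1_derivative:
  assumes "\<sigma> \<noteq> 0"
  shows "\<exists>\<phi>'. has_C1_derivative (\<lambda>x :: (real, 'n::{finite,linorder}) vec. step (2 - (restnorm m x)\<^sup>2 / \<sigma>\<^sup>2)) \<phi>'"
proof -
  have 1: "((\<lambda>t. step (2 - t / \<sigma>\<^sup>2)) has_real_derivative step' (2 - t / \<sigma>\<^sup>2) * (0 - 1 / \<sigma>\<^sup>2)) (at t)" for t
    by (rule DERIV_chain2[OF step_has_real_derivative]) (intro DERIV_diff DERIV_const DERIV_cdivide DERIV_ident)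
  have 2: "continuous_on UNIV (\<lambda>t. step' (2 - t / \<sigma>\<^sup>2) * (0 - 1 / \<sigma>\<^sup>2))"
    using assms by (intro continuous_intros) auto
  show ?thesis unfolding restnorm_square
    by (rule exI, rule has_C1_derivative_chain[OF has_C1_derivative_sum_squares 1 2])
qed

context
  fixes op :: "(real, 'n::{finite,linorder}) vec \<Rightarrow> (real, 'n) vec \<Rightarrow> (real, 'n) vec"
    and deg :: "'n \<Rightarrow> nat" and m :: nat
  assumes G: "hcarnot op deg" and m1: "1 \<le> m" and ml: "m \<le> card (layer deg 1)"
begin

text \<open>For a radial function h(|z|) times \<phi>, with \<open>h\<close> and \<open>h'\<close>
  standing for the values of h and its derivative at |z|. As X_i |z| is z_i / |z| for the first m
  indices and 0 for the rest of the layer, |z| has horizontal gradient of length 1; the triangle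
  inequality does the rest.\<close>

lemma hgrad_norm_product_le:
  assumes u: "has_C1_derivative u u'" and \<phi>: "has_C1_derivative \<phi> \<phi>'" and z: "0 < znorm m x"
    and u': "\<And>e. u' x e = h * \<phi>' x e + h' * ((\<Sum>i\<in>zidx m. x $ i * e $ i) / znorm m x) * \<phi> x"
  shows "hgrad_norm op deg u x \<le> \<bar>h\<bar> * hgrad_norm op deg \<phi> x + \<bar>h' * \<phi> x\<bar>"
proof -
  let ?y = "\<lambda>i. (if i \<in> zidx m then x $ i / znorm m x else 0)"
  have "Xop op i u x = h * Xop op i \<phi> x + (h' * \<phi> x) * ?y i" if i: "i \<in> layer deg 1" for i
  proof -
    have "(\<Sum>j\<in>zidx m. x $ j * lvf op (axis i 1) x $ j) = (\<Sum>j\<in>zidx m. if i = j then x $ j else 0)"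
      using i zidx_deg[OF G m1 ml] lvf_layer1_const[OF G] by (intro sum.cong) (auto simp: layer_def)
    thus ?thesis
      by (simp add: Xop_eq[OF G m1 ml u] Xop_eq[OF G m1 ml \<phi>] u')
  qed
  hence "hgrad_norm op deg u x = L2_set (\<lambda>i. h * Xop op i \<phi> x + (h' * \<phi> x) * ?y i) (layer deg 1)"
    by (simp add: hgrad_norm_def L2_set_def)
  also have "\<dots> \<le> L2_set (\<lambda>i. h * Xop op i \<phi> x) (layer deg 1) + L2_set (\<lambda>i. (h' * \<phi> x) * ?y i) (layer deg 1)"
    by (rule L2_set_triangle_ineq)
  also have "\<dots> = \<bar>h\<bar> * hgrad_norm op deg \<phi> x + \<bar>h' * \<phi> x\<bar> * L2_set ?y (layer deg 1)"
    unfolding L2_set_scale by (simp add: hgrad_norm_def L2_set_def)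
  also have "L2_set ?y (layer deg 1) = 1"
  proof -
    have "(\<Sum>i\<in>layer deg 1. (?y i)\<^sup>2) = (\<Sum>i\<in>zidx m. (x $ i / znorm m x)\<^sup>2)"
      by (rule sum.mono_neutral_cong_right) (use zidx_subset_layer[OF G m1 ml] in auto)
    also have "\<dots> = 1"
      using z by (simp add: power_divide znorm_square[symmetric] flip: sum_divide_distrib)
    finally show ?thesis by (simp add: L2_set_def)
  qed
  finally show ?thesis by simp
qed

text \<open>The test functions are \<open>exp (\<kappa> * \<tau>) * plateau (\<tau> / T)\<close> in the variable \<open>\<tau> = \<tau> |z|\<close>, times a cutoff in the
  remaining coordinates. In terms of \<open>\<tau>\<close> both integrals are with respect to Lebesgue measure, and
  the derivatives of the two cutoffs contribute a vanishing proportion as \<open>T\<close> grows.\<close>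
lemma hardy_sharp:
  fixes \<tau> k \<omega>1 \<omega>2 :: "real \<Rightarrow> real"
  assumes p: "1 < p" and \<rho>: "0 < \<rho>" and R1: "0 < R1" and C: "\<bar>\<kappa>\<bar> powr p < C"
    and \<tau>: "\<And>r. 0 < r \<Longrightarrow> r < R1 \<Longrightarrow> (\<tau> has_real_derivative - k r) (at r)"
    and kpos: "\<And>r. 0 < r \<Longrightarrow> r < R1 \<Longrightarrow> 0 < k r" and kcont: "continuous_on {0<..<R1} k"
    and km: "k \<in> borel_measurable borel" and klim: "((\<lambda>r. 1 / k r) \<longlongrightarrow> 0) (at_right 0)"
    and surj: "\<And>a. a0 \<le> a \<Longrightarrow> \<exists>r. 0 < r \<and> r < R1 \<and> \<tau> r = a"
    and \<omega>1: "\<And>r. 0 < r \<Longrightarrow> r < R1 \<Longrightarrow> \<omega>1 r = exp (- (p * \<kappa> * \<tau> r)) * k r * r powr (1 - real m)"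
    and \<omega>1m: "\<omega>1 \<in> borel_measurable borel"
    and \<omega>2: "\<And>r. 0 < r \<Longrightarrow> r < R1 \<Longrightarrow> \<omega>2 r = exp (- (p * \<kappa> * \<tau> r)) * k r powr (1 - p) * r powr (1 - real m)"
  shows "\<exists>u\<in>C1_0 {x. 0 < znorm m x \<and> znorm m x < \<rho> \<and> restnorm m x < \<rho>}.
    \<not> (ennreal C * (\<integral>\<^sup>+x. ennreal (\<bar>u x\<bar> powr p * \<omega>1 (znorm m x)) \<partial>lborel)
      \<le> (\<integral>\<^sup>+x. ennreal (hgrad_norm op deg u x powr p * \<omega>2 (znorm m x)) \<partial>lborel))"
proof -
  have mN: "m \<le> CARD('n)" using ml card_mono[of UNIV "layer deg 1"] by auto
  have dec: "\<tau> s < \<tau> r" if "0 < r" "r < s" "s < R1" for r s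
  proof (rule DERIV_neg_imp_decreasing[OF that(2)])
    fix y assume "r \<le> y" "y \<le> s"
    thus "\<exists>d. (\<tau> has_real_derivative d) (at y) \<and> d < 0"
      using \<tau>[of y] kpos[of y] that by (intro exI[of _ "- k y"]) auto
  qed
  define \<sigma> where "\<sigma> = \<rho> / 2"
  have \<sigma>: "0 < \<sigma>" using \<rho> by (simp add: \<sigma>_def)
  define \<phi> :: "(real, 'n) vec \<Rightarrow> real" where "\<phi> x = step (2 - (restnorm m x)\<^sup>2 / \<sigma>\<^sup>2)" for x
  obtain \<phi>' where \<phi>': "has_C1_derivative \<phi> \<phi>'"
    using restnorm_cutoff_has_C1_derivative[of \<sigma> m] \<sigma> unfolding \<phi>_def by blast
  have \<phi>_bounds: "0 \<le> \<phi> x" "\<phi> x \<le> 1" for x by (simp_all add: \<phi>_def step_bounds)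
  \<comment> \<open>\<phi> already vanishes once \<open>restnorm\<close> reaches sqrt 2 \<sigma> =
    \<rho> / sqrt 2, which is less than 3/4 \<rho>. The gap up to \<rho> keeps the support compactly
    inside the open cylinder.\<close>
  have \<phi>_zero: "\<phi> x = 0" if "3 / 4 * \<rho> < restnorm m x" for x
  proof -
    have "(3 / 4 * \<rho>)\<^sup>2 \<le> (restnorm m x)\<^sup>2" using that \<rho> by (intro power_mono) auto
    moreover have "2 * \<sigma>\<^sup>2 \<le> (3 / 4 * \<rho>)\<^sup>2" by (simp add: \<sigma>_def power2_eq_square)
    ultimately have "2 * \<sigma>\<^sup>2 \<le> (restnorm m x)\<^sup>2" by linarith
    hence "2 \<le> (restnorm m x)\<^sup>2 / \<sigma>\<^sup>2" using \<sigma> by (simp add: pos_le_divide_eq)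
    thus ?thesis by (simp add: \<phi>_def step_eq_0)
  qed
  have \<phi>_one: "\<phi> x = 1" if "restnorm m x < \<sigma>" for x
  proof -
    have "(restnorm m x)\<^sup>2 \<le> \<sigma>\<^sup>2" using that by (intro power_mono) auto
    hence "(restnorm m x)\<^sup>2 / \<sigma>\<^sup>2 \<le> 1" using \<sigma> by simp
    thus ?thesis by (simp add: \<phi>_def step_eq_1)
  qed
  define Q0 where "Q0 = {x :: (real, 'n) vec. 0 \<le> znorm m x \<and> znorm m x \<le> \<rho> \<and> restnorm m x \<le> \<rho>}"
  have "compact (hgrad_norm op deg \<phi> ` Q0)" unfolding Q0_def
    by (intro compact_continuous_image compact_shell
        continuous_on_subset[OF continuous_on_hgrad_norm[OF G m1 ml \<phi>']]) auto
  then obtain H0 where H0: "\<And>x. x \<in> Q0 \<Longrightarrow> \<bar>hgrad_norm op deg \<phi> x\<bar> \<le> H0"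
    using compact_imp_bounded[of "hgrad_norm op deg \<phi> ` Q0"] unfolding bounded_iff by force
  define H where "H = max 0 H0"
  have H: "hgrad_norm op deg \<phi> x \<le> H" if "x \<in> Q0" for x
    using H0[OF that] by (simp add: H_def)
  have H_nonneg: "0 \<le> H" by (simp add: H_def)
  \<comment> \<open>\<theta> is fixed so small that the coefficient \<open>A\<close> which
    \<open>powr_add_le\<close> puts on the main term is still below C.\<close>
  have "((\<lambda>\<theta>. (1 - \<theta>) powr (1 - p) * \<bar>\<kappa>\<bar> powr p) \<longlongrightarrow> (1 - 0) powr (1 - p) * \<bar>\<kappa>\<bar> powr p) (at_right (0::real))"
    by (intro tendsto_intros) auto
  hence "eventually (\<lambda>\<theta>::real. (1 - \<theta>) powr (1 - p) * \<bar>\<kappa>\<bar> powr p < C) (at_right 0)"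
    using C by (intro order_tendstoD(2)) auto
  moreover have "eventually (\<lambda>\<theta>::real. \<theta> \<in> {0<..<1}) (at_right 0)"
    by (rule eventually_at_right_real) simp
  ultimately have "eventually (\<lambda>\<theta>::real. (1 - \<theta>) powr (1 - p) * \<bar>\<kappa>\<bar> powr p < C \<and> \<theta> \<in> {0<..<1}) (at_right 0)"
    by (rule eventually_conj)
  then obtain \<theta> :: real where \<theta>: "0 < \<theta>" "\<theta> < 1" and \<theta>C: "(1 - \<theta>) powr (1 - p) * \<bar>\<kappa>\<bar> powr p < C"
    using eventually_happens[of _ "at_right (0::real)"] by (auto simp: trivial_limit_at_right_real)
  define A where "A = (1 - \<theta>) powr (1 - p) * \<bar>\<kappa>\<bar> powr p"
  define B where "B = \<theta> powr (1 - p)"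
  have AB: "0 \<le> A" "A < C" "0 < B" using \<theta> \<theta>C by (auto simp: A_def B_def)
  define c1 where "c1 = measure lebesgue (cylinder m 1 \<rho> :: (real, 'n) vec set)"
  define c2 where "c2 = measure lebesgue (cylinder m 1 \<sigma> :: (real, 'n) vec set)"
  have c: "0 < c1" "0 < c2" unfolding c1_def c2_def by (intro measure_cylinder_pos \<rho> \<sigma>)+
  \<comment> \<open>Error budget: the errors contribute B \<eta>^p on a set of mass at most c1 m 3T,
    while the left integral is at least c2 m T. \<open>X\<close> = \<eta>^p makes the total error
    half of (C - A) times that lower bound.\<close>
  define X where "X = (C - A) * c2 / (6 * B * c1)"
  have X: "0 < X" "B * X * (3 * c1) = (C - A) / 2 * c2" using AB c by (simp_all add: X_def)
  define \<eta> where "\<eta> = X powr (1 / p)"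
  have \<eta>: "0 < \<eta>" "\<eta> powr p = X" using X(1) p by (simp_all add: \<eta>_def powr_powr)
  \<comment> \<open>The gradient of \<phi> multiplies h, whereas the main term h' is larger by a
    factor k, which blows up at z = 0. Relative to k, the cutoff error is H/k, below \<eta>/2 close
    to z = 0.\<close>
  have "((\<lambda>r. H * (1 / k r)) \<longlongrightarrow> H * 0) (at_right 0)" by (intro tendsto_intros klim)
  hence "eventually (\<lambda>r. H * (1 / k r) < \<eta> / 2) (at_right 0)"
    using \<eta> by (intro order_tendstoD(2)) auto
  then obtain \<delta>0 where \<delta>0: "0 < \<delta>0" "\<And>r. 0 < r \<Longrightarrow> r < \<delta>0 \<Longrightarrow> H * (1 / k r) < \<eta> / 2"
    unfolding eventually_at_right_field by auto
  define \<delta> where "\<delta> = min (min \<delta>0 \<rho>) R1 / 2"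
  have \<delta>: "0 < \<delta>" "\<delta> < \<delta>0" "\<delta> < \<rho>" "\<delta> < R1" using \<delta>0 \<rho> R1 by (auto simp: \<delta>_def min_def)
  \<comment> \<open>\<open>T\<close> \<ge> \<open>a0\<close> makes the clock times T, 2T, 3T, 4T
    attainable, T > \<tau> \<delta> pushes the support into |z| < \<delta>, and T \<ge> 8/\<eta>
    brings the slope error 4/T down to \<eta>/2.\<close>
  define T where "T = max (max 1 a0) (max (\<tau> \<delta> + 1) (8 / \<eta>))"
  have T: "1 \<le> T" "a0 \<le> T" "\<tau> \<delta> < T" "8 / \<eta> \<le> T" by (auto simp: T_def)
  have T4: "4 / T \<le> \<eta> / 2" using T \<eta> by (simp add: field_simps)
  have ex: "\<exists>r. 0 < r \<and> r < R1 \<and> \<tau> r = j * T" if "1 \<le> j" for j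
  proof (rule surj)
    have "1 * T \<le> j * T" using that T(1) by (intro mult_right_mono) auto
    thus "a0 \<le> j * T" using T(2) by linarith
  qed
  obtain r1 where r1: "0 < r1" "r1 < R1" "\<tau> r1 = T" using ex[of 1] by auto
  obtain r2 where r2: "0 < r2" "r2 < R1" "\<tau> r2 = 2 * T" using ex[of 2] by auto
  obtain r3 where r3: "0 < r3" "r3 < R1" "\<tau> r3 = 3 * T" using ex[of 3] by auto
  obtain r4 where r4: "0 < r4" "r4 < R1" "\<tau> r4 = 4 * T" using ex[of 4] by auto
  \<comment> \<open>\<tau> decreases in r, so a later clock time is a smaller radius: r4 < r3 < r2 <
    r1 < \<delta>.\<close>
  have ord: "r < s" if "0 < r" "r < R1" "0 < s" "s < R1" "\<tau> s < \<tau> r" for r s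
    using that dec[of s r] by (cases r s rule: linorder_cases) auto
  have ord': "\<tau> s \<le> \<tau> r" if "0 < r" "r \<le> s" "s < R1" for r s
    using that dec[of r s] by (cases "r = s") auto
  have rs: "r1 < \<delta>" "r2 < r1" "r3 < r2" "r4 < r3"
    using ord[of r1 \<delta>] ord[of r2 r1] ord[of r3 r2] ord[of r4 r3] r1 r2 r3 r4 T(1,3) \<delta> by simp_all
  define h where "h r = exp (\<kappa> * \<tau> r) * plateau (\<tau> r / T)" for r
  define h' where "h' r = - (k r * exp (\<kappa> * \<tau> r) * (\<kappa> * plateau (\<tau> r / T) + plateau' (\<tau> r / T) / T))" for r
  have h': "(h has_real_derivative h' r) (at r)" if "0 < r" "r < R1" for r
  proof -
    have "((\<lambda>r. plateau (\<tau> r / T)) has_real_derivative plateau' (\<tau> r / T) * (- k r / T)) (at r)"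
      by (rule DERIV_chain2[OF plateau_has_real_derivative]) (intro DERIV_cdivide \<tau> that)
    moreover have "((\<lambda>r. exp (\<kappa> * \<tau> r)) has_real_derivative exp (\<kappa> * \<tau> r) * (\<kappa> * - k r)) (at r)"
      by (rule DERIV_chain2[OF DERIV_exp]) (intro DERIV_cmult \<tau> that)
    ultimately have "((\<lambda>r. exp (\<kappa> * \<tau> r) * plateau (\<tau> r / T)) has_real_derivative
       (exp (\<kappa> * \<tau> r) * (\<kappa> * - k r)) * plateau (\<tau> r / T) + plateau' (\<tau> r / T) * (- k r / T) * exp (\<kappa> * \<tau> r)) (at r)"
      by (intro DERIV_mult)
    moreover have "(exp (\<kappa> * \<tau> r) * (\<kappa> * - k r)) * plateau (\<tau> r / T) + plateau' (\<tau> r / T) * (- k r / T) * exp (\<kappa> * \<tau> r) = h' r"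
      by (simp add: h'_def algebra_simps)
    ultimately show ?thesis by (simp add: h_def[abs_def])
  qed
  define u :: "(real, 'n) vec \<Rightarrow> real"
    where "u x = (if 0 < znorm m x \<and> znorm m x < R1 then h (znorm m x) * \<phi> x else 0)" for x
  define u' where "u' x e = h (znorm m x) * \<phi>' x e + h' (znorm m x) * ((\<Sum>i\<in>zidx m. x $ i * e $ i) / znorm m x) * \<phi> x" for x e
  define K where "K = {x :: (real, 'n) vec. r4 \<le> znorm m x \<and> znorm m x \<le> r1 \<and> restnorm m x \<le> 3 / 4 * \<rho>}"
  define U where "U = {x :: (real, 'n) vec. 0 < znorm m x \<and> znorm m x < R1}"
  have K: "compact K" unfolding K_def by (rule compact_shell)
  have KU: "K \<subseteq> U" using r4 r1 by (auto simp: K_def U_def)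
  have U: "open U" unfolding U_def by (intro open_Collect_conj open_Collect_less continuous_intros)
  have h_zero: "h r = 0" if "0 < r" "r < R1" "r < r4 \<or> r1 < r" for r
  proof -
    have "T * 4 \<le> \<tau> r \<or> \<tau> r \<le> T * 1"
      using that ord'[of r r4] ord'[of r1 r] r4 r1 by auto
    hence "4 \<le> \<tau> r / T \<or> \<tau> r / T \<le> 1" using T by (auto simp: field_simps)
    thus ?thesis using plateau_props(4,5) by (auto simp: h_def)
  qed
  have zero: "u x = 0" if "x \<notin> K" for x
    using that h_zero[of "znorm m x"] \<phi>_zero[of x] by (auto simp: u_def K_def not_le)
  have \<tau>c: "continuous_on {0<..<R1} \<tau>"
    using \<tau> by (auto intro!: continuous_at_imp_continuous_on DERIV_isCont)
  have hc: "continuous_on {0<..<R1} h" "continuous_on {0<..<R1} h'"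
    unfolding h_def h'_def using T by (auto intro!: continuous_intros \<tau>c kcont)
  have u_C1: "has_C1_derivative u (\<lambda>x e. if x \<in> U then u' x e else 0)"
  proof (rule has_C1_derivative_glue[OF compact_imp_closed[OF K] U KU zero])
    fix x assume x: "x \<in> U"
    hence z: "0 < znorm m x" "znorm m x < R1" by (auto simp: U_def)
    have "((\<lambda>x. h (znorm m x)) has_derivative (\<lambda>e. h' (znorm m x) * ((\<Sum>i\<in>zidx m. x $ i * e $ i) / znorm m x))) (at x)"
      using has_derivative_compose[OF znorm_has_derivative[OF z(1)] h'[OF z, unfolded has_field_derivative_def]] .
    hence "((\<lambda>x. h (znorm m x) * \<phi> x) has_derivative u' x) (at x)"
      unfolding u'_def by (intro has_derivative_mult has_C1_derivativeD(1)[OF \<phi>'])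
    thus "(u has_derivative u' x) (at x)"
      by (rule has_derivative_transform_within_open[OF _ U x]) (auto simp: u_def U_def)
  next
    fix e
    have comp: "continuous_on U (\<lambda>x. f (znorm m x))" if "continuous_on {0<..<R1} f" for f :: "real \<Rightarrow> real"
      by (rule continuous_on_compose2[OF that continuous_on_znorm]) (auto simp: U_def)
    show "continuous_on U (\<lambda>x. u' x e)" unfolding u'_def
      by (intro continuous_on_add continuous_on_mult continuous_on_divide comp hc continuous_on_sum
          continuous_on_znorm continuous_on_component continuous_on_id continuous_on_const
          has_C1_derivativeD(2,3)[OF \<phi>'])
         (auto simp: U_def)
  qed
  define w where "w x = k (znorm m x) * znorm m x powr (1 - real m)" for x :: "(real, 'n) vec"
  define Q where "Q = {x :: (real, 'n) vec. r4 \<le> znorm m x \<and> znorm m x \<le> r1 \<and> restnorm m x < \<rho>}"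
  define Q' where "Q' = {x :: (real, 'n) vec. r3 \<le> znorm m x \<and> znorm m x \<le> r2 \<and> restnorm m x < \<sigma>}"
  have KQ: "K \<subseteq> Q" using \<rho> by (auto simp: K_def Q_def)
  have Q_range: "0 < znorm m x" "znorm m x < R1" "znorm m x < \<delta>" if "x \<in> Q" for x
    using that r4 r1 rs by (auto simp: Q_def)
  have w0: "0 \<le> w x" if "x \<in> Q" for x
    using Q_range[OF that] kpos[of "znorm m x"] by (simp add: w_def)
  have intQ: "(\<integral>\<^sup>+x. ennreal (w x) * indicator Q x \<partial>lborel) = ennreal (c1 * real m * (3 * T))"
    using nn_integral_shell[OF m1 mN km, of r4 r1 \<tau> \<rho>] \<tau> kpos r4 r1 rs
    by (simp add: w_def Q_def c1_def less_imp_le)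
  have intQ': "(\<integral>\<^sup>+x. ennreal (w x) * indicator Q' x \<partial>lborel) = ennreal (c2 * real m * T)"
    using nn_integral_shell[OF m1 mN km, of r3 r2 \<tau> \<sigma>] \<tau> kpos r3 r2 rs
    by (simp add: w_def Q'_def c2_def less_imp_le)
  define f where "f x = \<bar>u x\<bar> powr p * \<omega>1 (znorm m x)" for x
  have f_eq: "f x = w x * (plateau (\<tau> (znorm m x) / T) * \<phi> x) powr p" if x: "x \<in> Q" for x
  proof -
    note z = Q_range[OF x]
    let ?e = "exp (\<kappa> * \<tau> (znorm m x))" and ?g = "plateau (\<tau> (znorm m x) / T) * \<phi> x"
    have "u x = ?e * ?g" using z by (simp add: u_def h_def)
    hence "\<bar>u x\<bar> powr p = ?e powr p * ?g powr p"
      using plateau_props(1) \<phi>_bounds by (simp add: abs_mult powr_mult)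
    also have "?e powr p = exp (p * \<kappa> * \<tau> (znorm m x))" by (simp add: powr_def mult.assoc)
    finally show ?thesis
      by (simp add: f_def \<omega>1[OF z(1,2)] w_def exp_minus)
  qed
  have f_zero: "f x = 0" if "x \<notin> Q" for x using zero[of x] KQ that by (auto simp: f_def)
  \<comment> \<open>Factoring out k exp (\<kappa> \<tau>), the gradient is at most |\<kappa>| g
    \<phi> plus \<eta>. In its p-th power times \<open>\<omega>2\<close> the exponentials cancel and
    k^p k^(1-p) leaves k, so the main part is A times the left integrand and the error is a multiple
    of \<open>w\<close> alone.\<close>
  have le: "hgrad_norm op deg u x powr p * \<omega>2 (znorm m x) \<le> A * f x + B * \<eta> powr p * w x" if xK: "x \<in> K" for x
  proof -
    have x: "x \<in> Q" using xK KQ by auto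
    note z = Q_range[OF x]
    define r where "r = znorm m x"
    define E where "E = exp (\<kappa> * \<tau> r)"
    define g where "g = plateau (\<tau> r / T)"
    have r: "0 < r" "r < R1" "r < \<delta>0" using z \<delta> by (auto simp: r_def)
    have kr: "0 < k r" by (rule kpos[OF r(1,2)])
    have E: "0 < E" by (simp add: E_def)
    have g: "0 \<le> g" "g \<le> 1" using plateau_props by (auto simp: g_def)
    have "hgrad_norm op deg u x \<le> \<bar>h r\<bar> * hgrad_norm op deg \<phi> x + \<bar>h' r * \<phi> x\<bar>"
      unfolding r_def using KU xK by (intro hgrad_norm_product_le[OF u_C1 \<phi>' z(1)]) (auto simp: u'_def)
    also have "\<dots> \<le> E * H + k r * E * (\<bar>\<kappa>\<bar> * (g * \<phi> x) + 4 / T)"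
    proof (rule add_mono)
      have "x \<in> Q0" using x z \<delta> by (auto simp: Q_def Q0_def)
      hence "\<bar>h r\<bar> * hgrad_norm op deg \<phi> x \<le> E * H"
        using H H_nonneg E g hgrad_norm_nonneg[OF G m1 ml, of \<phi> x]
        by (intro mult_mono) (auto simp: h_def abs_mult mult_left_le simp flip: E_def g_def)
      thus "\<bar>h r\<bar> * hgrad_norm op deg \<phi> x \<le> E * H" .
      have "\<bar>\<kappa> * g + plateau' (\<tau> r / T) / T\<bar> * \<phi> x \<le> (\<bar>\<kappa>\<bar> * g + 4 / T) * \<phi> x"
      proof (intro mult_right_mono order_trans[OF abs_triangle_ineq] add_mono)
        show "\<bar>plateau' (\<tau> r / T) / T\<bar> \<le> 4 / T" using T plateau_props(6) by (simp add: abs_divide divide_right_mono)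
      qed (use g \<phi>_bounds in \<open>auto simp: abs_mult\<close>)
      also have "\<dots> = \<bar>\<kappa>\<bar> * (g * \<phi> x) + 4 / T * \<phi> x" by (simp add: algebra_simps)
      also have "4 / T * \<phi> x \<le> 4 / T * 1" using T \<phi>_bounds by (intro mult_left_mono) auto
      finally have *: "\<bar>\<kappa> * g + plateau' (\<tau> r / T) / T\<bar> * \<phi> x \<le> \<bar>\<kappa>\<bar> * (g * \<phi> x) + 4 / T" by simp
      have "\<bar>h' r * \<phi> x\<bar> = k r * E * (\<bar>\<kappa> * g + plateau' (\<tau> r / T) / T\<bar> * \<phi> x)"
        using kr E \<phi>_bounds by (simp add: h'_def abs_mult flip: E_def g_def)
      also have "\<dots> \<le> k r * E * (\<bar>\<kappa>\<bar> * (g * \<phi> x) + 4 / T)"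
        using * kr E by (intro mult_left_mono) auto
      finally show "\<bar>h' r * \<phi> x\<bar> \<le> k r * E * (\<bar>\<kappa>\<bar> * (g * \<phi> x) + 4 / T)" .
    qed
    also have "E * H = k r * E * (H * (1 / k r))" using kr by simp
    also have "k r * E * (H * (1 / k r)) + k r * E * (\<bar>\<kappa>\<bar> * (g * \<phi> x) + 4 / T)
        = k r * E * (\<bar>\<kappa>\<bar> * (g * \<phi> x) + (H * (1 / k r) + 4 / T))" by (simp add: distrib_left)
    also have "\<dots> \<le> k r * E * (\<bar>\<kappa>\<bar> * (g * \<phi> x) + \<eta>)"
    proof -
      have "H * (1 / k r) + 4 / T \<le> \<eta>" using \<delta>0(2)[OF r(1,3)] T4 by linarith
      thus ?thesis using kr E by (intro mult_left_mono add_left_mono) auto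
    qed
    finally have "hgrad_norm op deg u x powr p \<le> (k r * E * (\<bar>\<kappa>\<bar> * (g * \<phi> x) + \<eta>)) powr p"
      using p hgrad_norm_nonneg[OF G m1 ml] by (intro powr_mono2) auto
    also have "\<dots> = k r powr p * E powr p * (\<bar>\<kappa>\<bar> * (g * \<phi> x) + \<eta>) powr p"
      using kr E g \<phi>_bounds \<eta> by (simp add: powr_mult)
    also have "\<dots> \<le> k r powr p * E powr p * (A * (g * \<phi> x) powr p + B * \<eta> powr p)"
      using powr_add_le[OF p \<theta>, of "\<bar>\<kappa>\<bar> * (g * \<phi> x)" \<eta>] g \<phi>_bounds \<eta>
      by (intro mult_left_mono) (auto simp: A_def B_def powr_mult mult.assoc)
    finally have 1: "hgrad_norm op deg u x powr p \<le> k r powr p * E powr p * (A * (g * \<phi> x) powr p + B * \<eta> powr p)" .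
    have \<omega>2r: "\<omega>2 r = exp (- (p * \<kappa> * \<tau> r)) * k r powr (1 - p) * r powr (1 - real m)" by (rule \<omega>2[OF r(1,2)])
    hence "0 \<le> \<omega>2 r" by simp
    hence "hgrad_norm op deg u x powr p * \<omega>2 r
      \<le> (k r powr p * E powr p * (A * (g * \<phi> x) powr p + B * \<eta> powr p)) * \<omega>2 r"
      by (intro mult_right_mono 1)
    also have "\<dots> = (k r powr p * k r powr (1 - p)) * (E powr p * exp (- (p * \<kappa> * \<tau> r))) * r powr (1 - real m)
        * (A * (g * \<phi> x) powr p + B * \<eta> powr p)"
      by (simp only: \<omega>2r mult.assoc mult.commute mult.left_commute)
    also have "k r powr p * k r powr (1 - p) = k r" using kr by (simp flip: powr_add)
    also have "E powr p * exp (- (p * \<kappa> * \<tau> r)) = 1"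
      by (simp add: E_def powr_def mult.assoc flip: exp_add)
    also have "k r * 1 * r powr (1 - real m) = w x" by (simp add: w_def r_def)
    also have "w x * (A * (g * \<phi> x) powr p + B * \<eta> powr p) = A * f x + B * \<eta> powr p * w x"
      using f_eq[OF x] by (simp add: g_def r_def algebra_simps)
    finally show ?thesis by (simp add: r_def)
  qed
  note km[measurable] \<omega>1m[measurable]
  have [measurable]: "u \<in> borel_measurable borel"
    by (intro borel_measurable_continuous_onI has_C1_derivativeD(3)[OF u_C1])
  have [measurable]: "f \<in> borel_measurable borel" "w \<in> borel_measurable borel" "Q \<in> sets borel"
    unfolding f_def w_def Q_def by measurable
  have f0: "0 \<le> f x" for x using f_eq[of x] f_zero[of x] w0[of x] by (cases "x \<in> Q") auto
  have f_le: "f x \<le> w x" if "x \<in> Q" for x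
  proof -
    let ?g = "plateau (\<tau> (znorm m x) / T) * \<phi> x"
    have "0 \<le> ?g" "?g \<le> 1"
      by (simp add: plateau_props \<phi>_bounds, intro mult_le_one plateau_props \<phi>_bounds)
    hence "?g powr p \<le> 1 powr p" using p by (intro powr_mono2) auto
    thus ?thesis using f_eq[OF that] w0[OF that] by (simp add: mult_left_le)
  qed
  define I where "I = (\<integral>\<^sup>+x. ennreal (f x) \<partial>lborel)"
  \<comment> \<open>Finiteness of the left integral is needed to pass from \<open>ennreal\<close> to
    reals, where the strict comparison is made.\<close>
  have "I \<le> (\<integral>\<^sup>+x. ennreal (w x) * indicator Q x \<partial>lborel)"
    unfolding I_def using f_le f_zero by (intro nn_integral_mono) (auto simp: indicator_def intro: ennreal_leI)
  hence "I < \<infinity>" unfolding intQ using ennreal_less_top le_less_trans by (metis infinity_ennreal_def)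
  then obtain i where i: "0 \<le> i" "I = ennreal i" by (cases I) auto
  have "(\<integral>\<^sup>+x. ennreal (w x) * indicator Q' x \<partial>lborel) \<le> I"
    unfolding I_def
  proof (intro nn_integral_mono)
    fix x :: "(real, 'n) vec"
    show "ennreal (w x) * indicator Q' x \<le> ennreal (f x)"
    proof (cases "x \<in> Q'")
      case True
      hence x: "x \<in> Q" using rs \<sigma> \<rho> by (auto simp: Q'_def Q_def \<sigma>_def)
      have "T * 2 \<le> \<tau> (znorm m x)" "\<tau> (znorm m x) \<le> T * 3"
        using True ord'[of "znorm m x" r2] ord'[of r3 "znorm m x"] r2 r3 Q_range[OF x] by (auto simp: Q'_def)
      hence "plateau (\<tau> (znorm m x) / T) = 1"
        using T by (intro plateau_props(3)) (auto simp: field_simps)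
      moreover have "\<phi> x = 1" using True by (intro \<phi>_one) (simp add: Q'_def)
      ultimately show ?thesis using True f_eq[OF x] by simp
    qed simp
  qed
  hence i': "c2 * real m * T \<le> i" unfolding intQ' i using i by (simp add: ennreal_le_iff)
  have "0 < c2 * real m * T" using c T(1) m1 by (intro mult_pos_pos) auto
  hence i_pos: "0 < i" using i' by linarith
  have "(\<integral>\<^sup>+x. ennreal (hgrad_norm op deg u x powr p * \<omega>2 (znorm m x)) \<partial>lborel)
    \<le> (\<integral>\<^sup>+x. ennreal A * ennreal (f x) + ennreal (B * \<eta> powr p) * (ennreal (w x) * indicator Q x) \<partial>lborel)"
  proof (intro nn_integral_mono)
    fix x :: "(real, 'n) vec"
    show "ennreal (hgrad_norm op deg u x powr p * \<omega>2 (znorm m x))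
      \<le> ennreal A * ennreal (f x) + ennreal (B * \<eta> powr p) * (ennreal (w x) * indicator Q x)"
    proof (cases "x \<in> K")
      case True
      hence x: "x \<in> Q" using KQ by auto
      have "ennreal (hgrad_norm op deg u x powr p * \<omega>2 (znorm m x)) \<le> ennreal (A * f x + B * \<eta> powr p * w x)"
        by (rule ennreal_leI[OF le[OF True]])
      also have "\<dots> = ennreal A * ennreal (f x) + ennreal (B * \<eta> powr p) * (ennreal (w x) * indicator Q x)"
        using x AB f0[of x] w0[OF x] by (simp add: ennreal_plus ennreal_mult)
      finally show ?thesis .
    next
      case False
      have "hgrad_norm op deg u x = 0"
        by (rule hgrad_norm_zero_outside[OF G m1 ml u_C1 compact_imp_closed[OF K]]) (use zero False in auto)
      thus ?thesis using p by simp
    qed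
  qed
  also have "\<dots> = ennreal A * I + ennreal (B * \<eta> powr p) * ennreal (c1 * real m * (3 * T))"
    unfolding I_def intQ[symmetric] by (subst nn_integral_add) (auto simp: nn_integral_cmult)
  also have "\<dots> = ennreal (A * i + B * \<eta> powr p * (c1 * real m * (3 * T)))"
    using AB i c T by (simp add: ennreal_mult ennreal_plus)
  finally have upper: "(\<integral>\<^sup>+x. ennreal (hgrad_norm op deg u x powr p * \<omega>2 (znorm m x)) \<partial>lborel)
    \<le> ennreal (A * i + B * \<eta> powr p * (c1 * real m * (3 * T)))" .
  \<comment> \<open>T cancels from the comparison: errors and main term are both linear in T, and
    the choice of \<open>X\<close> makes the former at most (C - A)/2 times the left
    integral.\<close>
  have "B * \<eta> powr p * (c1 * real m * (3 * T)) = (B * \<eta> powr p * (3 * c1)) * (real m * T)" by simp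
  also have "\<dots> = (C - A) / 2 * (c2 * real m * T)" unfolding \<eta>(2) X(2) by simp
  also have "\<dots> \<le> (C - A) / 2 * i" using i' AB by (intro mult_left_mono) auto
  finally have "A * i + B * \<eta> powr p * (c1 * real m * (3 * T)) \<le> A * i + (C - A) / 2 * i" by simp
  also have "\<dots> < C * i"
  proof -
    have "0 < (C - A) / 2 * i" using i_pos AB by (intro mult_pos_pos) auto
    thus ?thesis by (simp add: field_simps)
  qed
  finally have *: "A * i + B * \<eta> powr p * (c1 * real m * (3 * T)) < C * i" .
  have "ennreal C * I = ennreal (C * i)" using AB i by (simp add: ennreal_mult)
  moreover have "0 < C * i" using AB i_pos by (intro mult_pos_pos) auto
  ultimately have "ennreal (A * i + B * \<eta> powr p * (c1 * real m * (3 * T))) < ennreal C * I"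
    using ennreal_lessI[OF _ *] by simp
  with upper have "(\<integral>\<^sup>+x. ennreal (hgrad_norm op deg u x powr p * \<omega>2 (znorm m x)) \<partial>lborel) < ennreal C * I"
    by (rule le_less_trans)
  moreover have "u \<in> C1_0 {x. 0 < znorm m x \<and> znorm m x < \<rho> \<and> restnorm m x < \<rho>}"
    by (rule C1_0I[OF u_C1 K _ zero]) (use KQ Q_range \<delta> in \<open>force simp: Q_def\<close>)+
  ultimately show ?thesis unfolding I_def f_def by (intro bexI[of _ u]) (auto simp: not_le)
qed

end

section \<open>The clocks for the power and the logarithmic weight\<close>

lemma C1_0_mono: "u \<in> C1_0 \<Omega> \<Longrightarrow> \<Omega> \<subseteq> \<Omega>' \<Longrightarrow> u \<in> C1_0 \<Omega>'"
  by (auto simp: C1_0_def)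

text \<open>Applying ln x \<le> x to x = sqrt (R/r) gives r ln(R/r) \<le> 2 sqrt (R r). In the
  logarithmic case this is the required decay of 1/k.\<close>

lemma tendsto_mult_ln_divide_zero:
  fixes R :: real
  assumes "0 < R"
  shows "((\<lambda>r. r * ln (R / r)) \<longlongrightarrow> 0) (at_right 0)"
proof (rule tendsto_sandwich[OF _ _ tendsto_const])
  have r: "eventually (\<lambda>r. r \<in> {0<..<R}) (at_right 0)" using assms by (rule eventually_at_right_real)
  show "eventually (\<lambda>r. 0 \<le> r * ln (R / r)) (at_right 0)"
    using r by eventually_elim (auto simp: field_simps)
  show "eventually (\<lambda>r. r * ln (R / r) \<le> 2 * sqrt (R * r)) (at_right 0)"
    using r
  proof eventually_elim
    fix r assume "r \<in> {0<..<R}"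
    hence r: "0 < r" by simp
    have "ln (R / r) = 2 * ln (sqrt (R / r))" using r assms by (simp add: ln_sqrt)
    also have "\<dots> \<le> 2 * sqrt (R / r)" using ln_bound[of "sqrt (R / r)"] r assms by simp
    finally have "r * ln (R / r) \<le> r * (2 * sqrt (R / r))" using r by (intro mult_left_mono) auto
    also have "\<dots> = 2 * sqrt (R * r)"
    proof -
      have "r * sqrt (R / r) = sqrt (r * r) * sqrt (R / r)" using r by simp
      also have "\<dots> = sqrt (R * r)" unfolding real_sqrt_mult[symmetric] using r by simp
      finally show ?thesis by simp
    qed
    finally show "r * ln (R / r) \<le> 2 * sqrt (R * r)" .
  qed
  have "((\<lambda>r. 2 * sqrt (R * r)) \<longlongrightarrow> 2 * sqrt (R * 0)) (at_right 0)" by (intro tendsto_intros)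
  thus "((\<lambda>r. 2 * sqrt (R * r)) \<longlongrightarrow> 0) (at_right 0)" by simp
qed

context
  fixes op :: "(real, 'n::{finite,linorder}) vec \<Rightarrow> (real, 'n) vec \<Rightarrow> (real, 'n) vec"
    and deg :: "'n \<Rightarrow> nat" and m :: nat
  assumes G: "hcarnot op deg" and m1: "1 \<le> m" and ml: "m \<le> card (layer deg 1)"
begin

text \<open>The clock is -ln |z|, so k = 1/|z| and exp (\<kappa> \<tau>) is the critical power
  |z|^(-(m+\<beta>)/p), for which the left integrand is exactly |z|^(-m).\<close>

lemma hardy_power_sharp:
  assumes p: "1 < p" and \<rho>: "0 < \<rho>" "{x. 0 < znorm m x \<and> znorm m x < \<rho> \<and> restnorm m x < \<rho>} \<subseteq> \<Omega>"
    and C: "(\<bar>real m + \<beta>\<bar> / p) powr p < C"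
  shows "\<exists>u\<in>C1_0 \<Omega>. \<not> (ennreal C *
               (\<integral>\<^sup>+x\<in>\<Omega>. ennreal (\<bar>u x\<bar> powr p * znorm m x powr \<beta>) \<partial>lborel)
             \<le> (\<integral>\<^sup>+x\<in>\<Omega>. ennreal (hgrad_norm op deg u x powr p * znorm m x powr (p + \<beta>)) \<partial>lborel))"
proof -
  define \<kappa> where "\<kappa> = (real m + \<beta>) / p"
  have \<kappa>: "\<bar>\<kappa>\<bar> powr p < C" using C p by (simp add: \<kappa>_def abs_divide)
  have "\<exists>u\<in>C1_0 {x. 0 < znorm m x \<and> znorm m x < \<rho> \<and> restnorm m x < \<rho>}.
    \<not> (ennreal C * (\<integral>\<^sup>+x. ennreal (\<bar>u x\<bar> powr p * znorm m x powr \<beta>) \<partial>lborel)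
      \<le> (\<integral>\<^sup>+x. ennreal (hgrad_norm op deg u x powr p * znorm m x powr (p + \<beta>)) \<partial>lborel))"
  proof (rule hardy_sharp[OF G m1 ml p \<rho>(1) zero_less_one \<kappa>, where \<tau> = "\<lambda>r. - ln r" and k = "\<lambda>r. 1 / r"
        and ?a0.0 = 1 and ?\<omega>1.0 = "\<lambda>r. r powr \<beta>" and ?\<omega>2.0 = "\<lambda>r. r powr (p + \<beta>)"])
    show "((\<lambda>r. - ln r) has_real_derivative - (1 / r)) (at r)" if "0 < r" for r :: real
      using that DERIV_minus[OF DERIV_ln_divide] by simp
    show "continuous_on {0<..<1} (\<lambda>r::real. 1 / r)" by (intro continuous_intros) auto
    show "((\<lambda>r. 1 / (1 / r)) \<longlongrightarrow> 0) (at_right (0::real))" by simp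
    \<comment> \<open>The clock is used on 0 < r < 1, so times a \<ge> 1 are reached at exp
      (-a).\<close>
    show "\<exists>r>0. r < 1 \<and> - ln r = a" if "1 \<le> a" for a :: real
      using that by (intro exI[of _ "exp (- a)"]) auto
    have e: "exp (- (p * \<kappa> * - ln r)) = r powr (real m + \<beta>)" if "0 < r" for r
      using that p by (simp add: \<kappa>_def powr_def)
    have inv: "1 / r = r powr - 1" if "0 < r" for r :: real using that by (simp add: powr_minus_divide)
    show "r powr \<beta> = exp (- (p * \<kappa> * - ln r)) * (1 / r) * r powr (1 - real m)" if "0 < r" for r
      unfolding e[OF that] unfolding inv[OF that] powr_add[symmetric] by simp
    show "r powr (p + \<beta>) = exp (- (p * \<kappa> * - ln r)) * (1 / r) powr (1 - p) * r powr (1 - real m)" if "0 < r" for r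
      unfolding e[OF that] unfolding inv[OF that] powr_powr powr_add[symmetric] by (simp add: add.commute)
  qed auto
  then obtain u where u: "u \<in> C1_0 {x. 0 < znorm m x \<and> znorm m x < \<rho> \<and> restnorm m x < \<rho>}"
    and not_le: "\<not> (ennreal C * (\<integral>\<^sup>+x. ennreal (\<bar>u x\<bar> powr p * znorm m x powr \<beta>) \<partial>lborel)
      \<le> (\<integral>\<^sup>+x. ennreal (hgrad_norm op deg u x powr p * znorm m x powr (p + \<beta>)) \<partial>lborel))" by blast
  have u\<Omega>: "u \<in> C1_0 \<Omega>" by (rule C1_0_mono[OF u \<rho>(2)])
  have "(\<integral>\<^sup>+x\<in>\<Omega>. ennreal (\<bar>u x\<bar> powr p * znorm m x powr \<beta>) \<partial>lborel)
      = (\<integral>\<^sup>+x. ennreal (\<bar>u x\<bar> powr p * znorm m x powr \<beta>) \<partial>lborel)"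
    using p by (intro C1_0_set_integrals(1)[OF G m1 ml u\<Omega>]) auto
  moreover have "(\<integral>\<^sup>+x\<in>\<Omega>. ennreal (hgrad_norm op deg u x powr p * znorm m x powr (p + \<beta>)) \<partial>lborel)
      = (\<integral>\<^sup>+x. ennreal (hgrad_norm op deg u x powr p * znorm m x powr (p + \<beta>)) \<partial>lborel)"
    using p by (intro C1_0_set_integrals(2)[OF G m1 ml u\<Omega>]) auto
  ultimately show ?thesis using not_le u\<Omega> by (intro bexI[of _ u]) simp_all
qed

text \<open>The clock is ln ln(R/|z|), so k = 1/(|z| ln(R/|z|)) and exp (\<kappa> \<tau>) is the
  critical profile ln(R/|z|)^(-(\<beta>+1)/p).\<close>

lemma hardy_log_sharp:
  assumes p: "p = real m" "1 < p" and R: "0 < R" and \<rho>: "0 < \<rho>"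
    and \<Omega>: "{x. 0 < znorm m x \<and> znorm m x < \<rho> \<and> restnorm m x < \<rho>} \<subseteq> \<Omega>"
    and C: "(\<bar>\<beta> + 1\<bar> / p) powr p < C"
  shows "\<exists>u\<in>C1_0 \<Omega>. \<not> (ennreal C *
               (\<integral>\<^sup>+x\<in>\<Omega>. ennreal (\<bar>u x\<bar> powr p / znorm m x powr p * ln (R / znorm m x) powr \<beta>) \<partial>lborel)
             \<le> (\<integral>\<^sup>+x\<in>\<Omega>. ennreal (hgrad_norm op deg u x powr p * ln (R / znorm m x) powr (p + \<beta>)) \<partial>lborel))"
proof -
  define \<kappa> where "\<kappa> = - (\<beta> + 1) / p"
  have "\<bar>\<kappa>\<bar> = \<bar>\<beta> + 1\<bar> / p" unfolding \<kappa>_def abs_divide abs_minus_cancel using p by simp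
  hence \<kappa>: "\<bar>\<kappa>\<bar> powr p < C" using C by simp
  have L: "0 < ln (R / r)" if "0 < r" "r < R" for r using that by (intro ln_gt_zero) simp
  have p\<kappa>: "p * \<kappa> = - (\<beta> + 1)" using p by (simp add: \<kappa>_def)
  have "\<exists>u\<in>C1_0 {x. 0 < znorm m x \<and> znorm m x < \<rho> \<and> restnorm m x < \<rho>}.
    \<not> (ennreal C * (\<integral>\<^sup>+x. ennreal (\<bar>u x\<bar> powr p * (1 / znorm m x powr p * ln (R / znorm m x) powr \<beta>)) \<partial>lborel)
      \<le> (\<integral>\<^sup>+x. ennreal (hgrad_norm op deg u x powr p * ln (R / znorm m x) powr (p + \<beta>)) \<partial>lborel))"
  proof (rule hardy_sharp[OF G m1 ml p(2) \<rho> R \<kappa>, where \<tau> = "\<lambda>r. ln (ln (R / r))" and k = "\<lambda>r. 1 / (r * ln (R / r))"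
        and ?a0.0 = 0 and ?\<omega>1.0 = "\<lambda>r. 1 / r powr p * ln (R / r) powr \<beta>" and ?\<omega>2.0 = "\<lambda>r. ln (R / r) powr (p + \<beta>)"])
    show "((\<lambda>r. ln (ln (R / r))) has_real_derivative - (1 / (r * ln (R / r)))) (at r)" if r: "0 < r" "r < R" for r
    proof -
      have "((\<lambda>r. R / r) has_real_derivative (0 * r - R * 1) / (r * r)) (at r)"
        using r by (intro DERIV_divide DERIV_const DERIV_ident) auto
      from DERIV_chain2[OF DERIV_ln_divide this]
      have "((\<lambda>r. ln (R / r)) has_real_derivative 1 / (R / r) * ((0 * r - R * 1) / (r * r))) (at r)" using r by simp
      from DERIV_chain2[OF DERIV_ln_divide[OF L[OF r]] this]
      have "((\<lambda>r. ln (ln (R / r))) has_real_derivative 1 / ln (R / r) * (1 / (R / r) * ((0 * r - R * 1) / (r * r)))) (at r)" .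
      moreover have "1 / ln (R / r) * (1 / (R / r) * ((0 * r - R * 1) / (r * r))) = - (1 / (r * ln (R / r)))"
        using r R L[OF r] by (simp add: divide_simps)
      ultimately show ?thesis by (simp only:)
    qed
    show "continuous_on {0<..<R} (\<lambda>r. 1 / (r * ln (R / r)))"
      by (intro continuous_intros) (use R L in \<open>force+\<close>)
    show "(\<lambda>r. 1 / (r * ln (R / r))) \<in> borel_measurable borel" by measurable
    show "((\<lambda>r. 1 / (1 / (r * ln (R / r)))) \<longlongrightarrow> 0) (at_right 0)" using tendsto_mult_ln_divide_zero[OF R] by simp
    show "\<exists>r>0. r < R \<and> ln (ln (R / r)) = a" for a
    proof -
      have "R / (R * exp (- exp a)) = exp (exp a)" using R by (simp add: exp_minus field_simps)
      thus ?thesis using R by (intro exI[of _ "R * exp (- exp a)"]) simp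
    qed
    show "(\<lambda>r. 1 / r powr p * ln (R / r) powr \<beta>) \<in> borel_measurable borel" by measurable
    have e: "exp (- (p * \<kappa> * ln (ln (R / r)))) = ln (R / r) powr (\<beta> + 1)" if "0 < r" "r < R" for r
    proof -
      have "exp (- (p * \<kappa> * ln (ln (R / r)))) = exp ((\<beta> + 1) * ln (ln (R / r)))"
        by (simp only: p\<kappa> mult_minus_left minus_minus)
      thus ?thesis using L[OF that] by (simp add: powr_def)
    qed
    have inv: "1 / (r * ln (R / r)) = r powr - 1 * ln (R / r) powr - 1" if "0 < r" "r < R" for r
      using L[OF that] that by (simp add: powr_minus_divide)
    show "1 / r powr p * ln (R / r) powr \<beta>
        = exp (- (p * \<kappa> * ln (ln (R / r)))) * (1 / (r * ln (R / r))) * r powr (1 - real m)" if r: "0 < r" "r < R" for r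
    proof -
      have "exp (- (p * \<kappa> * ln (ln (R / r)))) * (1 / (r * ln (R / r))) * r powr (1 - real m)
        = (ln (R / r) powr (\<beta> + 1) * ln (R / r) powr - 1) * (r powr - 1 * r powr (1 - real m))"
        unfolding e[OF r] unfolding inv[OF r] by (simp only: mult.assoc mult.commute mult.left_commute)
      also have "\<dots> = ln (R / r) powr \<beta> * r powr - p" unfolding powr_add[symmetric] using p by simp
      finally show ?thesis by (simp add: powr_minus_divide)
    qed
    show "ln (R / r) powr (p + \<beta>)
        = exp (- (p * \<kappa> * ln (ln (R / r)))) * (1 / (r * ln (R / r))) powr (1 - p) * r powr (1 - real m)" if r: "0 < r" "r < R" for r
    proof -
      have "(r powr - 1 * ln (R / r) powr - 1) powr (1 - p) = r powr (p - 1) * ln (R / r) powr (p - 1)"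
      proof -
        have "(r powr - 1 * ln (R / r) powr - 1) powr (1 - p) = (r powr - 1) powr (1 - p) * (ln (R / r) powr - 1) powr (1 - p)"
          by (intro powr_mult powr_ge_zero)
        thus ?thesis unfolding powr_powr by simp
      qed
      hence "exp (- (p * \<kappa> * ln (ln (R / r)))) * (1 / (r * ln (R / r))) powr (1 - p) * r powr (1 - real m)
        = (ln (R / r) powr (\<beta> + 1) * ln (R / r) powr (p - 1)) * (r powr (p - 1) * r powr (1 - real m))"
        unfolding e[OF r] unfolding inv[OF r] by (simp only: mult.assoc mult.commute mult.left_commute)
      also have "\<dots> = ln (R / r) powr (p + \<beta>) * r powr 0" unfolding powr_add[symmetric] using p by (simp add: add.commute)
      finally show ?thesis using r by simp
    qed
  qed (use L in auto)
  then obtain u where u: "u \<in> C1_0 {x. 0 < znorm m x \<and> znorm m x < \<rho> \<and> restnorm m x < \<rho>}"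
    and not_le: "\<not> (ennreal C * (\<integral>\<^sup>+x. ennreal (\<bar>u x\<bar> powr p / znorm m x powr p * ln (R / znorm m x) powr \<beta>) \<partial>lborel)
      \<le> (\<integral>\<^sup>+x. ennreal (hgrad_norm op deg u x powr p * ln (R / znorm m x) powr (p + \<beta>)) \<partial>lborel))" by auto
  have u\<Omega>: "u \<in> C1_0 \<Omega>" by (rule C1_0_mono[OF u \<Omega>])
  have "(\<integral>\<^sup>+x\<in>\<Omega>. ennreal (\<bar>u x\<bar> powr p / znorm m x powr p * ln (R / znorm m x) powr \<beta>) \<partial>lborel)
      = (\<integral>\<^sup>+x. ennreal (\<bar>u x\<bar> powr p / znorm m x powr p * ln (R / znorm m x) powr \<beta>) \<partial>lborel)"
    using p by (intro C1_0_set_integrals(1)[OF G m1 ml u\<Omega>]) auto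
  moreover have "(\<integral>\<^sup>+x\<in>\<Omega>. ennreal (hgrad_norm op deg u x powr p * ln (R / znorm m x) powr (p + \<beta>)) \<partial>lborel)
      = (\<integral>\<^sup>+x. ennreal (hgrad_norm op deg u x powr p * ln (R / znorm m x) powr (p + \<beta>)) \<partial>lborel)"
    using p by (intro C1_0_set_integrals(2)[OF G m1 ml u\<Omega>]) auto
  ultimately show ?thesis using not_le u\<Omega> by (intro bexI[of _ u]) simp_all
qed

section \<open>Unweighted corollaries and homogeneous norms\<close>

lemma hardy_unweighted:
  assumes p: "1 < p" and u: "u \<in> C1_0 \<Omega>" and neg: "real m - p < 0 \<Longrightarrow> \<forall>x\<in>\<Omega>. znorm m x \<noteq> 0"
  shows "ennreal ((\<bar>real m - p\<bar> / p) powr p) *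
           (\<integral>\<^sup>+x\<in>\<Omega>. ennreal (\<bar>u x\<bar> powr p / znorm m x powr p) \<partial>lborel)
         \<le> (\<integral>\<^sup>+x\<in>\<Omega>. ennreal (hgrad_norm op deg u x powr p) \<partial>lborel)"
proof -
  have "ennreal ((\<bar>real m + - p\<bar> / p) powr p) *
           (\<integral>\<^sup>+x\<in>\<Omega>. ennreal (\<bar>u x\<bar> powr p * znorm m x powr - p) \<partial>lborel)
         \<le> (\<integral>\<^sup>+x\<in>\<Omega>. ennreal (hgrad_norm op deg u x powr p * znorm m x powr (p + - p)) \<partial>lborel)"
    by (rule hardy_power[OF G m1 ml p u]) (use neg in simp)
  \<comment> \<open>With \<beta> = -p the right weight is |z|^0, which \<open>powr\<close> evaluates
    to 0 rather than 1 at z = 0; hence an inequality.\<close>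
  also have "\<dots> \<le> (\<integral>\<^sup>+x\<in>\<Omega>. ennreal (hgrad_norm op deg u x powr p) \<partial>lborel)"
    by (intro nn_integral_mono mult_right_mono ennreal_leI) auto
  finally show ?thesis by (simp add: powr_minus_divide)
qed

text \<open>The comparison can fail pointwise on z = 0, where division by 0 makes the right
  integrand 0 although N may be positive; that set is null.\<close>

lemma hardy_comparison:
  fixes N :: "(real, 'n) vec \<Rightarrow> real"
  assumes p: "0 < p" and c: "0 < c" and N: "\<And>x. c * znorm m x \<le> N x"
  shows "(\<integral>\<^sup>+x\<in>\<Omega>. ennreal (\<bar>u x\<bar> powr p / N x powr p) \<partial>lborel)
    \<le> (\<integral>\<^sup>+x\<in>\<Omega>. ennreal (\<bar>u x\<bar> powr p / (c * znorm m x) powr p) \<partial>lborel)"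
proof (rule nn_integral_mono_AE, rule AE_mp[OF AE_znorm_nonzero[OF G m1 ml]], intro AE_I2 impI)
  fix x :: "(real, 'n) vec" assume "znorm m x \<noteq> 0"
  hence z: "0 < c * znorm m x" using c znorm_nonneg[of m x] by (simp add: less_le)
  hence "(c * znorm m x) powr p \<le> N x powr p" using N[of x] p by (intro powr_mono2) auto
  moreover have "0 < (c * znorm m x) powr p" using less_imp_neq[OF z] by simp
  ultimately have "\<bar>u x\<bar> powr p / N x powr p \<le> \<bar>u x\<bar> powr p / (c * znorm m x) powr p"
    by (intro frac_le) simp_all
  thus "ennreal (\<bar>u x\<bar> powr p / N x powr p) * indicator \<Omega> x
    \<le> ennreal (\<bar>u x\<bar> powr p / (c * znorm m x) powr p) * indicator \<Omega> x"
    by (intro mult_right_mono ennreal_leI) simp_all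
qed

lemma hardy_hom_norm:
  assumes p: "1 < p" "p \<noteq> real m" and neg: "real m - p < 0 \<Longrightarrow> \<forall>x\<in>\<Omega>. znorm m x \<noteq> 0"
    and \<Omega>: "open \<Omega>" and N: "hom_norm op deg N"
  shows "\<exists>c>0. \<forall>u\<in>C1_0 \<Omega>.
           ennreal c * (\<integral>\<^sup>+x\<in>\<Omega>. ennreal (\<bar>u x\<bar> powr p / N x powr p) \<partial>lborel)
           \<le> (\<integral>\<^sup>+x\<in>\<Omega>. ennreal (hgrad_norm op deg u x powr p) \<partial>lborel)"
proof -
  obtain c where c: "0 < c" "\<And>x. c * znorm m x \<le> N x"
    using znorm_le_hom_norm[OF G m1 ml N] by blast
  \<comment> \<open>The factor c^p from the norm comparison is merged with the Hardy constant, which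
    is positive because p differs from m.\<close>
  define K where "K = (\<bar>real m - p\<bar> / p) powr p"
  have K: "0 < K" using p by (simp add: K_def)
  show ?thesis
  proof (intro exI[of _ "K * c powr p"] conjI ballI)
    show "0 < K * c powr p" using K c by simp
    fix u assume u: "u \<in> C1_0 \<Omega>"
    note borel_measurable_C1_0[OF G m1 ml u, measurable]
    have [measurable]: "\<Omega> \<in> sets borel" using \<Omega> by (rule borel_open)
    have "ennreal (K * c powr p) * (\<integral>\<^sup>+x\<in>\<Omega>. ennreal (\<bar>u x\<bar> powr p / N x powr p) \<partial>lborel)
      \<le> ennreal (K * c powr p) * (\<integral>\<^sup>+x\<in>\<Omega>. ennreal (\<bar>u x\<bar> powr p / (c * znorm m x) powr p) \<partial>lborel)"
      using p by (intro mult_left_mono hardy_comparison c) auto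
    also have "\<dots> = ennreal K * (ennreal (c powr p) * (\<integral>\<^sup>+x\<in>\<Omega>. ennreal (\<bar>u x\<bar> powr p / (c * znorm m x) powr p) \<partial>lborel))"
      using K by (simp add: ennreal_mult mult.assoc)
    also have "ennreal (c powr p) * (\<integral>\<^sup>+x\<in>\<Omega>. ennreal (\<bar>u x\<bar> powr p / (c * znorm m x) powr p) \<partial>lborel)
      = (\<integral>\<^sup>+x\<in>\<Omega>. ennreal (\<bar>u x\<bar> powr p / znorm m x powr p) \<partial>lborel)"
    proof -
      have "c powr p * (a / (c * z) powr p) = a / z powr p" if "0 \<le> z" for a z
        using c that by (simp add: powr_mult)
      hence "ennreal (c powr p) * (ennreal (\<bar>u x\<bar> powr p / (c * znorm m x) powr p) * indicator \<Omega> x)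
          = ennreal (\<bar>u x\<bar> powr p / znorm m x powr p) * indicator \<Omega> x" for x
        by (simp only: mult.assoc[symmetric] ennreal_mult'[OF powr_ge_zero, symmetric] znorm_nonneg)
      moreover have "ennreal (c powr p) * (\<integral>\<^sup>+x\<in>\<Omega>. ennreal (\<bar>u x\<bar> powr p / (c * znorm m x) powr p) \<partial>lborel)
        = (\<integral>\<^sup>+x. ennreal (c powr p) * (ennreal (\<bar>u x\<bar> powr p / (c * znorm m x) powr p) * indicator \<Omega> x) \<partial>lborel)"
        by (rule nn_integral_cmult[symmetric]) measurable
      ultimately show ?thesis by (simp only:)
    qed
    also have "ennreal K * \<dots> \<le> (\<integral>\<^sup>+x\<in>\<Omega>. ennreal (hgrad_norm op deg u x powr p) \<partial>lborel)"
      unfolding K_def by (rule hardy_unweighted[OF p(1) u neg])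
    finally show "ennreal (K * c powr p) * (\<integral>\<^sup>+x\<in>\<Omega>. ennreal (\<bar>u x\<bar> powr p / N x powr p) \<partial>lborel)
           \<le> (\<integral>\<^sup>+x\<in>\<Omega>. ennreal (hgrad_norm op deg u x powr p) \<partial>lborel)" .
  qed
qed

lemma hardy_log_unweighted:
  assumes p: "p = real m" "1 < p" and R: "0 < R" and u: "u \<in> C1_0 {x. znorm m x < R}"
  shows "ennreal (((p - 1) / p) powr p) *
           (\<integral>\<^sup>+x\<in>{x. znorm m x < R}. ennreal (\<bar>u x\<bar> powr p / (znorm m x * ln (R / znorm m x)) powr p) \<partial>lborel)
         \<le> (\<integral>\<^sup>+x\<in>{x. znorm m x < R}. ennreal (hgrad_norm op deg u x powr p) \<partial>lborel)"
proof -
  \<comment> \<open>The logarithmic inequality is taken at exponent -p, which is below -1. Then |-p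
    + 1| = p - 1 and the right weight is ln(R/|z|)^0, at most 1.\<close>
  have "- p < - 1" and abs: "\<bar>- p + 1\<bar> = p - 1" using p(2) by simp_all
  have eq: "(\<integral>\<^sup>+x\<in>{x. znorm m x < R}. ennreal (\<bar>u x\<bar> powr p / (znorm m x * ln (R / znorm m x)) powr p) \<partial>lborel)
    = (\<integral>\<^sup>+x\<in>{x. znorm m x < R}. ennreal (\<bar>u x\<bar> powr p / znorm m x powr p * ln (R / znorm m x) powr - p) \<partial>lborel)"
  proof (intro nn_integral_cong)
    fix x :: "(real, 'n) vec"
    show "ennreal (\<bar>u x\<bar> powr p / (znorm m x * ln (R / znorm m x)) powr p) * indicator {x. znorm m x < R} x
      = ennreal (\<bar>u x\<bar> powr p / znorm m x powr p * ln (R / znorm m x) powr - p) * indicator {x. znorm m x < R} x"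
    proof (cases "znorm m x = 0 \<or> R \<le> znorm m x")
      case False
      hence z: "0 < znorm m x" using znorm_nonneg[of m x] by linarith
      hence "0 < ln (R / znorm m x)" using False by (intro ln_gt_zero) simp
      hence "(znorm m x * ln (R / znorm m x)) powr p = znorm m x powr p * ln (R / znorm m x) powr p"
        using z by (intro powr_mult less_imp_le)
      hence "\<bar>u x\<bar> powr p / (znorm m x * ln (R / znorm m x)) powr p
          = \<bar>u x\<bar> powr p / znorm m x powr p * ln (R / znorm m x) powr - p"
        unfolding powr_minus_divide by simp
      thus ?thesis by (simp only:)
    next
      case True
      thus ?thesis
      proof
        assume "R \<le> znorm m x"
        hence "indicator {x. znorm m x < R} x = (0 :: ennreal)" by (intro indicator_simps(2)) simp
        thus ?thesis by (simp only: mult_zero_right)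
      qed simp
    qed
  qed
  have "ennreal (((p - 1) / p) powr p) *
      (\<integral>\<^sup>+x\<in>{x. znorm m x < R}. ennreal (\<bar>u x\<bar> powr p / znorm m x powr p * ln (R / znorm m x) powr - p) \<partial>lborel)
    \<le> (\<integral>\<^sup>+x\<in>{x. znorm m x < R}. ennreal (hgrad_norm op deg u x powr p * ln (R / znorm m x) powr (p + - p)) \<partial>lborel)"
    using hardy_log[OF G m1 ml p R \<open>- p < - 1\<close> u] by (simp only: abs)
  also have "\<dots> \<le> (\<integral>\<^sup>+x\<in>{x. znorm m x < R}. ennreal (hgrad_norm op deg u x powr p) \<partial>lborel)"
    by (intro nn_integral_mono mult_right_mono ennreal_leI) auto
  finally show ?thesis unfolding eq .
qed

end

theorem mainTheorem16:
  fixes op :: "(real, 'n::{finite,linorder}) vec \<Rightarrow> (real, 'n) vec \<Rightarrow> (real, 'n) vec"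
    and deg :: "'n \<Rightarrow> nat" and m :: nat and \<beta> :: real
  assumes G: "hcarnot op deg"
    and m1: "1 \<le> m" and ml: "m \<le> card (layer deg 1)"
  shows
  \<comment> \<open>(1) main inequality, its corollaries, and sharpness\<close>
  "(\<forall>p::real. \<forall>\<Omega>. 1 < p \<and> open \<Omega> \<and> (real m + \<beta> < 0 \<longrightarrow> (\<forall>x\<in>\<Omega>. znorm m x \<noteq> 0)) \<longrightarrow>
      (\<forall>u\<in>C1_0 \<Omega>.
         ennreal ((\<bar>real m + \<beta>\<bar> / p) powr p) *
           (\<integral>\<^sup>+x\<in>\<Omega>. ennreal (\<bar>u x\<bar> powr p * znorm m x powr \<beta>) \<partial>lborel)
         \<le> (\<integral>\<^sup>+x\<in>\<Omega>. ennreal (hgrad_norm op deg u x powr p * znorm m x powr (p + \<beta>)) \<partial>lborel))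
    \<and> ((htype op deg \<and> m = card (layer deg 1) \<and>
        (\<exists>\<rho>>0. {x. 0 < znorm m x \<and> znorm m x < \<rho> \<and> restnorm m x < \<rho>} \<subseteq> \<Omega>)) \<longrightarrow>
        (\<forall>C. C > (\<bar>real m + \<beta>\<bar> / p) powr p \<longrightarrow>
          (\<exists>u\<in>C1_0 \<Omega>. \<not> (ennreal C *
               (\<integral>\<^sup>+x\<in>\<Omega>. ennreal (\<bar>u x\<bar> powr p * znorm m x powr \<beta>) \<partial>lborel)
             \<le> (\<integral>\<^sup>+x\<in>\<Omega>. ennreal (hgrad_norm op deg u x powr p * znorm m x powr (p + \<beta>)) \<partial>lborel))))))
   \<and> (\<forall>p::real. \<forall>\<Omega>. 1 < p \<and> open \<Omega> \<and> (real m - p < 0 \<longrightarrow> (\<forall>x\<in>\<Omega>. znorm m x \<noteq> 0)) \<longrightarrow>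
      (\<forall>u\<in>C1_0 \<Omega>.
         ennreal ((\<bar>real m - p\<bar> / p) powr p) *
           (\<integral>\<^sup>+x\<in>\<Omega>. ennreal (\<bar>u x\<bar> powr p / NS deg x powr p) \<partial>lborel)
         \<le> ennreal ((\<bar>real m - p\<bar> / p) powr p) *
           (\<integral>\<^sup>+x\<in>\<Omega>. ennreal (\<bar>u x\<bar> powr p / znorm m x powr p) \<partial>lborel)
       \<and> ennreal ((\<bar>real m - p\<bar> / p) powr p) *
           (\<integral>\<^sup>+x\<in>\<Omega>. ennreal (\<bar>u x\<bar> powr p / znorm m x powr p) \<partial>lborel)
         \<le> (\<integral>\<^sup>+x\<in>\<Omega>. ennreal (hgrad_norm op deg u x powr p) \<partial>lborel))
    \<and> (\<forall>Nf. hom_norm op deg Nf \<and> p \<noteq> real m \<longrightarrow>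
        (\<exists>c>0. \<forall>u\<in>C1_0 \<Omega>.
           ennreal c * (\<integral>\<^sup>+x\<in>\<Omega>. ennreal (\<bar>u x\<bar> powr p / Nf x powr p) \<partial>lborel)
           \<le> (\<integral>\<^sup>+x\<in>\<Omega>. ennreal (hgrad_norm op deg u x powr p) \<partial>lborel))))
  \<comment> \<open>(2) logarithmic inequality (p = m), its corollary, and sharpness\<close>
   \<and> (\<forall>R::real. \<forall>\<Omega>. let p = real m in
       1 < p \<and> 0 < R \<and> \<Omega> = {x. znorm m x < R} \<and> \<beta> < -1 \<longrightarrow>
      (\<forall>u\<in>C1_0 \<Omega>.
         ennreal ((\<bar>\<beta> + 1\<bar> / p) powr p) *
           (\<integral>\<^sup>+x\<in>\<Omega>. ennreal (\<bar>u x\<bar> powr p / znorm m x powr p * ln (R / znorm m x) powr \<beta>) \<partial>lborel)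
         \<le> (\<integral>\<^sup>+x\<in>\<Omega>. ennreal (hgrad_norm op deg u x powr p * ln (R / znorm m x) powr (p + \<beta>)) \<partial>lborel))
    \<and> (\<forall>u\<in>C1_0 \<Omega>.
         ennreal (((p - 1) / p) powr p) *
           (\<integral>\<^sup>+x\<in>\<Omega>. ennreal (\<bar>u x\<bar> powr p / (znorm m x * ln (R / znorm m x)) powr p) \<partial>lborel)
         \<le> (\<integral>\<^sup>+x\<in>\<Omega>. ennreal (hgrad_norm op deg u x powr p) \<partial>lborel))
    \<and> ((htype op deg \<and> m = card (layer deg 1) \<and>
        (\<exists>\<rho>>0. {x. 0 < znorm m x \<and> znorm m x < \<rho> \<and> restnorm m x < \<rho>} \<subseteq> \<Omega>)) \<longrightarrow>
        (\<forall>C. C > (\<bar>\<beta> + 1\<bar> / p) powr p \<longrightarrow>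
          (\<exists>u\<in>C1_0 \<Omega>. \<not> (ennreal C *
               (\<integral>\<^sup>+x\<in>\<Omega>. ennreal (\<bar>u x\<bar> powr p / znorm m x powr p * ln (R / znorm m x) powr \<beta>) \<partial>lborel)
             \<le> (\<integral>\<^sup>+x\<in>\<Omega>. ennreal (hgrad_norm op deg u x powr p * ln (R / znorm m x) powr (p + \<beta>)) \<partial>lborel))))))"
proof -
  have NS: "1 * znorm m x \<le> NS deg x" for x
    using znorm_le_NS[OF G m1 ml] by simp
  show ?thesis
    unfolding Let_def
  proof (intro conjI allI impI ballI; (elim conjE exE)?)
    fix p :: real and \<Omega> and u :: "(real, 'n) vec \<Rightarrow> real"
    assume p: "1 < p" and neg: "real m + \<beta> < 0 \<longrightarrow> (\<forall>x\<in>\<Omega>. znorm m x \<noteq> 0)" and u: "u \<in> C1_0 \<Omega>"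
    show "ennreal ((\<bar>real m + \<beta>\<bar> / p) powr p) *
           (\<integral>\<^sup>+x\<in>\<Omega>. ennreal (\<bar>u x\<bar> powr p * znorm m x powr \<beta>) \<partial>lborel)
         \<le> (\<integral>\<^sup>+x\<in>\<Omega>. ennreal (hgrad_norm op deg u x powr p * znorm m x powr (p + \<beta>)) \<partial>lborel)"
      by (rule hardy_power[OF G m1 ml p u]) (use neg in simp)
  next
    fix p C \<rho> :: real and \<Omega> :: "(real, 'n) vec set"
    assume p: "1 < p" and C: "(\<bar>real m + \<beta>\<bar> / p) powr p < C" and \<rho>: "0 < \<rho>"
      and \<Omega>: "{x. 0 < znorm m x \<and> znorm m x < \<rho> \<and> restnorm m x < \<rho>} \<subseteq> \<Omega>"
    show "\<exists>u\<in>C1_0 \<Omega>. \<not> (ennreal C *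
               (\<integral>\<^sup>+x\<in>\<Omega>. ennreal (\<bar>u x\<bar> powr p * znorm m x powr \<beta>) \<partial>lborel)
             \<le> (\<integral>\<^sup>+x\<in>\<Omega>. ennreal (hgrad_norm op deg u x powr p * znorm m x powr (p + \<beta>)) \<partial>lborel))"
      by (rule hardy_power_sharp[OF G m1 ml p \<rho> \<Omega> C])
  next
    fix p :: real and \<Omega> and u :: "(real, 'n) vec \<Rightarrow> real"
    assume p: "1 < p" and u: "u \<in> C1_0 \<Omega>"
    have "(\<integral>\<^sup>+x\<in>\<Omega>. ennreal (\<bar>u x\<bar> powr p / NS deg x powr p) \<partial>lborel)
      \<le> (\<integral>\<^sup>+x\<in>\<Omega>. ennreal (\<bar>u x\<bar> powr p / znorm m x powr p) \<partial>lborel)"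
      using hardy_comparison[OF G m1 ml _ zero_less_one NS, of p u \<Omega>] p by simp
    thus "ennreal ((\<bar>real m - p\<bar> / p) powr p) * (\<integral>\<^sup>+x\<in>\<Omega>. ennreal (\<bar>u x\<bar> powr p / NS deg x powr p) \<partial>lborel)
      \<le> ennreal ((\<bar>real m - p\<bar> / p) powr p) * (\<integral>\<^sup>+x\<in>\<Omega>. ennreal (\<bar>u x\<bar> powr p / znorm m x powr p) \<partial>lborel)"
      by (rule mult_left_mono) simp
  next
    fix p :: real and \<Omega> and u :: "(real, 'n) vec \<Rightarrow> real"
    assume p: "1 < p" and neg: "real m - p < 0 \<longrightarrow> (\<forall>x\<in>\<Omega>. znorm m x \<noteq> 0)" and u: "u \<in> C1_0 \<Omega>"
    show "ennreal ((\<bar>real m - p\<bar> / p) powr p) * (\<integral>\<^sup>+x\<in>\<Omega>. ennreal (\<bar>u x\<bar> powr p / znorm m x powr p) \<partial>lborel)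
      \<le> (\<integral>\<^sup>+x\<in>\<Omega>. ennreal (hgrad_norm op deg u x powr p) \<partial>lborel)"
      by (rule hardy_unweighted[OF G m1 ml p u]) (use neg in simp)
  next
    fix p :: real and \<Omega> :: "(real, 'n) vec set" and Nf
    assume p: "1 < p" "p \<noteq> real m" and \<Omega>: "open \<Omega>"
      and neg: "real m - p < 0 \<longrightarrow> (\<forall>x\<in>\<Omega>. znorm m x \<noteq> 0)" and N: "hom_norm op deg Nf"
    show "\<exists>c>0. \<forall>u\<in>C1_0 \<Omega>.
           ennreal c * (\<integral>\<^sup>+x\<in>\<Omega>. ennreal (\<bar>u x\<bar> powr p / Nf x powr p) \<partial>lborel)
           \<le> (\<integral>\<^sup>+x\<in>\<Omega>. ennreal (hgrad_norm op deg u x powr p) \<partial>lborel)"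
      by (rule hardy_hom_norm[OF G m1 ml p _ \<Omega> N]) (use neg in simp)
  next
    fix R :: real and \<Omega> and u :: "(real, 'n) vec \<Rightarrow> real"
    assume m: "1 < real m" and R: "0 < R" and \<Omega>: "\<Omega> = {x. znorm m x < R}" and \<beta>: "\<beta> < - 1" and u: "u \<in> C1_0 \<Omega>"
    show "ennreal ((\<bar>\<beta> + 1\<bar> / real m) powr real m) *
           (\<integral>\<^sup>+x\<in>\<Omega>. ennreal (\<bar>u x\<bar> powr real m / znorm m x powr real m * ln (R / znorm m x) powr \<beta>) \<partial>lborel)
         \<le> (\<integral>\<^sup>+x\<in>\<Omega>. ennreal (hgrad_norm op deg u x powr real m * ln (R / znorm m x) powr (real m + \<beta>)) \<partial>lborel)"
      using u unfolding \<Omega> by (rule hardy_log[OF G m1 ml refl m R \<beta>])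
  next
    fix R :: real and \<Omega> and u :: "(real, 'n) vec \<Rightarrow> real"
    assume m: "1 < real m" and R: "0 < R" and \<Omega>: "\<Omega> = {x. znorm m x < R}" and u: "u \<in> C1_0 \<Omega>"
    show "ennreal (((real m - 1) / real m) powr real m) *
           (\<integral>\<^sup>+x\<in>\<Omega>. ennreal (\<bar>u x\<bar> powr real m / (znorm m x * ln (R / znorm m x)) powr real m) \<partial>lborel)
         \<le> (\<integral>\<^sup>+x\<in>\<Omega>. ennreal (hgrad_norm op deg u x powr real m) \<partial>lborel)"
      using u unfolding \<Omega> by (rule hardy_log_unweighted[OF G m1 ml refl m R])
  next
    fix R C \<rho> :: real and \<Omega> :: "(real, 'n) vec set"
    assume m: "1 < real m" and R: "0 < R" and C: "(\<bar>\<beta> + 1\<bar> / real m) powr real m < C" and \<rho>: "0 < \<rho>"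
      and \<Omega>: "{x. 0 < znorm m x \<and> znorm m x < \<rho> \<and> restnorm m x < \<rho>} \<subseteq> \<Omega>"
    show "\<exists>u\<in>C1_0 \<Omega>. \<not> (ennreal C *
               (\<integral>\<^sup>+x\<in>\<Omega>. ennreal (\<bar>u x\<bar> powr real m / znorm m x powr real m * ln (R / znorm m x) powr \<beta>) \<partial>lborel)
             \<le> (\<integral>\<^sup>+x\<in>\<Omega>. ennreal (hgrad_norm op deg u x powr real m * ln (R / znorm m x) powr (real m + \<beta>)) \<partial>lborel))"
      by (rule hardy_log_sharp[OF G m1 ml refl m R \<rho> \<Omega> C])
  qed
qed

end
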